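(* As $n\to\infty$, in the space $D[0,1]$, $$n^{-1/2}\bigl(X_{n,\lfloor nt\rfloor}-nt(1-t)\bigr)\overset{\mathrm d}{\longrightarrow}Z(t),$$ where $Z$ is a continuous Gaussian process on $[0,1]$ with mean $\mathbb E Z(t)=0$ and covariances $$\mathbb E\bigl(Z(s)Z(t)\bigr)=s^2(1-t)^2,\qquad 0\le s\le t\le1.$$
   Context: For $n\ge 2$ let $\sigma$ be a uniformly random permutation of $\{1,\dots,n\}$. For $0\le m\le n$ and $1\le k\le n$ let $I_{n,m}(k)=1$ if $\sigma^{-1}(k)\le m$ and $I_{n,m}(k)=0$ otherwise. Let $X_{n,m}$ be the number of runs (maximal blocks of consecutive ones) in the string $I_{n,m}(1),\dots,I_{n,m}(n)$, i.e. $$X_{n,m}=I_{n,m}(1)+\sum_{k=1}^{n-1}(1-I_{n,m}(k))I_{n,m}(k+1).$$ $D[0,1]$ is the space of right-continuous functions on $[0,1]$ with left-hand limits, equipped with the Skorohod topology; $\overset{\mathrm d}{\longrightarrow}$ denotes convergence in distribution of random elements of this space. *)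

theory Defs
  imports "HOL-Probability.Probability" "HOL-Combinatorics.Permutations"
begin

section \<open>The Skorohod space \<open>D[0,1]\<close>\<close>

definition cadlag_on_unit :: "(real \<Rightarrow> real) \<Rightarrow> bool" where
  "cadlag_on_unit x \<longleftrightarrow>
     (\<forall>t\<in>{0..<1}. (x \<longlongrightarrow> x t) (at t within {t<..1})) \<and>
     (\<forall>t\<in>{0<..1}. \<exists>l. (x \<longlongrightarrow> l) (at t within {0..<t}))"

text \<open>A function on \<open>[0,1]\<close> is represented by its unique extensional extension to the real line.\<close>

typedef cadlag = "{x. x \<in> extensional {0..1} \<and> cadlag_on_unit x}"
  morphisms cadlag_fun Abs_cadlag
proof
  show "(\<lambda>t\<in>{0..1}. 0) \<in> {x. x \<in> extensional {0..1} \<and> cadlag_on_unit x}"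
    unfolding cadlag_on_unit_def
  proof (intro CollectI conjI ballI exI[of _ 0])
    fix t :: real assume "t \<in> {0..<1}"
    then show "((\<lambda>t\<in>{0..1}. 0) \<longlongrightarrow> (\<lambda>t\<in>{0..1}. 0::real) t) (at t within {t<..1})"
      by (intro tendsto_eventually) (auto simp: eventually_at_filter)
  next
    fix t :: real assume "t \<in> {0<..1}"
    then show "((\<lambda>t\<in>{0..1}. 0::real) \<longlongrightarrow> 0) (at t within {0..<t})"
      by (intro tendsto_eventually) (auto simp: eventually_at_filter)
  qed auto
qed

text \<open>The path in \<open>D[0,1]\<close> of a function given on the real line; meaningful only if that function
  is cadlag on \<open>[0,1]\<close>, see \<open>cadlag_fun_path\<close>.\<close>

definition cadlag_path :: "(real \<Rightarrow> real) \<Rightarrow> cadlag" where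
  "cadlag_path x = Abs_cadlag (restrict x {0..1})"

lemma cadlag_fun_path:
  assumes "cadlag_on_unit x"
  shows "cadlag_fun (cadlag_path x) = restrict x {0..1}"
proof -
  have "cadlag_on_unit (restrict x {0..1})"
    unfolding cadlag_on_unit_def
  proof (intro conjI ballI)
    fix t :: real assume t: "t \<in> {0..<1}"
    have "(x \<longlongrightarrow> x t) (at t within {t<..1})"
      using assms t by (auto simp: cadlag_on_unit_def)
    moreover have "\<forall>\<^sub>F s in at t within {t<..1}. x s = restrict x {0..1} s"
      using t by (auto simp: eventually_at_filter)
    ultimately show "(restrict x {0..1} \<longlongrightarrow> restrict x {0..1} t) (at t within {t<..1})"
      using t Lim_transform_eventually by fastforce
  next
    fix t :: real assume t: "t \<in> {0<..1}"
    then obtain l where "(x \<longlongrightarrow> l) (at t within {0..<t})"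
      using assms unfolding cadlag_on_unit_def by blast
    moreover have "\<forall>\<^sub>F s in at t within {0..<t}. x s = restrict x {0..1} s"
      using t by (auto simp: eventually_at_filter)
    ultimately show "\<exists>l. (restrict x {0..1} \<longlongrightarrow> l) (at t within {0..<t})"
      by (blast intro: Lim_transform_eventually)
  qed
  then show ?thesis
    unfolding cadlag_path_def by (intro Abs_cadlag_inverse) auto
qed

lemma cadlag_on_unit_continuous:
  assumes "continuous_on {0..1} x"
  shows "cadlag_on_unit x"
  unfolding cadlag_on_unit_def
proof (intro conjI ballI)
  fix t :: real assume "t \<in> {0..<1}"
  then have "(x \<longlongrightarrow> x t) (at t within {0..1})" "{t<..1} \<subseteq> {0..1}"
    using assms by (auto simp: continuous_on_def)
  then show "(x \<longlongrightarrow> x t) (at t within {t<..1})"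
    by (rule tendsto_within_subset)
next
  fix t :: real assume "t \<in> {0<..1}"
  then have "(x \<longlongrightarrow> x t) (at t within {0..1})" "{0..<t} \<subseteq> {0..1}"
    using assms by (auto simp: continuous_on_def)
  then have "(x \<longlongrightarrow> x t) (at t within {0..<t})"
    by (rule tendsto_within_subset)
  then show "\<exists>l. (x \<longlongrightarrow> l) (at t within {0..<t})" ..
qed

definition time_changes :: "(real \<Rightarrow> real) set" where
  "time_changes =
     {l. continuous_on {0..1} l \<and> strict_mono_on {0..1} l \<and> l ` {0..1} = {0..1}}"

text \<open>The set whose infimum is the Skorohod distance of \<open>x\<close> and \<open>y\<close>.\<close>

definition skorohod_close :: "(real \<Rightarrow> real) \<Rightarrow> (real \<Rightarrow> real) \<Rightarrow> real set" where
  "skorohod_close x y =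
     {e. e > 0 \<and> (\<exists>l\<in>time_changes. \<forall>t\<in>{0..1}. \<bar>l t - t\<bar> \<le> e \<and> \<bar>x t - y (l t)\<bar> \<le> e)}"

lemma time_changes_id: "id \<in> time_changes"
  by (auto simp: time_changes_def strict_mono_on_def)

lemma time_changes_comp:
  assumes "l \<in> time_changes" "k \<in> time_changes"
  shows "k \<circ> l \<in> time_changes"
proof -
  have l: "continuous_on {0..1} l" "strict_mono_on {0..1} l" "l ` {0..1} = {0..1}"
    and k: "continuous_on {0..1} k" "strict_mono_on {0..1} k" "k ` {0..1} = {0..1}"
    using assms by (auto simp only: time_changes_def mem_Collect_eq)
  have "(k \<circ> l) ` {0..1} = {0..1}" by (simp only: image_comp[symmetric] l k)
  moreover have "continuous_on {0..1} (k \<circ> l)"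
    using l k by (intro continuous_on_compose) simp_all
  moreover have "strict_mono_on {0..1} (k \<circ> l)"
    by (rule strict_mono_onI) (metis comp_apply imageI k(2) l(2,3) strict_mono_onD)
  ultimately show ?thesis by (simp only: time_changes_def mem_Collect_eq simp_thms)
qed

lemma time_changes_inv:
  assumes "l \<in> time_changes"
  shows "inv_into {0..1} l \<in> time_changes"
proof -
  have c: "continuous_on {0..1} l" and m: "strict_mono_on {0..1} l" and im: "l ` {0..1} = {0..1}"
    using assms by (auto simp: time_changes_def)
  have inj: "inj_on l {0..1}" using m by (rule strict_mono_on_imp_inj_on)
  have "continuous_on (l ` {0..1}) (inv_into {0..1} l)"
    using c inj by (intro continuous_on_inv) (auto simp: inj)
  moreover have "inv_into {0..1} l ` {0..1} = {0..1}"
    using inj im by (metis inv_into_image_cancel order_refl)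
  moreover have "strict_mono_on {0..1} (inv_into {0..1} l)"
  proof (rule strict_mono_onI)
    fix r s :: real assume rs: "r \<in> {0..1}" "s \<in> {0..1}" "r < s"
    define a b where "a = inv_into {0..1} l r" and "b = inv_into {0..1} l s"
    have ab: "a \<in> {0..1}" "b \<in> {0..1}" "l a = r" "l b = s"
      using rs im by (auto simp: a_def b_def inv_into_into f_inv_into_f simp del: atLeastAtMost_iff)
    show "a < b"
    proof (rule ccontr)
      assume "\<not> a < b"
      then consider "b < a" | "a = b" by linarith
      then show False
      proof cases
        case 1
        then have "l b < l a" using strict_mono_onD[OF m ab(2,1)] by blast
        then show False using ab rs by simp
      qed (use ab rs in simp)
    qed
  qed
  ultimately show ?thesis using im by (simp add: time_changes_def)
qed

lemma cadlag_on_unit_bounded: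
  assumes "cadlag_on_unit x"
  shows "\<exists>B. \<forall>t\<in>{0..1}. \<bar>x t\<bar> \<le> B"
proof -
  have "\<exists>U B. open U \<and> t \<in> U \<and> (\<forall>s\<in>U \<inter> {0..1}. \<bar>x s\<bar> \<le> B)" if t: "t \<in> {0..1}" for t
  proof -
    have "\<exists>U B. open U \<and> t \<in> U \<and> (\<forall>s\<in>U \<inter> {t<..1}. \<bar>x s\<bar> \<le> B)"
    proof (cases "t < 1")
      case True
      then have "(x \<longlongrightarrow> x t) (at t within {t<..1})"
        using assms t by (auto simp: cadlag_on_unit_def)
      then have "\<forall>\<^sub>F s in at t within {t<..1}. dist (x s) (x t) < 1"
        by (rule tendstoD) simp
      then obtain U where U: "open U" "t \<in> U" "\<forall>s\<in>U. s \<noteq> t \<longrightarrow> s \<in> {t<..1} \<longrightarrow> dist (x s) (x t) < 1"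
        unfolding eventually_at_topological by blast
      then have "\<forall>s\<in>U \<inter> {t<..1}. \<bar>x s\<bar> \<le> \<bar>x t\<bar> + 1"
        by (fastforce simp: dist_real_def)
      then show ?thesis using U by blast
    next
      case False
      then show ?thesis using t by (intro exI[of _ UNIV]) auto
    qed
    then obtain U B where U: "open U" "t \<in> U" "\<forall>s\<in>U \<inter> {t<..1}. \<bar>x s\<bar> \<le> B" by blast
    have "\<exists>U B. open U \<and> t \<in> U \<and> (\<forall>s\<in>U \<inter> {0..<t}. \<bar>x s\<bar> \<le> B)"
    proof (cases "t > 0")
      case True
      then obtain l where "(x \<longlongrightarrow> l) (at t within {0..<t})"
        using assms t unfolding cadlag_on_unit_def by (metis atLeastAtMost_iff greaterThanAtMost_iff)
      then have "\<forall>\<^sub>F s in at t within {0..<t}. dist (x s) l < 1"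
        by (rule tendstoD) simp
      then obtain U where U: "open U" "t \<in> U" "\<forall>s\<in>U. s \<noteq> t \<longrightarrow> s \<in> {0..<t} \<longrightarrow> dist (x s) l < 1"
        unfolding eventually_at_topological by blast
      then have "\<forall>s\<in>U \<inter> {0..<t}. \<bar>x s\<bar> \<le> \<bar>l\<bar> + 1"
        by (fastforce simp: dist_real_def)
      then show ?thesis using U by blast
    next
      case False
      then show ?thesis using t by (intro exI[of _ UNIV]) auto
    qed
    then obtain V C where V: "open V" "t \<in> V" "\<forall>s\<in>V \<inter> {0..<t}. \<bar>x s\<bar> \<le> C" by blast
    have "\<bar>x s\<bar> \<le> max \<bar>x t\<bar> (max B C)" if s: "s \<in> (U \<inter> V) \<inter> {0..1}" for s
    proof -
      consider "s < t" | "s = t" | "s > t" by linarith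
      then show ?thesis
      proof cases
        case 1
        then have "\<bar>x s\<bar> \<le> C" using V s by auto
        then show ?thesis by linarith
      next
        case 3
        then have "\<bar>x s\<bar> \<le> B" using U s by auto
        then show ?thesis by linarith
      qed auto
    qed
    then show ?thesis using U V
      by (intro exI[of _ "U \<inter> V"] exI[of _ "max \<bar>x t\<bar> (max B C)"]) auto
  qed
  then obtain U B where UB: "\<And>t. t \<in> {0..1} \<Longrightarrow> open (U t) \<and> t \<in> U t \<and> (\<forall>s\<in>U t \<inter> {0..1}. \<bar>x s\<bar> \<le> B t)"
    by metis
  have "{0..1::real} \<subseteq> (\<Union>t\<in>{0..1}. U t)" using UB by blast
  then obtain T where T: "T \<subseteq> {0..1}" "finite T" "{0..1} \<subseteq> (\<Union>t\<in>T. U t)"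
    using UB by (metis compactE_image compact_Icc)
  have "\<bar>x s\<bar> \<le> (\<Sum>t\<in>T. \<bar>B t\<bar>)" if s: "s \<in> {0..1}" for s
  proof -
    obtain t where t: "t \<in> T" "s \<in> U t" using T s by blast
    then have "\<bar>x s\<bar> \<le> \<bar>B t\<bar>" using UB[of t] T s by force
    also have "\<dots> \<le> (\<Sum>t\<in>T. \<bar>B t\<bar>)" using t T by (intro member_le_sum) auto
    finally show ?thesis .
  qed
  then show ?thesis by blast
qed

lemma cadlag_fun_cadlag: "cadlag_on_unit (cadlag_fun x)"
  using cadlag_fun[of x] by simp

lemma skorohod_close_nonempty: "skorohod_close (cadlag_fun x) (cadlag_fun y) \<noteq> {}"
proof -
  obtain B C where
    B: "\<forall>t\<in>{0..1}. \<bar>cadlag_fun x t\<bar> \<le> B" and C: "\<forall>t\<in>{0..1}. \<bar>cadlag_fun y t\<bar> \<le> C"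
    using cadlag_on_unit_bounded cadlag_fun_cadlag by metis
  have "\<bar>B\<bar> + \<bar>C\<bar> + 1 \<in> skorohod_close (cadlag_fun x) (cadlag_fun y)"
    unfolding skorohod_close_def
  proof (intro CollectI conjI bexI[OF _ time_changes_id] ballI)
    fix t :: real assume t: "t \<in> {0..1}"
    show "\<bar>cadlag_fun x t - cadlag_fun y (id t)\<bar> \<le> \<bar>B\<bar> + \<bar>C\<bar> + 1"
      using B[rule_format, OF t] C[rule_format, OF t] by simp
  qed auto
  then show ?thesis by blast
qed

lemma skorohod_close_bdd: "bdd_below (skorohod_close x y)"
  by (rule bdd_belowI[of _ 0]) (auto simp: skorohod_close_def)

lemma skorohod_close_sym:
  assumes "e \<in> skorohod_close x y"
  shows "e \<in> skorohod_close y x"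
proof -
  obtain l where l: "l \<in> time_changes" "e > 0"
    "\<And>t. t \<in> {0..1} \<Longrightarrow> \<bar>l t - t\<bar> \<le> e \<and> \<bar>x t - y (l t)\<bar> \<le> e"
    using assms by (auto simp: skorohod_close_def)
  have "\<bar>inv_into {0..1} l t - t\<bar> \<le> e \<and> \<bar>y t - x (inv_into {0..1} l t)\<bar> \<le> e"
    if "t \<in> {0..1}" for t
  proof -
    have "t \<in> l ` {0..1}" using that l by (simp add: time_changes_def)
    then have "inv_into {0..1} l t \<in> {0..1}" "l (inv_into {0..1} l t) = t"
      by (auto simp: inv_into_into f_inv_into_f simp del: atLeastAtMost_iff)
    then show ?thesis using l(3)[of "inv_into {0..1} l t"] by (simp add: abs_minus_commute)
  qed
  then show ?thesis unfolding skorohod_close_def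
    by (intro CollectI conjI bexI[of _ "inv_into {0..1} l"] ballI l(2) time_changes_inv[OF l(1)]) blast+
qed

lemma skorohod_close_triangle:
  assumes "e \<in> skorohod_close x y" "d \<in> skorohod_close y z"
  shows "e + d \<in> skorohod_close x z"
proof -
  obtain l where l: "l \<in> time_changes" "e > 0"
    "\<And>t. t \<in> {0..1} \<Longrightarrow> \<bar>l t - t\<bar> \<le> e \<and> \<bar>x t - y (l t)\<bar> \<le> e"
    using assms by (auto simp: skorohod_close_def)
  obtain k where k: "k \<in> time_changes" "d > 0"
    "\<And>t. t \<in> {0..1} \<Longrightarrow> \<bar>k t - t\<bar> \<le> d \<and> \<bar>y t - z (k t)\<bar> \<le> d"
    using assms by (auto simp: skorohod_close_def)
  have "\<bar>(k \<circ> l) t - t\<bar> \<le> e + d \<and> \<bar>x t - z ((k \<circ> l) t)\<bar> \<le> e + d" if "t \<in> {0..1}" for t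
  proof -
    have "l t \<in> {0..1}" using that l by (auto simp: time_changes_def)
    then show ?thesis using l(3)[OF that] k(3)[of "l t"] unfolding o_def by linarith
  qed
  then show ?thesis using l k time_changes_comp[OF l(1) k(1)]
    unfolding skorohod_close_def by (intro CollectI conjI bexI[of _ "k \<circ> l"]) auto
qed

lemma skorohod_close_eq:
  assumes x: "cadlag_on_unit x" and y: "cadlag_on_unit y"
    and close: "\<And>d. d > 0 \<Longrightarrow> \<exists>e\<in>skorohod_close x y. e < d"
    and t: "t \<in> {0..1}"
  shows "x t = y t"
proof -
  have "\<bar>x t - y t\<bar> \<le> 0 + d" if d: "d > 0" for d
  proof (cases "t = 1")
    case True
    obtain e l where el: "e < d" "l \<in> time_changes"
      "\<And>t. t \<in> {0..1} \<Longrightarrow> \<bar>l t - t\<bar> \<le> e \<and> \<bar>x t - y (l t)\<bar> \<le> e"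
      using close[OF d] by (auto simp: skorohod_close_def)
    have im: "l ` {0..1} = {0..1}" and m: "strict_mono_on {0..1} l"
      using el by (auto simp: time_changes_def)
    have "1 \<in> l ` {0..1}" by (simp add: im)
    then obtain s where s: "s \<in> {0..1}" "l s = 1" by (metis imageE)
    have "l 1 \<in> l ` {0..1}" by (rule imageI) simp
    then have "l 1 \<le> 1" unfolding im by simp
    moreover have "l 1 > 1" if "s \<noteq> 1"
      using strict_mono_onD[OF m, of s 1] s that by simp
    ultimately have "l 1 = 1" using s by fastforce
    then show ?thesis using el(3)[of 1] el(1) True by simp
  next
    case False
    then have t': "t \<in> {0..<1}" using t by auto
    define r where "r = d / 3"
    have r: "r > 0" using d by (simp add: r_def)
    have "\<forall>\<^sub>F s in at t within {t<..1}. dist (x s) (x t) < r \<and> dist (y s) (y t) < r"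
      using x y t' r by (intro eventually_conj tendstoD) (auto simp: cadlag_on_unit_def)
    then obtain h where h: "h > 0"
      "\<And>s. s \<in> {t<..1} \<Longrightarrow> dist s t < h \<Longrightarrow> \<bar>x s - x t\<bar> < r \<and> \<bar>y s - y t\<bar> < r"
      unfolding eventually_at by (force simp: dist_real_def)
    define g where "g = min h (1 - t)"
    have g: "g > 0" "g \<le> h" "g \<le> 1 - t" using h t' by (auto simp: g_def)
    obtain e l where el: "e < min (g / 4) r" "l \<in> time_changes"
      "\<And>t. t \<in> {0..1} \<Longrightarrow> \<bar>l t - t\<bar> \<le> e \<and> \<bar>x t - y (l t)\<bar> \<le> e"
      using close[of "min (g / 4) r"] g r by (auto simp: skorohod_close_def)
    define s where "s = t + g / 2"
    have s: "s \<in> {0..1}" "s \<in> {t<..1}" "dist s t < h"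
      using g t' by (auto simp: s_def dist_real_def)
    have "\<bar>l s - s\<bar> < g / 4" using el(3)[OF s(1)] el(1) by linarith
    then have ls: "l s > t" "l s < t + g" by (auto simp: s_def) (simp_all add: abs_if field_simps split: if_splits)
    then have "l s \<in> {t<..1}" "dist (l s) t < h" using g by (auto simp: dist_real_def)
    then have "\<bar>y (l s) - y t\<bar> < r" using h by blast
    moreover have "\<bar>x s - x t\<bar> < r" using h s by blast
    moreover have "\<bar>x s - y (l s)\<bar> < r" using el(3)[OF s(1)] el(1) by linarith
    ultimately have "\<bar>x t - y t\<bar> < 3 * r" by linarith
    then show ?thesis by (simp add: r_def)
  qed
  then have "\<bar>x t - y t\<bar> \<le> 0" by (rule field_le_epsilon)
  then show ?thesis by simp
qed

text \<open>The \<open>J\<^sub>1\<close> metric of Billingsley, Convergence of Probability Measures, Section 12.\<close>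

instantiation cadlag :: metric_space
begin

definition dist_cadlag :: "cadlag \<Rightarrow> cadlag \<Rightarrow> real" where
  "dist_cadlag x y = Inf (skorohod_close (cadlag_fun x) (cadlag_fun y))"

definition uniformity_cadlag :: "(cadlag \<times> cadlag) filter" where
  "uniformity_cadlag = (INF e\<in>{0<..}. principal {(x, y). dist x y < e})"

definition open_cadlag :: "cadlag set \<Rightarrow> bool" where
  "open_cadlag U \<longleftrightarrow> (\<forall>x\<in>U. \<forall>\<^sub>F (x', y) in uniformity. x' = x \<longrightarrow> y \<in> U)"

instance
proof
  fix x y z :: cadlag
  let ?S = "\<lambda>x y. skorohod_close (cadlag_fun x) (cadlag_fun y)"
  have small: "\<exists>e\<in>?S x y. e < c" if "dist x y < c" for x y c
    using that unfolding dist_cadlag_def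
    by (simp add: cInf_less_iff[OF skorohod_close_nonempty skorohod_close_bdd])
  have le: "dist x y \<le> e" if "e \<in> ?S x y" for x y e
    using that unfolding dist_cadlag_def by (rule cInf_lower[OF _ skorohod_close_bdd])
  show "(dist x y = 0) = (x = y)"
  proof
    assume "dist x y = 0"
    then have "\<exists>e\<in>?S x y. e < d" if "d > 0" for d using small[of x y d] that by simp
    then have "cadlag_fun x t = cadlag_fun y t" if "t \<in> {0..1}" for t
      using that by (rule skorohod_close_eq[OF cadlag_fun_cadlag cadlag_fun_cadlag])
    then have "cadlag_fun x = cadlag_fun y"
      using cadlag_fun[of x] cadlag_fun[of y] by (intro extensionalityI[of _ "{0..1}"]) auto
    then show "x = y" by (simp add: cadlag_fun_inject)
  next
    assume "x = y"
    have "e \<in> ?S x x" if "e > 0" for e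
      using that unfolding skorohod_close_def
      by (intro CollectI conjI bexI[OF _ time_changes_id]) auto
    then have "dist x y \<le> 0 + e" if "e > 0" for e using le that \<open>x = y\<close> by auto
    then have "dist x y \<le> 0" by (rule field_le_epsilon)
    moreover have "dist x y \<ge> 0"
      unfolding dist_cadlag_def using skorohod_close_nonempty
      by (intro cInf_greatest) (auto simp: skorohod_close_def)
    ultimately show "dist x y = 0" by simp
  qed
  show "dist x y \<le> dist x z + dist y z"
  proof (rule field_le_epsilon)
    fix c :: real assume c: "c > 0"
    obtain d where d: "d \<in> ?S x z" "d < dist x z + c / 2"
      using small[of x z "dist x z + c / 2"] c half_gt_zero less_add_same_cancel1 by blast
    obtain e where e: "e \<in> ?S y z" "e < dist y z + c / 2"
      using small[of y z "dist y z + c / 2"] c half_gt_zero less_add_same_cancel1 by blast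
    have "d + e \<in> ?S x y" using skorohod_close_triangle[OF d(1) skorohod_close_sym[OF e(1)]] .
    then have "dist x y \<le> d + e" by (rule le)
    then show "dist x y \<le> dist x z + dist y z + c" using d e by simp
  qed
qed (rule uniformity_cadlag_def open_cadlag_def)+

end

section \<open>Convergence in distribution\<close>

definition converges_in_distribution ::
  "(nat \<Rightarrow> 'a measure) \<Rightarrow> (nat \<Rightarrow> 'a \<Rightarrow> 'c::topological_space) \<Rightarrow> 'b measure \<Rightarrow> ('b \<Rightarrow> 'c) \<Rightarrow> bool"
where
  "converges_in_distribution M X N Y \<longleftrightarrow>
     (\<forall>n. prob_space (M n) \<and> X n \<in> measurable (M n) borel) \<and>
     prob_space N \<and> Y \<in> measurable N borel \<and>
     (\<forall>f :: 'c \<Rightarrow> real. continuous_on UNIV f \<and> bounded (range f) \<longrightarrow>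
        (\<lambda>n. \<integral>\<omega>. f (X n \<omega>) \<partial>M n) \<longlonglongrightarrow> (\<integral>\<omega>. f (Y \<omega>) \<partial>N))"

section \<open>Gaussian processes\<close>

text \<open>Degenerate normal distributions are included; they occur in the limit process, which
  vanishes at the times 0 and 1.\<close>

definition normal_variable :: "'a measure \<Rightarrow> ('a \<Rightarrow> real) \<Rightarrow> bool" where
  "normal_variable M Y \<longleftrightarrow> Y \<in> borel_measurable M \<and>
     (\<exists>\<mu>. (AE \<omega> in M. Y \<omega> = \<mu>) \<or> (\<exists>\<sigma>>0. distributed M lborel Y (normal_density \<mu> \<sigma>)))"

definition gaussian_process :: "'a measure \<Rightarrow> 'i set \<Rightarrow> ('i \<Rightarrow> 'a \<Rightarrow> real) \<Rightarrow> bool" where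
  "gaussian_process M T Z \<longleftrightarrow> prob_space M \<and>
     (\<forall>t\<in>T. Z t \<in> borel_measurable M) \<and>
     (\<forall>F a. finite F \<and> F \<subseteq> T \<longrightarrow> normal_variable M (\<lambda>\<omega>. \<Sum>t\<in>F. a t * Z t \<omega>))"

definition limit_process :: "'a measure \<Rightarrow> (real \<Rightarrow> 'a \<Rightarrow> real) \<Rightarrow> bool" where
  "limit_process M Z \<longleftrightarrow>
     gaussian_process M {0..1} Z \<and>
     (\<forall>\<omega>\<in>space M. continuous_on {0..1} (\<lambda>t. Z t \<omega>)) \<and>
     (\<forall>t\<in>{0..1}. (\<integral>\<omega>. Z t \<omega> \<partial>M) = 0) \<and>
     (\<forall>s t. 0 \<le> s \<and> s \<le> t \<and> t \<le> 1 \<longrightarrow> (\<integral>\<omega>. Z s \<omega> * Z t \<omega> \<partial>M) = s\<^sup>2 * (1 - t)\<^sup>2)"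

section \<open>Runs in a random permutation\<close>

definition random_perm :: "nat \<Rightarrow> (nat \<Rightarrow> nat) measure" where
  "random_perm n = measure_pmf (pmf_of_set {\<sigma>. \<sigma> permutes {1..n}})"

definition occupied :: "(nat \<Rightarrow> nat) \<Rightarrow> nat \<Rightarrow> nat \<Rightarrow> int" where
  "occupied \<sigma> m k = (if inv \<sigma> k \<le> m then 1 else 0)"

definition runs :: "nat \<Rightarrow> nat \<Rightarrow> (nat \<Rightarrow> nat) \<Rightarrow> int" where
  "runs n m \<sigma> = occupied \<sigma> m 1 + (\<Sum>k=1..n-1. (1 - occupied \<sigma> m k) * occupied \<sigma> m (k + 1))"

definition scaled_runs :: "nat \<Rightarrow> (nat \<Rightarrow> nat) \<Rightarrow> real \<Rightarrow> real" where
  "scaled_runs n \<sigma> t =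
     (real_of_int (runs n (nat \<lfloor>real n * t\<rfloor>) \<sigma>) - real n * t * (1 - t)) / sqrt (real n)"

lemma cadlag_on_unit_scaled_runs: "cadlag_on_unit (scaled_runs n \<sigma>)"
proof (cases "n = 0")
  case True
  then have "scaled_runs n \<sigma> = (\<lambda>t. 0)" by (simp add: scaled_runs_def fun_eq_iff)
  then show ?thesis by (simp add: cadlag_on_unit_continuous)
next
  case False
  define g where "g = (\<lambda>c t. (real_of_int (runs n (nat c) \<sigma>) - real n * t * (1 - t)) / sqrt (real n))"
  have S: "scaled_runs n \<sigma> t = g \<lfloor>real n * t\<rfloor> t" for t by (simp add: g_def scaled_runs_def)
  have lim: "(g c \<longlongrightarrow> g c t) (at t within A)" for c t A
    using False unfolding g_def by (auto intro!: tendsto_intros)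
  show ?thesis unfolding cadlag_on_unit_def
  proof (intro conjI ballI)
    fix t :: real assume "t \<in> {0..<1}"
    have "((\<lambda>s. real n * s) \<longlongrightarrow> real n * t) (at t within {t<..1})" by (intro tendsto_intros)
    then have "\<forall>\<^sub>F s in at t within {t<..1}. real n * s < real_of_int \<lfloor>real n * t\<rfloor> + 1"
      by (rule order_tendstoD) linarith
    moreover have "\<forall>\<^sub>F s in at t within {t<..1}. t < s" by (simp add: eventually_at_filter)
    ultimately have "\<forall>\<^sub>F s in at t within {t<..1}. g \<lfloor>real n * t\<rfloor> s = scaled_runs n \<sigma> s"
    proof eventually_elim
      case (elim s)
      then have "real n * t \<le> real n * s" by (simp add: mult_left_mono)
      then have "\<lfloor>real n * s\<rfloor> = \<lfloor>real n * t\<rfloor>" using elim by linarith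
      then show ?case by (simp add: S)
    qed
    with lim show "(scaled_runs n \<sigma> \<longlongrightarrow> scaled_runs n \<sigma> t) (at t within {t<..1})"
      unfolding S[of t] by (rule Lim_transform_eventually)
  next
    fix t :: real assume "t \<in> {0<..1}"
    have "((\<lambda>s. real n * s) \<longlongrightarrow> real n * t) (at t within {0..<t})" by (intro tendsto_intros)
    then have "\<forall>\<^sub>F s in at t within {0..<t}. real_of_int (\<lceil>real n * t\<rceil> - 1) < real n * s"
      by (rule order_tendstoD) linarith
    moreover have "\<forall>\<^sub>F s in at t within {0..<t}. s < t" by (simp add: eventually_at_filter)
    ultimately have "\<forall>\<^sub>F s in at t within {0..<t}. g (\<lceil>real n * t\<rceil> - 1) s = scaled_runs n \<sigma> s"
    proof eventually_elim
      case (elim s)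
      then have "real n * s < real n * t" using False by simp
      then have "\<lfloor>real n * s\<rfloor> = \<lceil>real n * t\<rceil> - 1" using elim by linarith
      then show ?case by (simp add: S)
    qed
    with lim show "\<exists>l. (scaled_runs n \<sigma> \<longlongrightarrow> l) (at t within {0..<t})"
      by (blast intro: Lim_transform_eventually)
  qed
qed

end

theory Submission
  imports Defs "HOL-Real_Asymp.Real_Asymp"
begin

text \<open>Let \<open>Y\<^sub>m\<close> be the number of adjacent pairs of unoccupied sites after \<open>m\<close> steps and \<open>u = n - m\<close>.
  Up to boundary terms the number of runs is \<open>u - Y\<^sub>m\<close>.  Every pair survives the next step with
  probability \<open>1 - 2 / u\<close>, so the centred count divided by \<open>u (u - 1)\<close> is a martingale, whose
  conditional variances are affine in the numbers of unoccupied pairs and triples and in the square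
  of the former; these concentrate because such counts are martingales of the same kind.  A
  Lindeberg argument then gives the Gaussian limits of linear combinations of finitely many times,
  and the variance recursion has a closed solution, from which the covariance is read off.

  Fourth moments of increments are of the order of the squared time difference, directly in the first
  half of the time interval and by time reversal in the second.  A dyadic maximal inequality turns
  this into a bound on the distance between the process and its step approximation on a grid.
  Weak convergence therefore reduces to bounded Lipschitz functions of finitely many values, which
  are approximated by trigonometric polynomials.

  The limit is \<open>(1 - t)\<^sup>2 * B (t\<^sup>2 / (1 - t)\<^sup>2)\<close> for a Brownian motion \<open>B\<close>.  It is built from Levy's
  construction of the Brownian bridge.\<close>

section \<open>Averages over permutations\<close>

text \<open>The limit process in the statement is arbitrary, so the comparison may use only its
  finite-dimensional characteristic functions, its second moments and the continuity of its paths.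
  Fourth moments are needed because variances of increments grow only linearly in the time
  difference: added up over the blocks of a grid they would not become small. With blocks of n/M
  steps, about M squared lengths add up to n^2/M, which on the scale n^2 vanishes as M grows. The
  Skorohod distance is only ever bounded by the uniform distance, that is, by the identity time
  change. This suffices because the limit is continuous. The central limit theorem is proved for
  times bounded away from 1. There each conditional variance differs from its mean by O(n^(-1/2)) in
  L1, a bound that deteriorates as the unoccupied sites run out. At time 1 the centred count and the
  limit are both zero.\<close>

definition perms :: "nat \<Rightarrow> (nat \<Rightarrow> nat) set" where
  "perms n = {\<sigma>. \<sigma> permutes {1..n}}"

text \<open>Values in a general normed space serve real moments and complex characteristic functions
  alike.\<close>

definition pexp :: "nat \<Rightarrow> ((nat \<Rightarrow> nat) \<Rightarrow> 'b) \<Rightarrow> 'b::real_normed_vector" where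
  "pexp n F = (\<Sum>\<sigma>\<in>perms n. F \<sigma>) /\<^sub>R real (card (perms n))"

lemma finite_perms [simp]: "finite (perms n)"
  unfolding perms_def by (rule finite_permutations) simp

lemma id_perms: "id \<in> perms n"
  by (simp add: perms_def permutes_id)

lemma card_perms_pos [simp]: "card (perms n) > 0"
  using id_perms by (auto simp: card_gt_0_iff)

lemma integral_random_perm:
  fixes F :: "(nat \<Rightarrow> nat) \<Rightarrow> 'b::{banach, second_countable_topology}"
  shows "(\<integral>\<sigma>. F \<sigma> \<partial>random_perm n) = pexp n F"
proof -
  have ne: "perms n \<noteq> {}" using id_perms by blast
  have "(\<integral>\<sigma>. F \<sigma> \<partial>random_perm n) = (\<Sum>\<sigma>\<in>perms n. pmf (pmf_of_set (perms n)) \<sigma> *\<^sub>R F \<sigma>)"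
    unfolding random_perm_def perms_def[symmetric]
    using ne by (intro integral_measure_pmf) auto
  also have "\<dots> = pexp n F"
    using ne unfolding pexp_def scaleR_sum_right
    by (intro sum.cong refl) (simp add: divide_inverse)
  finally show ?thesis .
qed

lemma integrable_random_perm:
  fixes F :: "(nat \<Rightarrow> nat) \<Rightarrow> 'b::{banach, second_countable_topology}"
  shows "integrable (random_perm n) F"
proof -
  have "perms n \<noteq> {}" using id_perms by blast
  then show ?thesis unfolding random_perm_def perms_def[symmetric]
    by (intro integrable_measure_pmf_finite) simp
qed

lemma prob_space_random_perm: "prob_space (random_perm n)"
  by (simp add: random_perm_def prob_space_measure_pmf)

lemma measurable_random_perm: "F \<in> measurable (random_perm n) borel"
  by (simp add: random_perm_def)

lemma pexp_add: "pexp n (\<lambda>\<sigma>. F \<sigma> + G \<sigma>) = pexp n F + pexp n G"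
  by (simp add: pexp_def sum.distrib scaleR_add_right)

lemma pexp_diff: "pexp n (\<lambda>\<sigma>. F \<sigma> - G \<sigma>) = pexp n F - pexp n G"
  by (simp add: pexp_def sum_subtractf scaleR_diff_right)

lemma pexp_mult_left: "pexp n (\<lambda>\<sigma>. c * F \<sigma>) = c * pexp n (F :: _ \<Rightarrow> 'b::real_normed_algebra)"
  by (simp add: pexp_def sum_distrib_left)

lemma pexp_mult_right: "pexp n (\<lambda>\<sigma>. F \<sigma> * c) = pexp n (F :: _ \<Rightarrow> 'b::real_normed_algebra) * c"
  by (simp add: pexp_def sum_distrib_right)

lemma pexp_divide: "pexp n (\<lambda>\<sigma>. F \<sigma> / c) = pexp n (F :: _ \<Rightarrow> real) / c"
  by (simp add: divide_inverse pexp_mult_right)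

lemma pexp_sum: "pexp n (\<lambda>\<sigma>. \<Sum>i\<in>A. F i \<sigma>) = (\<Sum>i\<in>A. pexp n (F i))"
  unfolding pexp_def by (subst sum.swap) (simp add: scaleR_sum_right)

lemma pexp_const [simp]: "pexp n (\<lambda>\<sigma>. c) = c"
  using less_imp_neq[OF card_perms_pos[of n]] by (simp add: pexp_def sum_constant_scaleR del: card_perms_pos)

lemma pexp_cong: "(\<And>\<sigma>. \<sigma> \<in> perms n \<Longrightarrow> F \<sigma> = G \<sigma>) \<Longrightarrow> pexp n F = pexp n G"
  by (simp add: pexp_def)

lemma pexp_mono:
  fixes F G :: "(nat \<Rightarrow> nat) \<Rightarrow> real"
  shows "(\<And>\<sigma>. \<sigma> \<in> perms n \<Longrightarrow> F \<sigma> \<le> G \<sigma>) \<Longrightarrow> pexp n F \<le> pexp n G"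
  unfolding pexp_def by (auto intro!: mult_left_mono sum_mono)

lemma norm_pexp_le: "norm (pexp n F) \<le> pexp n (\<lambda>\<sigma>. norm (F \<sigma>))"
  unfolding pexp_def by (simp add: norm_sum mult_left_mono divide_inverse[symmetric])

lemma abs_pexp_le: "\<bar>pexp n F\<bar> \<le> pexp n (\<lambda>\<sigma>. \<bar>F \<sigma> :: real\<bar>)"
  using norm_pexp_le[of n F] by simp

lemma pexp_nonneg:
  fixes F :: "(nat \<Rightarrow> nat) \<Rightarrow> real"
  shows "(\<And>\<sigma>. \<sigma> \<in> perms n \<Longrightarrow> 0 \<le> F \<sigma>) \<Longrightarrow> 0 \<le> pexp n F"
  using pexp_mono[of n "\<lambda>_. 0" F] by simp

lemma pexp_compose_right:
  assumes "q permutes {1..n}"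
  shows "pexp n (\<lambda>\<sigma>. F (\<sigma> \<circ> q)) = pexp n F"
  using sum_permutations_compose_right[OF assms, of F] by (simp add: pexp_def perms_def)

lemma pexp_square_mean: "(pexp n F)\<^sup>2 \<le> pexp n (\<lambda>\<sigma>. (F \<sigma> :: real)\<^sup>2)"
proof -
  have "0 \<le> pexp n (\<lambda>\<sigma>. (F \<sigma> - pexp n F)\<^sup>2)" by (rule pexp_nonneg) simp
  also have "\<dots> = pexp n (\<lambda>\<sigma>. (F \<sigma>)\<^sup>2 - 2 * pexp n F * F \<sigma> + (pexp n F)\<^sup>2)"
    by (rule pexp_cong) (simp add: power2_eq_square algebra_simps)
  also have "\<dots> = pexp n (\<lambda>\<sigma>. (F \<sigma>)\<^sup>2) - (pexp n F)\<^sup>2"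
    by (simp add: pexp_add pexp_diff pexp_mult_left power2_eq_square)
  finally show ?thesis by simp
qed

text \<open>The conditional expectation of \<open>F\<close> given \<open>\<sigma> 1, \<dots>, \<sigma> m\<close>, for \<open>F\<close> that depends on
  \<open>\<sigma> 1, \<dots>, \<sigma> (m + 1)\<close> only: each remaining value is equally likely to come next.\<close>

definition next_avg :: "nat \<Rightarrow> nat \<Rightarrow> ((nat \<Rightarrow> nat) \<Rightarrow> 'b) \<Rightarrow> (nat \<Rightarrow> nat) \<Rightarrow> 'b::real_normed_vector"
where
  "next_avg n m F \<sigma> =
     (\<Sum>j\<in>{m<..n}. F (\<sigma> \<circ> Transposition.transpose (Suc m) j)) /\<^sub>R real (n - m)"

text \<open>Measurability with respect to the first \<open>m\<close> values, expressed as
  invariance: the transpositions of \<open>Suc m\<close> with later indices generate all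
  permutations of \<open>{m<..n}\<close>.\<close>

definition in_past :: "nat \<Rightarrow> nat \<Rightarrow> ((nat \<Rightarrow> nat) \<Rightarrow> 'b) \<Rightarrow> bool" where
  "in_past n m F \<longleftrightarrow> (\<forall>\<sigma>\<in>perms n. \<forall>j\<in>{m<..n}. F (\<sigma> \<circ> Transposition.transpose (Suc m) j) = F \<sigma>)"

lemma transpose_permutes:
  assumes "m < n" "j \<in> {m<..n}"
  shows "Transposition.transpose (Suc m) j permutes {1..n}"
  using assms by (intro permutes_swap_id) auto

lemma comp_transpose_perms:
  assumes "m < n" "j \<in> {m<..n}" "\<sigma> \<in> perms n"
  shows "\<sigma> \<circ> Transposition.transpose (Suc m) j \<in> perms n"
  using assms transpose_permutes[OF assms(1,2)] by (simp add: perms_def permutes_compose)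

text \<open>The tower property. Composition with a transposition is a bijection of the permutations,
  so every summand has the mean of \<open>F\<close>. No restriction on what \<open>F\<close> depends
  on is needed.\<close>

lemma pexp_next_avg:
  assumes "m < n"
  shows "pexp n (next_avg n m F) = pexp n F"
proof -
  have "pexp n (next_avg n m F) =
      pexp n (\<lambda>\<sigma>. \<Sum>j\<in>{m<..n}. F (\<sigma> \<circ> Transposition.transpose (Suc m) j)) /\<^sub>R real (n - m)"
    unfolding next_avg_def pexp_def by (simp add: scaleR_sum_right[symmetric] mult.commute)
  also have "pexp n (\<lambda>\<sigma>. \<Sum>j\<in>{m<..n}. F (\<sigma> \<circ> Transposition.transpose (Suc m) j)) = (\<Sum>j\<in>{m<..n}. pexp n F)"
    unfolding pexp_sum by (intro sum.cong refl pexp_compose_right transpose_permutes assms)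
  also have "\<dots> /\<^sub>R real (n - m) = pexp n F"
    using assms by (simp add: sum_constant_scaleR)
  finally show ?thesis .
qed

lemma next_avg_mult_past:
  fixes F G :: "(nat \<Rightarrow> nat) \<Rightarrow> 'b::real_normed_algebra"
  assumes "in_past n m F" "\<sigma> \<in> perms n"
  shows "next_avg n m (\<lambda>\<sigma>. F \<sigma> * G \<sigma>) \<sigma> = F \<sigma> * next_avg n m G \<sigma>"
  using assms by (simp add: next_avg_def in_past_def sum_distrib_left)

lemma pexp_mult_past:
  fixes F G :: "(nat \<Rightarrow> nat) \<Rightarrow> 'b::real_normed_algebra"
  assumes "m < n" "in_past n m F"
  shows "pexp n (\<lambda>\<sigma>. F \<sigma> * G \<sigma>) = pexp n (\<lambda>\<sigma>. F \<sigma> * next_avg n m G \<sigma>)"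
proof -
  have "pexp n (\<lambda>\<sigma>. F \<sigma> * G \<sigma>) = pexp n (next_avg n m (\<lambda>\<sigma>. F \<sigma> * G \<sigma>))"
    by (rule pexp_next_avg[OF assms(1), symmetric])
  also have "\<dots> = pexp n (\<lambda>\<sigma>. F \<sigma> * next_avg n m G \<sigma>)"
    by (rule pexp_cong) (rule next_avg_mult_past[OF assms(2)])
  finally show ?thesis .
qed

lemma next_avg_add: "next_avg n m (\<lambda>\<sigma>. F \<sigma> + G \<sigma>) \<sigma> = next_avg n m F \<sigma> + next_avg n m G \<sigma>"
  by (simp add: next_avg_def sum.distrib scaleR_add_right)

lemma next_avg_diff: "next_avg n m (\<lambda>\<sigma>. F \<sigma> - G \<sigma>) \<sigma> = next_avg n m F \<sigma> - next_avg n m G \<sigma>"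
  by (simp add: next_avg_def sum_subtractf scaleR_diff_right)

lemma next_avg_mult_left:
  "next_avg n m (\<lambda>\<sigma>. c * F \<sigma>) \<sigma> = c * next_avg n m (F :: _ \<Rightarrow> 'b::real_normed_algebra) \<sigma>"
  by (simp add: next_avg_def sum_distrib_left)

lemma next_avg_past:
  assumes "m < n" "in_past n m F" "\<sigma> \<in> perms n"
  shows "next_avg n m F \<sigma> = F \<sigma>"
proof -
  have "(\<Sum>j\<in>{m<..n}. F (\<sigma> \<circ> Transposition.transpose (Suc m) j)) = (\<Sum>j\<in>{m<..n}. F \<sigma>)"
    using assms by (intro sum.cong) (auto simp: in_past_def)
  then show ?thesis using assms(1) by (simp add: next_avg_def sum_constant_scaleR)
qed

lemma next_avg_mono:
  fixes F G :: "(nat \<Rightarrow> nat) \<Rightarrow> real"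
  assumes "m < n" "\<sigma> \<in> perms n" "\<And>\<sigma>. \<sigma> \<in> perms n \<Longrightarrow> F \<sigma> \<le> G \<sigma>"
  shows "next_avg n m F \<sigma> \<le> next_avg n m G \<sigma>"
  unfolding next_avg_def using assms comp_transpose_perms[OF assms(1)]
  by (intro scaleR_left_mono sum_mono) auto

lemma norm_next_avg_le: "norm (next_avg n m F \<sigma>) \<le> next_avg n m (\<lambda>\<sigma>. norm (F \<sigma>)) \<sigma>"
  unfolding next_avg_def by (simp add: norm_sum mult_left_mono divide_inverse[symmetric])

lemma in_past_comp: "in_past n m F \<Longrightarrow> in_past n m (\<lambda>\<sigma>. g (F \<sigma>))"
  by (simp add: in_past_def)

lemma in_past_comp2: "in_past n m F \<Longrightarrow> in_past n m G \<Longrightarrow> in_past n m (\<lambda>\<sigma>. g (F \<sigma>) (G \<sigma>))"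
  by (simp add: in_past_def)

lemma in_past_sum: "(\<And>i. i \<in> A \<Longrightarrow> in_past n m (F i)) \<Longrightarrow> in_past n m (\<lambda>\<sigma>. \<Sum>i\<in>A. F i \<sigma>)"
  by (auto simp: in_past_def intro!: sum.cong)


section \<open>Counting windows of unoccupied sites\<close>

text \<open>The unoccupied sites after \<open>m\<close> steps are \<open>\<sigma> ` {m<..n}\<close>.  Windows that stick out of
  \<open>{1..n}\<close> are allowed but never count.\<close>

definition windows :: "nat \<Rightarrow> nat \<Rightarrow> nat \<Rightarrow> (nat \<Rightarrow> nat) \<Rightarrow> real" where
  "windows n r m \<sigma> = (\<Sum>k=1..n. of_bool ({k..<k+r} \<subseteq> \<sigma> ` {m<..n}))"

text \<open>The transposition carries the indices after \<open>Suc m\<close> to the indices after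
  \<open>m\<close> other than \<open>j\<close>. Choosing \<open>j\<close> therefore means that the
  site \<open>\<sigma> j\<close> is occupied next.\<close>

lemma unoccupied_step:
  assumes "m < n" "j \<in> {m<..n}" "\<sigma> \<in> perms n"
  shows "(\<sigma> \<circ> Transposition.transpose (Suc m) j) ` {Suc m<..n} = \<sigma> ` {m<..n} - {\<sigma> j}"
proof -
  let ?t = "Transposition.transpose (Suc m) j"
  have t: "?t permutes {m<..n}" using assms by (intro permutes_swap_id) auto
  have "?t ` {Suc m<..n} = ?t ` ({m<..n} - {Suc m})"
    by (rule arg_cong[where f = "image ?t"]) auto
  also have "\<dots> = {m<..n} - {j}"
    using permutes_image[OF t] permutes_inj[OF t] by (subst image_set_diff) auto
  finally have "?t ` {Suc m<..n} = {m<..n} - {j}" .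
  moreover have "inj \<sigma>" using assms by (auto simp: perms_def dest: permutes_inj)
  ultimately show ?thesis
    unfolding image_comp[symmetric] by (simp add: image_set_diff)
qed

lemma in_past_unoccupied:
  assumes "l \<le> m" "m < n"
  shows "in_past n m (\<lambda>\<sigma>. \<sigma> ` {l<..n})"
  unfolding in_past_def
proof (intro ballI)
  fix \<sigma> j assume "j \<in> {m<..n}"
  then have "Transposition.transpose (Suc m) j permutes {l<..n}"
    using assms by (intro permutes_swap_id) auto
  then show "(\<sigma> \<circ> Transposition.transpose (Suc m) j) ` {l<..n} = \<sigma> ` {l<..n}"
    unfolding image_comp[symmetric] by (simp add: permutes_image)
qed

lemma in_past_windows: "l \<le> m \<Longrightarrow> m < n \<Longrightarrow> in_past n m (windows n r l)"
  unfolding windows_def by (rule in_past_comp[OF in_past_unoccupied])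

text \<open>Removing one site from the unoccupied set destroys exactly the unoccupied windows that
  contain it.\<close>

lemma windows_step:
  assumes "m < n" "j \<in> {m<..n}" "\<sigma> \<in> perms n"
  shows "windows n r m \<sigma> - windows n r (Suc m) (\<sigma> \<circ> Transposition.transpose (Suc m) j)
    = (\<Sum>k=1..n. of_bool ({k..<k+r} \<subseteq> \<sigma> ` {m<..n}) * of_bool (\<sigma> j \<in> {k..<k+r}))"
  unfolding windows_def unoccupied_step[OF assms] sum_subtractf[symmetric]
  by (intro sum.cong) auto

lemma sum_window_hits:
  assumes "m < n" "\<sigma> \<in> perms n" "B \<subseteq> \<sigma> ` {m<..n}"
  shows "(\<Sum>j\<in>{m<..n}. of_bool (\<sigma> j \<in> B)) = real (card B)"
proof -
  have inj: "inj \<sigma>" using assms by (auto simp: perms_def dest: permutes_inj)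
  have "\<sigma> ` {j\<in>{m<..n}. \<sigma> j \<in> B} = B" using assms(3) by auto
  then have "card {j\<in>{m<..n}. \<sigma> j \<in> B} = card B"
    using card_image[OF inj_on_subset[OF inj subset_UNIV]] by metis
  then show ?thesis by (simp add: Int_def flip: sum.inter_filter)
qed

text \<open>Double counting of pairs of an unoccupied window and a site in it: each such window is
  destroyed by \<open>r\<close> of the possible choices.\<close>

lemma sum_windows_step:
  assumes "m < n" "\<sigma> \<in> perms n"
  shows "(\<Sum>j\<in>{m<..n}. windows n r m \<sigma> -
    windows n r (Suc m) (\<sigma> \<circ> Transposition.transpose (Suc m) j)) = r * windows n r m \<sigma>"
proof -
  have "(\<Sum>j\<in>{m<..n}. windows n r m \<sigma> -
      windows n r (Suc m) (\<sigma> \<circ> Transposition.transpose (Suc m) j)) =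
    (\<Sum>j\<in>{m<..n}. \<Sum>k=1..n. of_bool ({k..<k+r} \<subseteq> \<sigma> ` {m<..n}) * of_bool (\<sigma> j \<in> {k..<k+r}))"
    by (intro sum.cong refl windows_step assms)
  also have "\<dots> = (\<Sum>k=1..n. of_bool ({k..<k+r} \<subseteq> \<sigma> ` {m<..n}) *
      (\<Sum>j\<in>{m<..n}. of_bool (\<sigma> j \<in> {k..<k+r})))"
    unfolding sum_distrib_left by (rule sum.swap)
  also have "\<dots> = (\<Sum>k=1..n. of_bool ({k..<k+r} \<subseteq> \<sigma> ` {m<..n}) * real r)"
  proof (intro sum.cong refl)
    fix k
    show "of_bool ({k..<k+r} \<subseteq> \<sigma> ` {m<..n}) * (\<Sum>j\<in>{m<..n}. of_bool (\<sigma> j \<in> {k..<k+r}))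
      = of_bool ({k..<k+r} \<subseteq> \<sigma> ` {m<..n}) * real r"
      using sum_window_hits[OF assms, of "{k..<k+r}"] by (cases "{k..<k+r} \<subseteq> \<sigma> ` {m<..n}") simp_all
  qed
  also have "\<dots> = r * windows n r m \<sigma>"
    by (simp add: windows_def sum_distrib_right mult.commute)
  finally show ?thesis .
qed

lemma next_avg_windows:
  assumes "m < n" "\<sigma> \<in> perms n"
  shows "next_avg n m (windows n r (Suc m)) \<sigma> = (1 - r / real (n - m)) * windows n r m \<sigma>"
  using sum_windows_step[OF assms, of r] assms(1)
  by (simp add: next_avg_def sum_subtractf field_simps)

lemma windows_nonneg: "0 \<le> windows n r m \<sigma>"
  unfolding windows_def by (intro sum_nonneg) auto

text \<open>A site lies in at most \<open>r\<close> windows of length \<open>r\<close>, because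
  their left ends are \<open>r\<close> consecutive numbers.\<close>

lemma windows_decrease:
  assumes "m < n" "\<sigma> \<in> perms n"
  shows "0 \<le> windows n r m \<sigma> - windows n r (Suc m) \<sigma>"
    and "windows n r m \<sigma> - windows n r (Suc m) \<sigma> \<le> r"
proof -
  let ?d = "\<Sum>k=1..n. of_bool ({k..<k+r} \<subseteq> \<sigma> ` {m<..n}) * of_bool (\<sigma> (Suc m) \<in> {k..<k+r}) :: real"
  \<comment> \<open>The choice \<open>j = Suc m\<close> makes the transposition the identity, so the
    step formula applies to the permutation itself.\<close>
  have d: "windows n r m \<sigma> - windows n r (Suc m) \<sigma> = ?d"
    using windows_step[OF assms(1) _ assms(2), of "Suc m" r] assms(1) by simp
  show "0 \<le> windows n r m \<sigma> - windows n r (Suc m) \<sigma>"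
    unfolding d by (intro sum_nonneg) auto
  have "?d \<le> (\<Sum>k=1..n. of_bool (\<sigma> (Suc m) \<in> {k..<k+r}))"
    by (intro sum_mono) auto
  also have "\<dots> = real (card {k\<in>{1..n}. \<sigma> (Suc m) \<in> {k..<k+r}})"
    by (simp add: Int_def)
  also have "\<dots> \<le> real (card {\<sigma> (Suc m) + 1 - r..<\<sigma> (Suc m) + 1})"
    by (intro of_nat_mono card_mono) auto
  also have "\<dots> \<le> r" by simp
  finally show "windows n r m \<sigma> - windows n r (Suc m) \<sigma> \<le> r" unfolding d .
qed

lemma next_avg_decrease:
  assumes "m < n" "\<sigma> \<in> perms n"
  shows "next_avg n m (\<lambda>\<sigma>. windows n r m \<sigma> - windows n r (Suc m) \<sigma>) \<sigma>
    = r / real (n - m) * windows n r m \<sigma>"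
  using assms by (simp add: next_avg_diff next_avg_windows next_avg_past[OF _ in_past_windows]
      algebra_simps)

lemma next_avg_const [simp]: "m < n \<Longrightarrow> next_avg n m (\<lambda>_. c) \<sigma> = c"
  by (simp add: next_avg_def sum_constant_scaleR)

text \<open>The rate is the conditional mean of the decrease and inherits its pathwise
  bounds.\<close>

lemma windows_rate_bounds:
  assumes "m < n" "\<sigma> \<in> perms n"
  shows "0 \<le> r / real (n - m) * windows n r m \<sigma>" "r / real (n - m) * windows n r m \<sigma> \<le> r"
proof -
  show "0 \<le> r / real (n - m) * windows n r m \<sigma>" by (simp add: windows_nonneg)
  show "r / real (n - m) * windows n r m \<sigma> \<le> r"
    using next_avg_mono[OF assms, of "\<lambda>\<sigma>. windows n r m \<sigma> - windows n r (Suc m) \<sigma>" "\<lambda>_. real r"]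
      windows_decrease(2)[OF assms(1)] next_avg_decrease[OF assms, of r] assms(1)
    by simp
qed

lemma windows_le:
  assumes "m < n" "\<sigma> \<in> perms n" "0 < r"
  shows "windows n r m \<sigma> \<le> real (n - m)"
proof -
  have "real r * windows n r m \<sigma> \<le> real r * real (n - m)"
    using windows_rate_bounds(2)[OF assms(1,2), of r] assms(1) by (simp add: pos_divide_le_eq)
  then show ?thesis using assms(3) by simp
qed

section \<open>Martingale differences of the window counts\<close>

definition mart_diff :: "nat \<Rightarrow> nat \<Rightarrow> nat \<Rightarrow> (nat \<Rightarrow> nat) \<Rightarrow> real" where
  "mart_diff n r m \<sigma> = windows n r (Suc m) \<sigma> - (1 - r / real (n - m)) * windows n r m \<sigma>"

lemma in_past_mart_diff: "l < m \<Longrightarrow> m < n \<Longrightarrow> in_past n m (mart_diff n r l)"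
  unfolding mart_diff_def by (rule in_past_comp2[OF in_past_windows in_past_windows]) auto

lemma next_avg_mart_diff:
  assumes "m < n" "\<sigma> \<in> perms n"
  shows "next_avg n m (mart_diff n r m) \<sigma> = 0"
  using assms unfolding mart_diff_def
  by (simp add: next_avg_diff next_avg_windows next_avg_mult_left next_avg_past[OF _ in_past_windows])

text \<open>The difference is the rate minus the actual decrease, and both lie between 0 and
  \<open>r\<close>.\<close>

lemma abs_mart_diff_le:
  assumes "m < n" "\<sigma> \<in> perms n"
  shows "\<bar>mart_diff n r m \<sigma>\<bar> \<le> r"
  using windows_decrease[OF assms, of r] windows_rate_bounds[OF assms, of r]
  by (simp add: mart_diff_def algebra_simps abs_le_iff)

lemma pexp_windows_Suc:
  assumes "m < n"
  shows "pexp n (windows n r (Suc m)) = (1 - r / real (n - m)) * pexp n (windows n r m)"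
proof -
  have "pexp n (windows n r (Suc m)) = pexp n (next_avg n m (windows n r (Suc m)))"
    by (rule pexp_next_avg[OF assms, symmetric])
  also have "\<dots> = pexp n (\<lambda>\<sigma>. (1 - r / real (n - m)) * windows n r m \<sigma>)"
    by (rule pexp_cong) (rule next_avg_windows[OF assms])
  finally show ?thesis by (simp add: pexp_mult_left)
qed

text \<open>For \<open>r = 0\<close> every one of the \<open>n\<close> empty windows counts, one
  fewer than \<open>n + 1 - r\<close> would say. For \<open>r > n\<close> the truncated subtraction
  gives 0.\<close>

lemma windows_0:
  assumes "\<sigma> \<in> perms n"
  shows "windows n r 0 \<sigma> = (if r = 0 then n else real (n + 1 - r))"
proof -
  have "\<sigma> ` {0<..n} = {1..n}"
    using assms permutes_image[of \<sigma> "{1..n}"] by (simp add: perms_def atLeastSucAtMost_greaterThanAtMost[symmetric])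
  then have "windows n r 0 \<sigma> = real (card {k\<in>{1..n}. {k..<k+r} \<subseteq> {1..n}})"
    by (simp add: windows_def Int_def)
  also have "{k\<in>{1..n}. {k..<k+r} \<subseteq> {1..n}} = (if r = 0 then {1..n} else {1..n+1-r})"
  proof (cases "r = 0")
    case False
    have "{k..<k+r} \<subseteq> {1..n} \<longleftrightarrow> k \<le> n + 1 - r" if "k \<in> {1..n}" for k
    proof
      assume "{k..<k+r} \<subseteq> {1..n}"
      moreover have "k + r - 1 \<in> {k..<k+r}" using False by simp
      ultimately have "k + r - 1 \<in> {1..n}" by blast
      then have "k + r - 1 \<le> n" by (simp only: atLeastAtMost_iff)
      then show "k \<le> n + 1 - r" using False by arith
    qed (use that in auto)
    then show ?thesis using False by auto
  qed auto
  finally show ?thesis by simp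
qed


text \<open>The offset \<open>a\<close> and the factors \<open>\<alpha>\<close> allow two uses:
  centred counts, whose recursion has factors of modulus at most 1, and sums of martingale
  differences from a later start, with all factors 1. In the expansion of the square and of the
  fourth power the term linear in the new difference averages to zero.\<close>

lemma martingale_moments:
  fixes S D :: "nat \<Rightarrow> (nat \<Rightarrow> nat) \<Rightarrow> real"
  assumes len: "a + N \<le> n"
    and init: "\<And>\<sigma>. \<sigma> \<in> perms n \<Longrightarrow> S 0 \<sigma> = 0"
    and rec: "\<And>k \<sigma>. k < N \<Longrightarrow> \<sigma> \<in> perms n \<Longrightarrow> S (Suc k) \<sigma> = \<alpha> k * S k \<sigma> + D k \<sigma>"
    and \<alpha>: "\<And>k. k < N \<Longrightarrow> \<bar>\<alpha> k\<bar> \<le> 1"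
    and bound: "\<And>k \<sigma>. k < N \<Longrightarrow> \<sigma> \<in> perms n \<Longrightarrow> \<bar>D k \<sigma>\<bar> \<le> d"
    and past: "\<And>k. k < N \<Longrightarrow> in_past n (a + k) (S k)"
    and avg: "\<And>k \<sigma>. k < N \<Longrightarrow> \<sigma> \<in> perms n \<Longrightarrow> next_avg n (a + k) (D k) \<sigma> = 0"
    and k: "k \<le> N"
  shows "pexp n (\<lambda>\<sigma>. (S k \<sigma>)\<^sup>2) \<le> d\<^sup>2 * k" "pexp n (\<lambda>\<sigma>. (S k \<sigma>) ^ 4) \<le> 8 * d ^ 4 * (real k)\<^sup>2"
proof -
  have orth: "pexp n (\<lambda>\<sigma>. g (S k \<sigma>) * D k \<sigma>) = 0" if "k < N" for k and g :: "real \<Rightarrow> real"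
  proof -
    have "pexp n (\<lambda>\<sigma>. g (S k \<sigma>) * D k \<sigma>) = pexp n (\<lambda>\<sigma>. g (S k \<sigma>) * next_avg n (a + k) (D k) \<sigma>)"
      using that len by (intro pexp_mult_past in_past_comp[OF past]) auto
    also have "\<dots> = pexp n (\<lambda>\<sigma>. 0)" by (rule pexp_cong) (simp add: avg that)
    finally show ?thesis by simp
  qed
  have step: "\<bar>\<alpha> k * S k \<sigma>\<bar> \<le> \<bar>S k \<sigma>\<bar>" if "k < N" for k \<sigma>
    using \<alpha>[OF that] by (simp add: abs_mult mult_left_le_one_le)
  have "pexp n (\<lambda>\<sigma>. (S k \<sigma>)\<^sup>2) \<le> d\<^sup>2 * k \<and> pexp n (\<lambda>\<sigma>. (S k \<sigma>) ^ 4) \<le> 8 * d ^ 4 * (real k)\<^sup>2"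
    using k
  proof (induction k)
    case 0
    have "pexp n (\<lambda>\<sigma>. (S 0 \<sigma>)\<^sup>2) = pexp n (\<lambda>\<sigma>. 0)" "pexp n (\<lambda>\<sigma>. (S 0 \<sigma>) ^ 4) = pexp n (\<lambda>\<sigma>. 0)"
      by (rule pexp_cong, simp add: init)+
    then show ?case by simp
  next
    case (Suc k)
    then have k: "k < N" by simp
    note IH = Suc.IH[OF less_imp_le[OF k]]
    have "pexp n (\<lambda>\<sigma>. (S (Suc k) \<sigma>)\<^sup>2)
        \<le> pexp n (\<lambda>\<sigma>. (S k \<sigma>)\<^sup>2 + 2 * \<alpha> k * (S k \<sigma> * D k \<sigma>) + d\<^sup>2)"
    proof (rule pexp_mono)
      fix \<sigma> assume \<sigma>: "\<sigma> \<in> perms n"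
      have "(\<alpha> k * S k \<sigma>)\<^sup>2 \<le> (S k \<sigma>)\<^sup>2" "(D k \<sigma>)\<^sup>2 \<le> d\<^sup>2"
        using step[OF k, of \<sigma>] bound[OF k \<sigma>] by (simp_all add: abs_le_square_iff[symmetric])
      then show "(S (Suc k) \<sigma>)\<^sup>2 \<le> (S k \<sigma>)\<^sup>2 + 2 * \<alpha> k * (S k \<sigma> * D k \<sigma>) + d\<^sup>2"
        by (simp add: rec[OF k \<sigma>] power2_sum)
    qed
    also have "\<dots> = pexp n (\<lambda>\<sigma>. (S k \<sigma>)\<^sup>2) + d\<^sup>2"
      using orth[OF k, of "\<lambda>x. x"] by (simp add: pexp_add pexp_mult_left)
    also have "\<dots> \<le> d\<^sup>2 * Suc k" using IH by (simp add: algebra_simps)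
    finally have A: "pexp n (\<lambda>\<sigma>. (S (Suc k) \<sigma>)\<^sup>2) \<le> d\<^sup>2 * Suc k" .
    have "pexp n (\<lambda>\<sigma>. (S (Suc k) \<sigma>) ^ 4)
        \<le> pexp n (\<lambda>\<sigma>. (S k \<sigma>) ^ 4 + 4 * \<alpha> k ^ 3 * ((S k \<sigma>) ^ 3 * D k \<sigma>) + 8 * d\<^sup>2 * (S k \<sigma>)\<^sup>2 + 3 * d ^ 4)"
    proof (rule pexp_mono)
      fix \<sigma> assume \<sigma>: "\<sigma> \<in> perms n"
      define s x y where "s = S k \<sigma>" and "x = \<alpha> k * S k \<sigma>" and "y = D k \<sigma>"
      have x: "\<bar>x\<bar> \<le> \<bar>s\<bar>" and y: "\<bar>y\<bar> \<le> d"
        using step[OF k, of \<sigma>] bound[OF k \<sigma>] by (simp_all add: s_def x_def y_def)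
      have d: "0 \<le> d" using y by simp
      have x2: "x\<^sup>2 \<le> s\<^sup>2" and y2: "y\<^sup>2 \<le> d\<^sup>2"
        using x y by (simp_all add: abs_le_square_iff[symmetric])
      have x4: "x ^ 4 \<le> s ^ 4"
        using power_mono[OF x2, of 2] by simp
      have y4: "y ^ 4 \<le> d ^ 4"
        using power_mono[OF y2, of 2] by simp
      have xy2: "x\<^sup>2 * y\<^sup>2 \<le> s\<^sup>2 * d\<^sup>2"
        using x2 y2 by (intro mult_mono) auto
      have "x * y ^ 3 \<le> \<bar>x * y ^ 3\<bar>" by simp
      also have "\<dots> \<le> \<bar>s\<bar> * d ^ 3"
        unfolding abs_mult power_abs using x y by (intro mult_mono power_mono) auto
      finally have xy3': "x * y ^ 3 \<le> \<bar>s\<bar> * d ^ 3" .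
      \<comment> \<open>The odd mixed term does not vanish; it is split by the inequality of
        arithmetic and geometric means.\<close>
      have xy3: "2 * (x * y ^ 3) \<le> s\<^sup>2 * d\<^sup>2 + d ^ 4"
      proof -
        have "0 \<le> (\<bar>s\<bar> * d - d\<^sup>2)\<^sup>2" by simp
        also have "\<dots> = s\<^sup>2 * d\<^sup>2 + d ^ 4 - 2 * (\<bar>s\<bar> * d ^ 3)"
        proof -
          have "s\<^sup>2 = \<bar>s\<bar>\<^sup>2" by simp
          then show ?thesis by algebra
        qed
        finally show ?thesis using xy3' by linarith
      qed
      have "(x + y) ^ 4 = x ^ 4 + 4 * (x ^ 3 * y) + 6 * (x\<^sup>2 * y\<^sup>2) + 4 * (x * y ^ 3) + y ^ 4"
        by (simp add: power2_eq_square power3_eq_cube power4_eq_xxxx algebra_simps)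
      \<comment> \<open>The term \<open>4 * (x * y ^ 3)\<close> adds 2 to each of the coefficients 6
        and 1, which explains 8 and 3.\<close>
      then have "(x + y) ^ 4 \<le> s ^ 4 + 4 * (x ^ 3 * y) + 8 * (s\<^sup>2 * d\<^sup>2) + 3 * d ^ 4"
        using x4 y4 xy2 xy3 by linarith
      then show "(S (Suc k) \<sigma>) ^ 4
          \<le> (S k \<sigma>) ^ 4 + 4 * \<alpha> k ^ 3 * ((S k \<sigma>) ^ 3 * D k \<sigma>) + 8 * d\<^sup>2 * (S k \<sigma>)\<^sup>2 + 3 * d ^ 4"
        by (simp add: rec[OF k \<sigma>] s_def x_def y_def power_mult_distrib algebra_simps)
    qed
    also have "\<dots> = pexp n (\<lambda>\<sigma>. (S k \<sigma>) ^ 4) + 8 * d\<^sup>2 * pexp n (\<lambda>\<sigma>. (S k \<sigma>)\<^sup>2) + 3 * d ^ 4"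
      using orth[OF k, of "\<lambda>x. x ^ 3"] by (simp add: pexp_add pexp_mult_left)
    also have "\<dots> \<le> 8 * d ^ 4 * (real k)\<^sup>2 + 8 * d\<^sup>2 * (d\<^sup>2 * k) + 3 * d ^ 4"
      using IH by (intro add_mono mult_left_mono) auto
    also have "\<dots> = d ^ 4 * (8 * (real k)\<^sup>2 + 8 * k + 3)"
      by (simp add: power2_eq_square power4_eq_xxxx algebra_simps)
    \<comment> \<open>The induction closes because 8 k^2 + 8 k + 3 is at most 8 (k + 1)^2.\<close>
    also have "\<dots> \<le> d ^ 4 * (8 * (real (Suc k))\<^sup>2)"
      by (intro mult_left_mono) (auto simp: power2_eq_square algebra_simps)
    finally show ?case using A by (simp add: mult_ac)
  qed
  then show "pexp n (\<lambda>\<sigma>. (S k \<sigma>)\<^sup>2) \<le> d\<^sup>2 * k" "pexp n (\<lambda>\<sigma>. (S k \<sigma>) ^ 4) \<le> 8 * d ^ 4 * (real k)\<^sup>2"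
    by auto
qed

section \<open>Moments of the centred counts\<close>

definition centred :: "nat \<Rightarrow> nat \<Rightarrow> nat \<Rightarrow> (nat \<Rightarrow> nat) \<Rightarrow> real" where
  "centred n r m \<sigma> = windows n r m \<sigma> - pexp n (windows n r m)"

lemma centred_0: "\<sigma> \<in> perms n \<Longrightarrow> centred n r 0 \<sigma> = 0"
proof -
  assume "\<sigma> \<in> perms n"
  moreover have "pexp n (windows n r 0) = pexp n (\<lambda>_. if r = 0 then n else real (n + 1 - r))"
    by (rule pexp_cong) (rule windows_0)
  ultimately show ?thesis by (simp add: centred_def windows_0)
qed

lemma centred_Suc:
  assumes "m < n"
  shows "centred n r (Suc m) \<sigma> = (1 - r / real (n - m)) * centred n r m \<sigma> + mart_diff n r m \<sigma>"
  using pexp_windows_Suc[OF assms, of r] by (simp add: centred_def mart_diff_def algebra_simps)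

lemma in_past_centred: "l \<le> m \<Longrightarrow> m < n \<Longrightarrow> in_past n m (centred n r l)"
  unfolding centred_def by (rule in_past_comp[OF in_past_windows])

text \<open>The second hypothesis says that \<open>1 - r / real (n - k)\<close> is at least -1, so
  that the recursion does not expand. It can fail only when very few sites are left.\<close>

lemma centred_moments:
  assumes "m \<le> n" "\<And>k. k < m \<Longrightarrow> real r \<le> 2 * real (n - k)"
  shows "pexp n (\<lambda>\<sigma>. (centred n r m \<sigma>)\<^sup>2) \<le> (real r)\<^sup>2 * m"
    and "pexp n (\<lambda>\<sigma>. (centred n r m \<sigma>) ^ 4) \<le> 8 * real r ^ 4 * (real m)\<^sup>2"
proof -
  have \<alpha>: "\<bar>1 - r / real (n - k)\<bar> \<le> 1" if "k < m" for k
  proof -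
    have "r / real (n - k) \<le> 2" using assms(2)[OF that] that assms(1) by (simp add: field_simps)
    moreover have "0 \<le> r / real (n - k)" by simp
    moreover have "\<bar>1 - q\<bar> \<le> 1" if "q \<le> 2" "0 \<le> q" for q :: real using that by simp
    ultimately show ?thesis by blast
  qed
  note facts = assms(1) \<alpha> centred_0[of _ n r] centred_Suc[of _ n r] abs_mart_diff_le[of _ n _ r]
    in_past_centred[of _ _ n r] next_avg_mart_diff[of _ n _ r]
  show "pexp n (\<lambda>\<sigma>. (centred n r m \<sigma>)\<^sup>2) \<le> (real r)\<^sup>2 * m"
    by (rule martingale_moments(1)[where a = 0 and N = m and D = "mart_diff n r"
        and \<alpha> = "\<lambda>k. 1 - r / real (n - k)"]) (use facts in auto)
  show "pexp n (\<lambda>\<sigma>. (centred n r m \<sigma>) ^ 4) \<le> 8 * real r ^ 4 * (real m)\<^sup>2"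
    by (rule martingale_moments(2)[where a = 0 and N = m and D = "mart_diff n r"
        and \<alpha> = "\<lambda>k. 1 - r / real (n - k)"]) (use facts in auto)
qed

section \<open>Exact means and variances\<close>

lemma pexp_windows_2:
  assumes "0 < n" "m \<le> n"
  shows "pexp n (windows n 2 m) = real (n - m) * (real (n - m) - 1) / n"
  using assms(2)
proof (induction m)
  case 0
  have "pexp n (windows n 2 0) = pexp n (\<lambda>_. real (n + 1 - 2))"
    by (rule pexp_cong) (simp add: windows_0)
  then show ?case using assms by (simp add: of_nat_diff)
next
  case (Suc m)
  define x where "x = real (n - m)"
  have x: "x > 0" "real (n - Suc m) = x - 1" using Suc.prems by (auto simp: x_def of_nat_diff)
  have "pexp n (windows n 2 (Suc m)) = (1 - 2 / x) * (x * (x - 1) / n)"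
    using Suc by (simp add: pexp_windows_Suc x_def)
  also have "\<dots> = (x - 1) * (x - 1 - 1) / n" using x assms by (simp add: field_simps)
  finally show ?case by (simp add: x)
qed

text \<open>As for pairs, the product of the factors of the recursion telescopes. The value is the
  number of windows, n - 2 here and n - 1 for pairs, times the probability that the sites of one
  window are all unoccupied.\<close>

lemma pexp_windows_3:
  assumes "1 < n" "m \<le> n"
  shows "pexp n (windows n 3 m) =
    real (n - m) * (real (n - m) - 1) * (real (n - m) - 2) / (real n * (real n - 1))"
  using assms(2)
proof (induction m)
  case 0
  have "pexp n (windows n 3 0) = pexp n (\<lambda>_. real (n + 1 - 3))"
    by (rule pexp_cong) (simp add: windows_0)
  then show ?case using assms by (simp add: of_nat_diff)
next
  case (Suc m)
  define x N where "x = real (n - m)" and "N = real n"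
  have x: "x > 0" "real (n - Suc m) = x - 1" using Suc.prems by (auto simp: x_def of_nat_diff)
  have N: "N > 1" using assms by (simp add: N_def)
  have "pexp n (windows n 3 (Suc m)) = (1 - 3 / x) * (x * (x - 1) * (x - 2) / (N * (N - 1)))"
    using Suc by (simp add: pexp_windows_Suc x_def N_def)
  also have "(1 - 3 / x) * (x * (x - 1) * (x - 2) / (N * (N - 1))) = ((1 - 3 / x) * x) * ((x - 1) * (x - 2) / (N * (N - 1)))"
    by (simp only: times_divide_eq_right mult.assoc)
  also have "(1 - 3 / x) * x = x - 3" using x by (simp add: field_simps)
  also have "(x - 3) * ((x - 1) * (x - 2) / (N * (N - 1))) = (x - 1) * (x - 1 - 1) * (x - 1 - 2) / (N * (N - 1))"
    unfolding times_divide_eq_right by (rule arg_cong[where f = "\<lambda>y. y / (N * (N - 1))"]) algebra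
  finally show ?case by (simp add: x N_def)
qed

text \<open>The only windows of length two through \<open>x\<close> start at \<open>x - 1\<close>
  and at \<open>x\<close>.\<close>

lemma pair_hits:
  fixes Z :: "nat set"
  assumes "Z \<subseteq> {1..n}" "x \<in> Z"
  shows "(\<Sum>k=1..n. of_bool ({k..<k+2} \<subseteq> Z) * of_bool (x \<in> {k..<k+2}))
    = (of_bool (x - 1 \<in> Z) + of_bool (Suc x \<in> Z) :: real)"
proof -
  have two: "{k..<k+2} = {k, Suc k}" for k :: nat by auto
  have "(\<Sum>k=1..n. of_bool ({k..<k+2} \<subseteq> Z) * of_bool (x \<in> {k..<k+2}) :: real)
      = (\<Sum>k=1..n. (if k = x then of_bool (Suc x \<in> Z) else 0) + (if k = x - 1 then of_bool (x - 1 \<in> Z) else 0))"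
  proof (intro sum.cong refl)
    fix k assume k: "k \<in> {1..n}"
    have x: "0 < x" using assms by auto
    consider "k = x" | "x = Suc k" | "x \<notin> {k, Suc k}" "k \<noteq> x" "k \<noteq> x - 1" using x k by force
    then show "of_bool ({k..<k+2} \<subseteq> Z) * of_bool (x \<in> {k..<k+2})
      = ((if k = x then of_bool (Suc x \<in> Z) else 0) + (if k = x - 1 then of_bool (x - 1 \<in> Z) else 0) :: real)"
      unfolding two using assms(2) x by cases simp_all
  qed
  also have "\<dots> = of_bool (x - 1 \<in> Z) + of_bool (Suc x \<in> Z)"
  proof -
    \<comment> \<open>For \<open>x = 1\<close> the truncated difference \<open>x - 1\<close> is 0,
      which is not a site.\<close>
    have "0 \<notin> Z" "x \<in> {1..n}" using assms by auto
    then show ?thesis by (cases "x = 1") (simp_all add: sum.distrib, linarith)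
  qed
  finally show ?thesis .
qed

text \<open>The decrease is a sum of two indicators, one for each neighbour of the new site. Its
  square is the decrease itself plus twice the product of the indicators, and the product detects
  middle sites of unoccupied triples. This is how triples enter the variance.\<close>

lemma next_avg_square_decrease:
  assumes "m < n" "\<sigma> \<in> perms n"
  shows "next_avg n m (\<lambda>\<sigma>. (windows n 2 m \<sigma> - windows n 2 (Suc m) \<sigma>)\<^sup>2) \<sigma>
    = (2 * windows n 2 m \<sigma> + 2 * windows n 3 m \<sigma>) / real (n - m)"
proof -
  define Z where "Z = \<sigma> ` {m<..n}"
  have inj: "inj \<sigma>" using assms by (auto simp: perms_def dest: permutes_inj)
  have Z: "Z \<subseteq> {1..n}" unfolding Z_def
    using assms permutes_image[of \<sigma> "{1..n}"] by (auto simp: perms_def)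
  let ?d = "\<lambda>j. windows n 2 m \<sigma> - windows n 2 (Suc m) (\<sigma> \<circ> Transposition.transpose (Suc m) j)"
  let ?h = "\<lambda>x. of_bool (x - 1 \<in> Z \<and> Suc x \<in> Z) :: real"
  have sq: "(?d j)\<^sup>2 = ?d j + 2 * ?h (\<sigma> j)" if "j \<in> {m<..n}" for j
  proof -
    have "?d j = of_bool (\<sigma> j - 1 \<in> Z) + of_bool (Suc (\<sigma> j) \<in> Z)"
      unfolding windows_step[OF assms(1) that assms(2)] Z_def[symmetric]
      using that by (intro pair_hits Z) (auto simp: Z_def)
    then show ?thesis by (simp only:) (auto simp: power2_eq_square)
  qed
  have "(\<Sum>j\<in>{m<..n}. ?h (\<sigma> j)) = (\<Sum>x\<in>Z. ?h x)"
    unfolding Z_def by (subst sum.reindex) (auto intro: inj_on_subset[OF inj])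
  also have "\<dots> = real (card {x\<in>Z. x - 1 \<in> Z \<and> Suc x \<in> Z})"
    using finite_subset[OF Z] by (simp add: Int_def)
  \<comment> \<open>Triples are indexed here by the middle site and in \<open>windows\<close> by the
    left end.\<close>
  also have "{x\<in>Z. x - 1 \<in> Z \<and> Suc x \<in> Z} = Suc ` {k\<in>{1..n}. {k..<k+3} \<subseteq> Z}"
  proof -
    have three: "{k..<k+3} = {k, Suc k, Suc (Suc k)}" for k :: nat by auto
    have "x \<in> Suc ` {k\<in>{1..n}. {k..<k+3} \<subseteq> Z}" if "x \<in> Z" "x - 1 \<in> Z" "Suc x \<in> Z" for x
    proof -
      have "x - 1 \<in> {1..n}" "x \<in> {1..n}" using that Z by blast+
      then show ?thesis using that by (intro image_eqI[of _ _ "x - 1"]) (auto simp: three)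
    qed
    moreover have "x \<in> Z \<and> x - 1 \<in> Z \<and> Suc x \<in> Z" if "x \<in> Suc ` {k\<in>{1..n}. {k..<k+3} \<subseteq> Z}" for x
      using that unfolding three by clarsimp
    ultimately show ?thesis by blast
  qed
  also have "real (card (Suc ` {k\<in>{1..n}. {k..<k+3} \<subseteq> Z})) = windows n 3 m \<sigma>"
    by (simp add: card_image windows_def Z_def Int_def)
  finally have h: "(\<Sum>j\<in>{m<..n}. ?h (\<sigma> j)) = windows n 3 m \<sigma>" .
  have wm: "windows n 2 m (\<sigma> \<circ> Transposition.transpose (Suc m) j) = windows n 2 m \<sigma>"
    if "j \<in> {m<..n}" for j
    using in_past_windows[of m m n 2] that assms unfolding in_past_def by blast
  have "(\<Sum>j\<in>{m<..n}. (windows n 2 m (\<sigma> \<circ> Transposition.transpose (Suc m) j)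
      - windows n 2 (Suc m) (\<sigma> \<circ> Transposition.transpose (Suc m) j))\<^sup>2)
      = (\<Sum>j\<in>{m<..n}. ?d j + 2 * ?h (\<sigma> j))"
    by (intro sum.cong refl) (simp only: wm sq)
  also have "\<dots> = 2 * windows n 2 m \<sigma> + 2 * windows n 3 m \<sigma>"
    using sum_windows_step[OF assms, of 2] h by (simp only: sum.distrib sum_distrib_left[symmetric])
  finally show ?thesis unfolding next_avg_def by (simp only: divide_inverse real_scaleR_def mult.commute)
qed

text \<open>The conditional variance of the decrease: its second moment minus the square of its
  conditional mean.\<close>

lemma next_avg_square_mart_diff:
  assumes "m < n" "\<sigma> \<in> perms n"
  shows "next_avg n m (\<lambda>\<sigma>. (mart_diff n 2 m \<sigma>)\<^sup>2) \<sigma>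
    = (2 * windows n 2 m \<sigma> + 2 * windows n 3 m \<sigma>) / real (n - m) - (2 / real (n - m) * windows n 2 m \<sigma>)\<^sup>2"
proof -
  define u where "u = real (n - m)"
  let ?d = "\<lambda>\<sigma>. windows n 2 m \<sigma> - windows n 2 (Suc m) \<sigma>"
  let ?y = "\<lambda>\<sigma>. 2 / u * windows n 2 m \<sigma>"
  have "next_avg n m (\<lambda>\<sigma>. (mart_diff n 2 m \<sigma>)\<^sup>2) \<sigma>
      = next_avg n m (\<lambda>\<sigma>. (?d \<sigma>)\<^sup>2 - 2 * (?y \<sigma> * ?d \<sigma>) + (?y \<sigma>)\<^sup>2) \<sigma>"
  proof -
    have "mart_diff n 2 m \<sigma> = ?y \<sigma> - ?d \<sigma>" for \<sigma>
      by (simp add: mart_diff_def u_def left_diff_distrib)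
    moreover have "(y - d)\<^sup>2 = d\<^sup>2 - 2 * (y * d) + y\<^sup>2" for y d :: real by algebra
    ultimately show ?thesis by simp
  qed
  also have "\<dots> = next_avg n m (\<lambda>\<sigma>. (?d \<sigma>)\<^sup>2) \<sigma> - 2 * next_avg n m (\<lambda>\<sigma>. ?y \<sigma> * ?d \<sigma>) \<sigma> + next_avg n m (\<lambda>\<sigma>. (?y \<sigma>)\<^sup>2) \<sigma>"
    by (simp only: next_avg_add next_avg_diff next_avg_mult_left)
  also have "next_avg n m (\<lambda>\<sigma>. ?y \<sigma> * ?d \<sigma>) \<sigma> = ?y \<sigma> * next_avg n m ?d \<sigma>"
    using assms by (intro next_avg_mult_past in_past_comp[OF in_past_windows]) auto
  also have "next_avg n m ?d \<sigma> = ?y \<sigma>"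
    using next_avg_decrease[OF assms, of 2] by (simp add: u_def)
  also have "next_avg n m (\<lambda>\<sigma>. (?y \<sigma>)\<^sup>2) \<sigma> = (?y \<sigma>)\<^sup>2"
    using assms by (intro next_avg_past in_past_comp[OF in_past_windows]) auto
  also have "next_avg n m (\<lambda>\<sigma>. (?d \<sigma>)\<^sup>2) \<sigma> = (2 * windows n 2 m \<sigma> + 2 * windows n 3 m \<sigma>) / u"
    unfolding u_def by (rule next_avg_square_decrease[OF assms])
  finally show ?thesis by (simp add: u_def power2_eq_square)
qed

text \<open>The first three terms are the second moment of the number of pairs: equal, overlapping and
  disjoint pairs of adjacent sites that are unoccupied when \<open>x\<close> of \<open>N\<close> sites are.\<close>

definition pair_var :: "real \<Rightarrow> real \<Rightarrow> real" where
  "pair_var N x = x * (x - 1) / N + 2 * (x * (x - 1) * (x - 2)) / (N * (N - 1))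
     + x * (x - 1) * (x - 2) * (x - 3) / (N * (N - 1)) - (x * (x - 1) / N)\<^sup>2"

text \<open>The variance \<open>V\<close> satisfies a linear recursion, because the new difference
  is orthogonal to the past. Its own mean square involves the mean square of the pair count, hence
  again \<open>V\<close>. The solution was found by counting pairs of pairs and is verified here by
  induction.\<close>

lemma pexp_centred_square:
  assumes "1 < n" "m \<le> n"
  shows "pexp n (\<lambda>\<sigma>. (centred n 2 m \<sigma>)\<^sup>2) = pair_var n (real (n - m))"
  using assms(2)
proof (induction m)
  case 0
  have "pexp n (\<lambda>\<sigma>. (centred n 2 0 \<sigma>)\<^sup>2) = pexp n (\<lambda>_. 0)"
    by (rule pexp_cong) (simp add: centred_0)
  also have "\<dots> = pair_var n n"
  proof -
    have "pair_var N N = (N - 1) + 2 * (N - 2) + (N - 2) * (N - 3) - (N - 1)\<^sup>2" if "N > 1" for N :: real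
    proof -
      have "2 * (N * (N - 1) * (N - 2)) / (N * (N - 1)) = 2 * (N - 2)"
        "N * (N - 1) * (N - 2) * (N - 3) / (N * (N - 1)) = (N - 2) * (N - 3)"
        using that by simp_all
      then show ?thesis using that unfolding pair_var_def by simp
    qed
    moreover have "(N - 1) + 2 * (N - 2) + (N - 2) * (N - 3) - (N - 1)\<^sup>2 = 0" for N :: real
      by algebra
    ultimately show ?thesis using assms by simp
  qed
  finally show ?case by simp
next
  case (Suc m)
  then have m: "m < n" by simp
  define x N where "x = real (n - m)" and "N = real n"
  have x: "x > 0" "real (n - Suc m) = x - 1" using m by (auto simp: x_def of_nat_diff)
  have N: "N > 1" using assms by (simp add: N_def)
  define V where "V = pexp n (\<lambda>\<sigma>. (centred n 2 m \<sigma>)\<^sup>2)"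
  have V: "V = pair_var N x" using Suc by (simp add: V_def x_def N_def)
  define a b where "a = x * (x - 1) / N" and "b = x * (x - 1) * (x - 2) / (N * (N - 1))"
  have a: "pexp n (windows n 2 m) = a"
    using pexp_windows_2[of n m] m by (simp add: a_def x_def N_def)
  have b: "pexp n (windows n 3 m) = b"
    using pexp_windows_3[of n m] m assms by (simp add: b_def x_def N_def)
  have "pexp n (\<lambda>\<sigma>. (windows n 2 m \<sigma>)\<^sup>2) = pexp n (\<lambda>\<sigma>. (centred n 2 m \<sigma>)\<^sup>2 + 2 * a * windows n 2 m \<sigma> - a\<^sup>2)"
    by (rule pexp_cong) (simp add: centred_def a power2_eq_square algebra_simps)
  also have "\<dots> = V + a\<^sup>2"
    by (simp add: pexp_add pexp_diff pexp_mult_left a V_def power2_eq_square)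
  finally have sq: "pexp n (\<lambda>\<sigma>. (windows n 2 m \<sigma>)\<^sup>2) = V + a\<^sup>2" .
  have "pexp n (\<lambda>\<sigma>. (mart_diff n 2 m \<sigma>)\<^sup>2) = pexp n (next_avg n m (\<lambda>\<sigma>. (mart_diff n 2 m \<sigma>)\<^sup>2))"
    by (rule pexp_next_avg[OF m, symmetric])
  also have "\<dots> = pexp n (\<lambda>\<sigma>. (2 * windows n 2 m \<sigma> + 2 * windows n 3 m \<sigma>) / x - (4 / x\<^sup>2) * (windows n 2 m \<sigma>)\<^sup>2)"
    by (rule pexp_cong) (simp add: next_avg_square_mart_diff[OF m] x_def power_mult_distrib power_divide)
  also have "\<dots> = (2 * a + 2 * b) / x - (4 / x\<^sup>2) * (V + a\<^sup>2)"
    by (simp add: pexp_add pexp_diff pexp_divide pexp_mult_left a b sq)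
  finally have D: "pexp n (\<lambda>\<sigma>. (mart_diff n 2 m \<sigma>)\<^sup>2) = (2 * a + 2 * b) / x - (4 / x\<^sup>2) * (V + a\<^sup>2)" .
  have orth: "pexp n (\<lambda>\<sigma>. centred n 2 m \<sigma> * mart_diff n 2 m \<sigma>) = 0"
  proof -
    have "pexp n (\<lambda>\<sigma>. centred n 2 m \<sigma> * mart_diff n 2 m \<sigma>)
        = pexp n (\<lambda>\<sigma>. centred n 2 m \<sigma> * next_avg n m (mart_diff n 2 m) \<sigma>)"
      using m by (intro pexp_mult_past in_past_centred) auto
    also have "\<dots> = pexp n (\<lambda>\<sigma>. 0)" by (rule pexp_cong) (simp add: next_avg_mart_diff[OF m])
    finally show ?thesis by simp
  qed
  have "pexp n (\<lambda>\<sigma>. (centred n 2 (Suc m) \<sigma>)\<^sup>2)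
      = pexp n (\<lambda>\<sigma>. (1 - 2 / x)\<^sup>2 * (centred n 2 m \<sigma>)\<^sup>2
          + 2 * (1 - 2 / x) * (centred n 2 m \<sigma> * mart_diff n 2 m \<sigma>) + (mart_diff n 2 m \<sigma>)\<^sup>2)"
    using m by (intro pexp_cong) (simp add: centred_Suc x_def power2_sum power_mult_distrib)
  also have "\<dots> = (1 - 2 / x)\<^sup>2 * V + ((2 * a + 2 * b) / x - (4 / x\<^sup>2) * (V + a\<^sup>2))"
    by (simp add: pexp_add pexp_mult_left orth D V_def)
  \<comment> \<open>The two contributions of \<open>V\<close> combine, since (1 - 2/x)^2 - 4/x^2 = 1
    - 4/x.\<close>
  also have "\<dots> = (1 - 4 / x) * V + (2 * a + 2 * b) / x - 4 * (a / x)\<^sup>2"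
    by (simp add: power2_eq_square algebra_simps add_divide_distrib diff_divide_distrib)
  also have "\<dots> = pair_var N (x - 1)"
  proof -
    \<comment> \<open>Taking out the factor \<open>x\<close> turns \<open>(1 - 4 / x) * V\<close>
      into an expression that is polynomial in \<open>x\<close>.\<close>
    have "V = x * ((x - 1) / N + 2 * ((x - 1) * (x - 2)) / (N * (N - 1))
       + (x - 1) * (x - 2) * (x - 3) / (N * (N - 1)) - x * (x - 1)\<^sup>2 / N\<^sup>2)" (is "_ = x * ?v")
      unfolding V pair_var_def by (simp add: power2_eq_square algebra_simps)
    then have "(1 - 4 / x) * V = (x - 4) * ?v"
      using x(1) by (simp add: left_diff_distrib)
    moreover have "(2 * a + 2 * b) / x = 2 * (x - 1) / N + 2 * ((x - 1) * (x - 2)) / (N * (N - 1))"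
      using x(1) unfolding a_def b_def by (simp add: add_divide_distrib)
    moreover have "a / x = (x - 1) / N" using x(1) by (simp add: a_def)
    moreover have "(x - 4) * ?v + (2 * (x - 1) / N + 2 * ((x - 1) * (x - 2)) / (N * (N - 1))) - 4 * ((x - 1) / N)\<^sup>2
      = pair_var N (x - 1)"
    proof -
      \<comment> \<open>With \<open>p\<close> for 1/N and \<open>q\<close> for 1/(N (N - 1)),
        regarded as independent variables, this is a polynomial identity.\<close>
      have "(x - 4) * ((x - 1) * p + 2 * ((x - 1) * (x - 2)) * q + (x - 1) * (x - 2) * (x - 3) * q - x * (x - 1)\<^sup>2 * p\<^sup>2)
          + (2 * (x - 1) * p + 2 * ((x - 1) * (x - 2)) * q) - 4 * ((x - 1) * p)\<^sup>2
        = (x - 1) * (x - 1 - 1) * p + 2 * ((x - 1) * (x - 1 - 1) * (x - 1 - 2)) * q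
          + (x - 1) * (x - 1 - 1) * (x - 1 - 2) * (x - 1 - 3) * q - ((x - 1) * (x - 1 - 1) * p)\<^sup>2" for p q :: real
        by algebra
      from this[of "inverse N" "inverse (N * (N - 1))"] show ?thesis
        unfolding pair_var_def divide_inverse power_inverse .
    qed
    ultimately show ?thesis by (simp only: add.assoc[symmetric])
  qed
  finally show ?case by (simp add: x N_def)
qed


section \<open>Runs and the symmetry between occupied and unoccupied sites\<close>

lemma windows_2_eq:
  assumes "\<sigma> \<in> perms n"
  shows "windows n 2 m \<sigma> = (\<Sum>k=1..n-1. of_bool (k \<in> \<sigma> ` {m<..n}) * of_bool (k + 1 \<in> \<sigma> ` {m<..n}))"
proof -
  have two: "{k..<k+2} = {k, k + 1}" for k :: nat by auto
  \<comment> \<open>The window starting at \<open>n\<close> sticks out, which is why the sum ends at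
    \<open>n - 1\<close>.\<close>
  have out: "n + 1 \<notin> \<sigma> ` {m<..n}"
  proof -
    have "\<sigma> ` {m<..n} \<subseteq> \<sigma> ` {1..n}" by (intro image_mono) auto
    then show ?thesis using assms permutes_image[of \<sigma> "{1..n}"] by (auto simp: perms_def)
  qed
  show ?thesis
  proof (cases n)
    case (Suc l)
    have "windows n 2 m \<sigma> = (\<Sum>k=1..n. of_bool (k \<in> \<sigma> ` {m<..n}) * of_bool (k + 1 \<in> \<sigma> ` {m<..n}))"
      unfolding windows_def two by (intro sum.cong refl) auto
    also have "\<dots> = (\<Sum>k=1..n-1. of_bool (k \<in> \<sigma> ` {m<..n}) * of_bool (k + 1 \<in> \<sigma> ` {m<..n}))"
      using out unfolding Suc by simp
    finally show ?thesis .
  qed (simp add: windows_def)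
qed

lemma unoccupied_facts:
  assumes "\<sigma> \<in> perms n" "m \<le> n"
  shows "\<sigma> ` {m<..n} \<subseteq> {1..n}" "(\<Sum>k=1..n. of_bool (k \<in> \<sigma> ` {m<..n})) = real (n - m)"
proof -
  have inj: "inj \<sigma>" and im: "\<sigma> ` {1..n} = {1..n}"
    using assms permutes_image[of \<sigma> "{1..n}"] by (auto simp: perms_def dest: permutes_inj)
  show Z: "\<sigma> ` {m<..n} \<subseteq> {1..n}" using image_mono[of "{m<..n}" "{1..n}" \<sigma>] im by auto
  have "(\<Sum>k=1..n. of_bool (k \<in> \<sigma> ` {m<..n})) = real (card ({1..n} \<inter> \<sigma> ` {m<..n}))"
    by simp
  also have "{1..n} \<inter> \<sigma> ` {m<..n} = \<sigma> ` {m<..n}" using Z by blast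
  also have "card (\<sigma> ` {m<..n}) = n - m"
    using card_image[OF inj_on_subset[OF inj subset_UNIV], of "{m<..n}"] by simp
  finally show "(\<Sum>k=1..n. of_bool (k \<in> \<sigma> ` {m<..n})) = real (n - m)" .
qed

lemma sum_unoccupied_shift:
  assumes "\<sigma> \<in> perms n" "m \<le> n" "0 < n"
  shows "(\<Sum>k=1..n-1. of_bool (k \<in> \<sigma> ` {m<..n})) = real (n - m) - of_bool (n \<in> \<sigma> ` {m<..n})"
    "(\<Sum>k=1..n-1. of_bool (k + 1 \<in> \<sigma> ` {m<..n})) = real (n - m) - of_bool (1 \<in> \<sigma> ` {m<..n})"
proof -
  let ?J = "\<lambda>k. of_bool (k \<in> \<sigma> ` {m<..n}) :: real"
  obtain l where n: "n = Suc l" using assms(3) by (cases n) auto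
  have "(\<Sum>k=1..n. ?J k) = (\<Sum>k=1..l. ?J k) + ?J n" unfolding n by simp
  then show "(\<Sum>k=1..n-1. ?J k) = real (n - m) - ?J n"
    unfolding unoccupied_facts(2)[OF assms(1,2)] by (simp add: n)
  have "(\<Sum>k=1..n. ?J k) = ?J 1 + (\<Sum>k=Suc 1..n. ?J k)"
    using assms(3) by (intro sum.atLeast_Suc_atMost) simp
  also have "(\<Sum>k=Suc 1..n. ?J k) = (\<Sum>k=1..l. ?J (Suc k))"
    unfolding n by (rule sum.shift_bounds_cl_Suc_ivl)
  finally show "(\<Sum>k=1..n-1. ?J (k + 1)) = real (n - m) - ?J 1"
    unfolding unoccupied_facts(2)[OF assms(1,2)] by (simp add: n)
qed

lemma occupied_eq:
  assumes "\<sigma> \<in> perms n" "k \<in> {1..n}"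
  shows "real_of_int (occupied \<sigma> m k) = 1 - of_bool (k \<in> \<sigma> ` {m<..n})"
proof -
  have p: "\<sigma> permutes {1..n}" using assms by (simp add: perms_def)
  have "inv \<sigma> k \<in> {1..n}" using permutes_in_image[OF permutes_inv[OF p]] assms(2) by blast
  moreover have "\<sigma> (inv \<sigma> k) = k" using permutes_inverses(1)[OF p] .
  ultimately have "k \<in> \<sigma> ` {m<..n} \<longleftrightarrow> m < inv \<sigma> k"
    using permutes_inverses(2)[OF p] by force
  then show ?thesis by (auto simp: occupied_def)
qed

text \<open>A run begins at site 1 or directly after an unoccupied site. Expanding the product in
  the definition leaves the unoccupied sites minus the unoccupied pairs, up to the two end
  sites.\<close>

lemma runs_eq:
  assumes "\<sigma> \<in> perms n" "m \<le> n" "0 < n"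
  shows "real_of_int (runs n m \<sigma>) = real (n - m) + 1 - windows n 2 m \<sigma>
    - of_bool (1 \<in> \<sigma> ` {m<..n}) - of_bool (n \<in> \<sigma> ` {m<..n})"
proof -
  let ?J = "\<lambda>k. of_bool (k \<in> \<sigma> ` {m<..n}) :: real"
  have "real_of_int (runs n m \<sigma>) = (1 - ?J 1) + (\<Sum>k=1..n-1. ?J k * (1 - ?J (k + 1)))"
  proof -
    have A: "real_of_int ((1 - occupied \<sigma> m k) * occupied \<sigma> m (k + 1)) = ?J k * (1 - ?J (k + 1))"
      if "k \<in> {1..n-1}" for k
    proof -
      have "k \<in> {1..n}" "k + 1 \<in> {1..n}" using that by auto
      then show ?thesis
        unfolding of_int_mult of_int_diff of_int_1 by (simp only: occupied_eq[OF assms(1)]) simp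
    qed
    have B: "real_of_int (occupied \<sigma> m 1) = 1 - ?J 1"
      using assms(3) by (intro occupied_eq assms(1)) simp
    show ?thesis
      unfolding runs_def of_int_add of_int_sum B
      by (intro arg_cong2[where f = "(+)"] sum.cong refl A)
  qed
  also have "(\<Sum>k=1..n-1. ?J k * (1 - ?J (k + 1))) = (\<Sum>k=1..n-1. ?J k) - (\<Sum>k=1..n-1. ?J k * ?J (k + 1))"
    by (simp only: right_diff_distrib mult_1_right sum_subtractf)
  finally show ?thesis
    unfolding sum_unoccupied_shift(1)[OF assms] windows_2_eq[OF assms(1)] by linarith
qed

text \<open>The pair count enters the number of runs with a minus sign, hence the plus sign here.
  The bound 4 adds four errors of size at most 1: two from rounding \<open>real n * t\<close>, one
  from the factor u - 1 instead of u in the mean, and one from the end sites.\<close>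

lemma scaled_runs_approx:
  assumes \<sigma>: "\<sigma> \<in> perms n" and n: "0 < n" and t: "t \<in> {0..1}"
  shows "\<bar>sqrt n * scaled_runs n \<sigma> t + centred n 2 (nat \<lfloor>real n * t\<rfloor>) \<sigma>\<bar> \<le> 4"
proof -
  define m where "m = nat \<lfloor>real n * t\<rfloor>"
  define \<delta> where "\<delta> = real n * t - real m"
  have nt: "0 \<le> real n * t" "real n * t \<le> n" using t by (auto intro: mult_left_le)
  have m: "real m = \<lfloor>real n * t\<rfloor>" using nt by (simp add: m_def)
  then have \<delta>: "0 \<le> \<delta>" "\<delta> < 1" unfolding \<delta>_def by linarith+
  have mn: "m \<le> n" using \<delta> nt \<delta>_def by linarith
  define N T where "N = real n" and "T = t"
  have N: "N \<ge> 1" and T: "0 \<le> T" "T \<le> 1" using n t by (auto simp: N_def T_def)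
  have u: "real (n - m) = N * (1 - T) + \<delta>"
    using mn by (simp add: of_nat_diff \<delta>_def N_def T_def algebra_simps)
  let ?J = "\<lambda>k. of_bool (k \<in> \<sigma> ` {m<..n}) :: real"
  have "sqrt n * scaled_runs n \<sigma> t = real_of_int (runs n m \<sigma>) - N * T * (1 - T)"
    using n by (simp add: scaled_runs_def m_def N_def T_def)
  also have "\<dots> = real (n - m) + 1 - windows n 2 m \<sigma> - ?J 1 - ?J n - N * T * (1 - T)"
    by (simp add: runs_eq[OF \<sigma> mn n])
  also have "\<dots> + centred n 2 m \<sigma>
      = (real (n - m) - real (n - m) * (real (n - m) - 1) / N - N * T * (1 - T)) + (1 - ?J 1 - ?J n)"
    by (simp add: centred_def pexp_windows_2[OF n mn] N_def)
  finally have eq: "sqrt n * scaled_runs n \<sigma> t + centred n 2 m \<sigma>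
      = (real (n - m) - real (n - m) * (real (n - m) - 1) / N - N * T * (1 - T)) + (1 - ?J 1 - ?J n)" .
  have "real (n - m) - real (n - m) * (real (n - m) - 1) / N - N * T * (1 - T)
      = \<delta> * (2 * T - 1) + (1 - T) + \<delta> / N - \<delta>\<^sup>2 / N"
    using N unfolding u by (simp add: field_simps power2_eq_square)
  moreover have "\<bar>\<delta> * (2 * T - 1)\<bar> \<le> 1"
    unfolding abs_mult using \<delta> T by (intro mult_le_one) auto
  moreover have "0 \<le> \<delta> / N - \<delta>\<^sup>2 / N" "\<delta> / N - \<delta>\<^sup>2 / N \<le> 1"
  proof -
    have "\<delta>\<^sup>2 \<le> \<delta>" using \<delta> by (simp add: power2_eq_square mult_left_le)
    then show "0 \<le> \<delta> / N - \<delta>\<^sup>2 / N" using N by (simp add: divide_right_mono)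
    have "\<delta> / N \<le> 1" using \<delta> N by simp
    moreover have "0 \<le> \<delta>\<^sup>2 / N" using N by simp
    ultimately show "\<delta> / N - \<delta>\<^sup>2 / N \<le> 1" by linarith
  qed
  moreover have "\<bar>1 - ?J 1 - ?J n\<bar> \<le> 1" by simp
  ultimately show ?thesis
    unfolding m_def[symmetric] eq using T by linarith
qed

text \<open>Reversing time exchanges occupied and unoccupied sites.  This transfers moment bounds from the
  first half of the time interval, where the drift coefficient \<open>2 / (n - m)\<close> is at most \<open>4 / n\<close>, to
  the second half, where it is not under control.\<close>

definition reversal :: "nat \<Rightarrow> nat \<Rightarrow> nat" where
  "reversal n i = (if i \<in> {1..n} then n + 1 - i else i)"

lemma reversal_permutes: "reversal n permutes {1..n}"
proof (rule bij_imp_permutes)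
  show "bij_betw (reversal n) {1..n} {1..n}"
    by (rule bij_betw_byWitness[where f' = "reversal n"]) (auto simp: reversal_def)
qed (auto simp: reversal_def)

text \<open>Reversal complements the unoccupied set. In the complement the product over an adjacent
  pair expands with the same quadratic term, while the linear terms sum to a deterministic number up
  to the two end sites. After centring only these end sites and their means remain.\<close>

lemma centred_reversal:
  assumes \<sigma>: "\<sigma> \<in> perms n" and m: "m \<le> n" and n: "0 < n"
  shows "\<bar>centred n 2 (n - m) (\<sigma> \<circ> reversal n) - centred n 2 m \<sigma>\<bar> \<le> 2"
proof -
  have inj: "inj \<sigma>" and im: "\<sigma> ` {1..n} = {1..n}"
    using \<sigma> permutes_image[of \<sigma> "{1..n}"] by (auto simp: perms_def dest: permutes_inj)
  have \<sigma>': "\<sigma> \<circ> reversal n \<in> perms n"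
    using \<sigma> reversal_permutes by (auto simp: perms_def intro: permutes_compose)
  have "reversal n ` {n - m<..n} = {1..m}"
  proof (intro equalityI subsetI)
    fix i assume "i \<in> {1..m}"
    then show "i \<in> reversal n ` {n - m<..n}"
      using m by (intro image_eqI[of _ _ "n + 1 - i"]) (auto simp: reversal_def)
  qed (use m in \<open>auto simp: reversal_def\<close>)
  then have "(\<sigma> \<circ> reversal n) ` {n - m<..n} = \<sigma> ` ({1..n} - {m<..n})"
    unfolding image_comp[symmetric] using m by (intro arg_cong[where f = "image \<sigma>"]) auto
  also have "\<dots> = {1..n} - \<sigma> ` {m<..n}"
    by (simp only: image_set_diff[OF inj] im)
  finally have Z: "(\<sigma> \<circ> reversal n) ` {n - m<..n} = {1..n} - \<sigma> ` {m<..n}" .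
  let ?J = "\<lambda>k. of_bool (k \<in> \<sigma> ` {m<..n}) :: real"
  have "windows n 2 (n - m) (\<sigma> \<circ> reversal n) = (\<Sum>k=1..n-1. (1 - ?J k) * (1 - ?J (k + 1)))"
    unfolding windows_2_eq[OF \<sigma>'] Z using n by (intro sum.cong refl) auto
  also have "\<dots> = (\<Sum>k=1..n-1. (1 - ?J k - ?J (k + 1)) + ?J k * ?J (k + 1))"
    by (intro sum.cong refl) (simp add: algebra_simps del: of_bool_eq_0_iff)
  also have "\<dots> = real (n - 1) - (\<Sum>k=1..n-1. ?J k) - (\<Sum>k=1..n-1. ?J (k + 1))
      + (\<Sum>k=1..n-1. ?J k * ?J (k + 1))"
    by (simp only: sum.distrib sum_subtractf sum_constant) simp
  also have "\<dots> = real n - 1 - 2 * real (n - m) + ?J 1 + ?J n + windows n 2 m \<sigma>"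
    unfolding sum_unoccupied_shift[OF \<sigma> m n] windows_2_eq[OF \<sigma>] using n by (simp add: of_nat_diff)
  finally have w: "windows n 2 (n - m) (\<sigma> \<circ> reversal n)
      = real n - 1 - 2 * real (n - m) + ?J 1 + ?J n + windows n 2 m \<sigma>" .
  define N u where "N = real n" and "u = real (n - m)"
  have N: "N \<ge> 1" and u: "0 \<le> u" "u \<le> N" using n by (auto simp: N_def u_def)
  have nm: "real (n - (n - m)) = N - u" using m by (simp add: N_def u_def of_nat_diff)
  have "centred n 2 (n - m) (\<sigma> \<circ> reversal n) - centred n 2 m \<sigma>
      = N - 1 - 2 * u + ?J 1 + ?J n - (N - u) * (N - u - 1) / N + u * (u - 1) / N"
    unfolding centred_def w pexp_windows_2[OF n m] pexp_windows_2[OF n diff_le_self] nm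
    by (simp add: N_def u_def)
  also have "\<dots> = ?J 1 + ?J n - 2 * (u / N)"
    using N by (simp add: field_simps)
  also have "\<bar>\<dots>\<bar> \<le> 2"
  proof -
    have "0 \<le> u / N" "u / N \<le> 1" using u N by auto
    then show ?thesis by (simp add: abs_le_iff)
  qed
  finally show ?thesis .
qed

section \<open>Fourth moments of increments\<close>

lemma power4_sum_le: "(x + y) ^ 4 \<le> 8 * (x ^ 4 + y ^ 4)" for x y :: real
proof -
  have sq: "(a + b)\<^sup>2 \<le> 2 * (a\<^sup>2 + b\<^sup>2)" for a b :: real
    using sum_squares_bound[of a b] by (simp add: power2_sum)
  have "(x + y) ^ 4 = ((x + y)\<^sup>2)\<^sup>2" by simp
  also have "\<dots> \<le> (2 * (x\<^sup>2 + y\<^sup>2))\<^sup>2" by (intro power_mono sq) auto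
  also have "\<dots> = 4 * (x\<^sup>2 + y\<^sup>2)\<^sup>2" by algebra
  also have "\<dots> \<le> 4 * (2 * ((x\<^sup>2)\<^sup>2 + (y\<^sup>2)\<^sup>2))" by (intro mult_left_mono sq) auto
  finally show ?thesis by simp
qed

lemma power4_sum_card_le: "(\<Sum>i\<in>A. f i :: real) ^ 4 \<le> real (card A) ^ 3 * (\<Sum>i\<in>A. f i ^ 4)"
proof -
  have "(\<Sum>i\<in>A. f i) ^ 4 = ((\<Sum>i\<in>A. f i)\<^sup>2)\<^sup>2" by simp
  also have "\<dots> \<le> ((\<Sum>i\<in>A. (f i)\<^sup>2) * card A)\<^sup>2"
    using sum_squared_le_sum_of_squares[of f A] by (intro power_mono) auto
  also have "\<dots> = (real (card A))\<^sup>2 * (\<Sum>i\<in>A. (f i)\<^sup>2)\<^sup>2" by (simp add: power_mult_distrib mult.commute)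
  also have "\<dots> \<le> (real (card A))\<^sup>2 * ((\<Sum>i\<in>A. ((f i)\<^sup>2)\<^sup>2) * card A)"
    by (intro mult_left_mono sum_squared_le_sum_of_squares) auto
  also have "(\<Sum>i\<in>A. ((f i)\<^sup>2)\<^sup>2) = (\<Sum>i\<in>A. f i ^ 4)" by simp
  also have "(real (card A))\<^sup>2 * ((\<Sum>i\<in>A. f i ^ 4) * card A) = real (card A) ^ 3 * (\<Sum>i\<in>A. f i ^ 4)"
    by algebra
  finally show ?thesis .
qed

text \<open>The increment is a martingale sum \<open>S\<close> minus an accumulated drift
  \<open>R\<close>. The drift has \<open>h\<close> terms of size at most 4/n times a centred count
  with fourth moment at most 128 n^2, which gives 32768 h^4 / n^2, and h is at most n. The constant
  is 8 (128 + 32768).\<close>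

lemma centred_increment_lower:
  assumes ab: "a \<le> b" "2 * b \<le> n + 1" "b \<le> n"
  shows "pexp n (\<lambda>\<sigma>. (centred n 2 b \<sigma> - centred n 2 a \<sigma>) ^ 4) \<le> 263168 * (real (b - a))\<^sup>2"
proof (cases "a = b")
  case False
  define h where "h = b - a"
  have h: "b = a + h" "0 < h" using ab False by (auto simp: h_def)
  have n: "0 < n" using ab h by simp
  define S where "S k \<sigma> = (\<Sum>i<k. mart_diff n 2 (a + i) \<sigma>)" for k \<sigma>
  define R where "R k \<sigma> = (\<Sum>i<k. 2 / real (n - (a + i)) * centred n 2 (a + i) \<sigma>)" for k \<sigma>
  have dec: "centred n 2 (a + k) \<sigma> - centred n 2 a \<sigma> = S k \<sigma> - R k \<sigma>" if "k \<le> h" for k \<sigma>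
    using that
  proof (induction k)
    case (Suc k)
    have "centred n 2 (Suc (a + k)) \<sigma> = (1 - 2 / real (n - (a + k))) * centred n 2 (a + k) \<sigma> + mart_diff n 2 (a + k) \<sigma>"
      using Suc.prems h ab by (subst centred_Suc) auto
    also have "\<dots> = centred n 2 (a + k) \<sigma> - 2 / real (n - (a + k)) * centred n 2 (a + k) \<sigma> + mart_diff n 2 (a + k) \<sigma>"
      by (simp only: left_diff_distrib mult_1_left)
    finally show ?case using Suc by (simp add: S_def R_def)
  qed (simp add: S_def R_def)
  have S4: "pexp n (\<lambda>\<sigma>. (S h \<sigma>) ^ 4) \<le> 8 * 2 ^ 4 * (real h)\<^sup>2"
  proof (rule martingale_moments(2)[where a = a and N = h and S = S
        and D = "\<lambda>k. mart_diff n 2 (a + k)" and \<alpha> = "\<lambda>_. 1" and d = 2])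
    fix k assume k: "k < h"
    then have lt: "a + k < n" using h ab by simp
    show "in_past n (a + k) (S k)"
      unfolding S_def using lt by (intro in_past_sum in_past_mart_diff) auto
    fix \<sigma> assume \<sigma>: "\<sigma> \<in> perms n"
    show "\<bar>mart_diff n 2 (a + k) \<sigma>\<bar> \<le> 2" using abs_mart_diff_le[OF lt \<sigma>, of 2] by simp
    show "next_avg n (a + k) (mart_diff n 2 (a + k)) \<sigma> = 0" by (rule next_avg_mart_diff[OF lt \<sigma>])
  qed (use h ab in \<open>auto simp: S_def\<close>)
  have R4: "pexp n (\<lambda>\<sigma>. (R h \<sigma>) ^ 4) \<le> 32768 * (real h)\<^sup>2"
  proof -
    have "pexp n (\<lambda>\<sigma>. (R h \<sigma>) ^ 4)
      \<le> pexp n (\<lambda>\<sigma>. real h ^ 3 * (\<Sum>i<h. (4 / n) ^ 4 * centred n 2 (a + i) \<sigma> ^ 4))"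
    proof (rule pexp_mono)
      fix \<sigma>
      have "(R h \<sigma>) ^ 4 \<le> real (card {..<h}) ^ 3 * (\<Sum>i<h. (2 / real (n - (a + i)) * centred n 2 (a + i) \<sigma>) ^ 4)"
        unfolding R_def by (rule power4_sum_card_le)
      also have "\<dots> \<le> real h ^ 3 * (\<Sum>i<h. (4 / n) ^ 4 * centred n 2 (a + i) \<sigma> ^ 4)"
        unfolding power_mult_distrib card_lessThan
      proof (intro mult_left_mono sum_mono mult_right_mono power_mono)
        fix i assume "i \<in> {..<h}"
        \<comment> \<open>Steps run only up to \<open>b - 1\<close>, so
          \<open>2 * b \<le> n + 1\<close> suffices. This admits the midpoint for odd
          \<open>n\<close>.\<close>
        then have "n \<le> 2 * (n - (a + i))" using h ab by auto
        then have "real n \<le> 2 * real (n - (a + i))" by linarith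
        then show "2 / real (n - (a + i)) \<le> 4 / real n" using n by (simp add: field_simps)
      qed auto
      finally show "(R h \<sigma>) ^ 4 \<le> real h ^ 3 * (\<Sum>i<h. (4 / n) ^ 4 * centred n 2 (a + i) \<sigma> ^ 4)" .
    qed
    also have "\<dots> = real h ^ 3 * (\<Sum>i<h. (4 / n) ^ 4 * pexp n (\<lambda>\<sigma>. centred n 2 (a + i) \<sigma> ^ 4))"
      by (simp only: pexp_mult_left pexp_sum)
    also have "\<dots> \<le> real h ^ 3 * (\<Sum>i<h. (4 / n) ^ 4 * (128 * (real n)\<^sup>2))"
    proof (intro mult_left_mono sum_mono)
      fix i assume "i \<in> {..<h}"
      then have i: "a + i \<le> n" "\<And>k. k < a + i \<Longrightarrow> real 2 \<le> 2 * real (n - k)" using h ab by auto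
      have "pexp n (\<lambda>\<sigma>. centred n 2 (a + i) \<sigma> ^ 4) \<le> 8 * real 2 ^ 4 * (real (a + i))\<^sup>2"
        by (rule centred_moments(2)) (use i in auto)
      also have "\<dots> \<le> 128 * (real n)\<^sup>2"
        using i(1) by (simp add: power_mono del: of_nat_add)
      finally show "pexp n (\<lambda>\<sigma>. centred n 2 (a + i) \<sigma> ^ 4) \<le> 128 * (real n)\<^sup>2" .
    qed auto
    also have "\<dots> = 32768 * ((real h)\<^sup>2 * (real h / n)\<^sup>2)"
      using n by (simp add: field_simps power2_eq_square power3_eq_cube power4_eq_xxxx)
    also have "\<dots> \<le> 32768 * ((real h)\<^sup>2 * 1)"
      using h ab n by (intro mult_left_mono power_le_one) (auto simp: h_def)
    finally show ?thesis by simp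
  qed
  have "pexp n (\<lambda>\<sigma>. (centred n 2 b \<sigma> - centred n 2 a \<sigma>) ^ 4)
      \<le> pexp n (\<lambda>\<sigma>. 8 * ((S h \<sigma>) ^ 4 + (R h \<sigma>) ^ 4))"
    using power4_sum_le[of "S h _" "- R h _"] by (intro pexp_mono) (simp add: h(1) dec)
  also have "\<dots> = 8 * (pexp n (\<lambda>\<sigma>. (S h \<sigma>) ^ 4) + pexp n (\<lambda>\<sigma>. (R h \<sigma>) ^ 4))"
    by (simp add: pexp_mult_left pexp_add)
  also have "\<dots> \<le> 8 * (8 * 2 ^ 4 * (real h)\<^sup>2 + 32768 * (real h)\<^sup>2)"
    using S4 R4 by (intro mult_left_mono add_mono) auto
  finally show ?thesis by (simp add: h(1))
qed simp

text \<open>Reversal changes the increment by at most 4, twice the error of one count. The additive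
  256 = 4^4 is absorbed because distinct integer times are at least 1 apart: 8 (263168 + 256) =
  2107392.\<close>

lemma centred_increment_upper:
  assumes ab: "a \<le> b" "n \<le> 2 * a" "b \<le> n"
  shows "pexp n (\<lambda>\<sigma>. (centred n 2 b \<sigma> - centred n 2 a \<sigma>) ^ 4) \<le> 2107392 * (real (b - a))\<^sup>2"
proof (cases "a = b")
  case False
  have n: "0 < n" and h: "1 \<le> real (b - a)" using ab False by auto
  let ?d = "\<lambda>\<sigma>. centred n 2 (n - a) \<sigma> - centred n 2 (n - b) \<sigma>"
  have "pexp n (\<lambda>\<sigma>. (centred n 2 b \<sigma> - centred n 2 a \<sigma>) ^ 4)
      \<le> pexp n (\<lambda>\<sigma>. 8 * ((?d (\<sigma> \<circ> reversal n)) ^ 4 + 256))"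
  proof (rule pexp_mono)
    fix \<sigma> assume \<sigma>: "\<sigma> \<in> perms n"
    define e where "e = - (centred n 2 b \<sigma> - centred n 2 a \<sigma>) - ?d (\<sigma> \<circ> reversal n)"
    have "\<bar>e\<bar> \<le> 4"
      using centred_reversal[OF \<sigma> _ n, of a] centred_reversal[OF \<sigma> _ n, of b] ab
      unfolding e_def by linarith
    then have "e ^ 4 \<le> 4 ^ 4" using power_mono[of "\<bar>e\<bar>" 4 4] by simp
    moreover have "(centred n 2 b \<sigma> - centred n 2 a \<sigma>) ^ 4 = (?d (\<sigma> \<circ> reversal n) + e) ^ 4"
      unfolding e_def by (simp only: add_diff_cancel_left' power_minus_even even_numeral
          add.commute[of "?d (\<sigma> \<circ> reversal n)"] diff_add_cancel)
    moreover have "(?d (\<sigma> \<circ> reversal n) + e) ^ 4 \<le> 8 * ((?d (\<sigma> \<circ> reversal n)) ^ 4 + e ^ 4)"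
      by (rule power4_sum_le)
    ultimately show "(centred n 2 b \<sigma> - centred n 2 a \<sigma>) ^ 4 \<le> 8 * ((?d (\<sigma> \<circ> reversal n)) ^ 4 + 256)"
      by simp
  qed
  also have "\<dots> = 8 * (pexp n (\<lambda>\<sigma>. (?d (\<sigma> \<circ> reversal n)) ^ 4) + 256)"
    by (simp only: pexp_mult_left pexp_add pexp_const)
  also have "pexp n (\<lambda>\<sigma>. (?d (\<sigma> \<circ> reversal n)) ^ 4) = pexp n (\<lambda>\<sigma>. (?d \<sigma>) ^ 4)"
    by (rule pexp_compose_right[OF reversal_permutes])
  also have "\<dots> \<le> 263168 * (real ((n - a) - (n - b)))\<^sup>2"
    using ab by (intro centred_increment_lower) auto
  also have "(n - a) - (n - b) = b - a" using ab by simp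
  also have "8 * (263168 * (real (b - a))\<^sup>2 + 256) \<le> 2107392 * (real (b - a))\<^sup>2"
    using one_le_power[OF h, of 2] by simp
  finally show ?thesis by simp
qed simp

lemma centred_increment:
  assumes ab: "a \<le> b" "b \<le> n"
  shows "pexp n (\<lambda>\<sigma>. (centred n 2 b \<sigma> - centred n 2 a \<sigma>) ^ 4) \<le> 16859136 * (real (b - a))\<^sup>2"
proof -
  let ?d = "\<lambda>a b. pexp n (\<lambda>\<sigma>. (centred n 2 b \<sigma> - centred n 2 a \<sigma>) ^ 4)"
  \<comment> \<open>This midpoint satisfies both \<open>2 * p \<le> n + 1\<close> and
    \<open>n \<le> 2 * p\<close>, as the bounds for the two halves require.\<close>
  define p where "p = (n + 1) div 2"
  consider "b \<le> p" | "p \<le> a" | "a < p" "p < b" by linarith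
  then show ?thesis
  proof cases
    case 1
    then have "?d a b \<le> 263168 * (real (b - a))\<^sup>2"
      using ab by (intro centred_increment_lower) (auto simp: p_def)
    also have "\<dots> \<le> 16859136 * (real (b - a))\<^sup>2" by (intro mult_right_mono) auto
    finally show ?thesis .
  next
    case 2
    then have "?d a b \<le> 2107392 * (real (b - a))\<^sup>2"
      using ab by (intro centred_increment_upper) (auto simp: p_def)
    also have "\<dots> \<le> 16859136 * (real (b - a))\<^sup>2" by (intro mult_right_mono) auto
    finally show ?thesis .
  next
    case 3
    have "?d a b \<le> pexp n (\<lambda>\<sigma>. 8 * ((centred n 2 p \<sigma> - centred n 2 a \<sigma>) ^ 4 + (centred n 2 b \<sigma> - centred n 2 p \<sigma>) ^ 4))"
    proof (rule pexp_mono)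
      fix \<sigma>
      have "(centred n 2 b \<sigma> - centred n 2 a \<sigma>) ^ 4
        = ((centred n 2 p \<sigma> - centred n 2 a \<sigma>) + (centred n 2 b \<sigma> - centred n 2 p \<sigma>)) ^ 4" by simp
      also have "\<dots> \<le> 8 * ((centred n 2 p \<sigma> - centred n 2 a \<sigma>) ^ 4 + (centred n 2 b \<sigma> - centred n 2 p \<sigma>) ^ 4)"
        by (rule power4_sum_le)
      finally show "(centred n 2 b \<sigma> - centred n 2 a \<sigma>) ^ 4
        \<le> 8 * ((centred n 2 p \<sigma> - centred n 2 a \<sigma>) ^ 4 + (centred n 2 b \<sigma> - centred n 2 p \<sigma>) ^ 4)" .
    qed
    also have "\<dots> = 8 * (?d a p + ?d p b)" by (simp add: pexp_mult_left pexp_add)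
    also have "\<dots> \<le> 8 * (2107392 * (real (p - a))\<^sup>2 + 2107392 * (real (b - p))\<^sup>2)"
    proof -
      have "?d a p \<le> 263168 * (real (p - a))\<^sup>2"
        using ab 3 by (intro centred_increment_lower) (auto simp: p_def)
      also have "\<dots> \<le> 2107392 * (real (p - a))\<^sup>2" by (intro mult_right_mono) auto
      finally have "?d a p \<le> 2107392 * (real (p - a))\<^sup>2" .
      moreover have "?d p b \<le> 2107392 * (real (b - p))\<^sup>2"
        using ab 3 by (intro centred_increment_upper) (auto simp: p_def)
      ultimately show ?thesis by (intro mult_left_mono add_mono) auto
    qed
    also have "\<dots> \<le> 16859136 * (real (p - a) + real (b - p))\<^sup>2"
      by (simp add: power2_sum)
    also have "real (p - a) + real (b - p) = real (b - a)" using 3 by simp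
    finally show ?thesis .
  qed
qed

section \<open>A dyadic maximal inequality for fourth moments\<close>

lemma power4_sum_le_weighted:
  fixes x y :: real
  shows "(x + y) ^ 4 \<le> 3 / 2 * x ^ 4 + 729 * y ^ 4"
proof -
  \<comment> \<open>The weights are 1 + 1/8 and 1 + 8. Two applications give (9/8)^3, which is below
    3/2, and 9^3 = 729.\<close>
  have sq: "(a + b)\<^sup>2 \<le> 9 / 8 * a\<^sup>2 + 9 * b\<^sup>2" for a b :: real
  proof -
    have "0 \<le> (a - 8 * b)\<^sup>2" by simp
    also have "\<dots> = a\<^sup>2 - 16 * (a * b) + 64 * b\<^sup>2" by algebra
    finally show ?thesis by (simp add: power2_sum)
  qed
  have "(x + y) ^ 4 = ((x + y)\<^sup>2)\<^sup>2" by simp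
  also have "\<dots> \<le> (9 / 8 * x\<^sup>2 + 9 * y\<^sup>2)\<^sup>2" by (intro power_mono sq) auto
  also have "\<dots> \<le> 9 / 8 * (9 / 8 * x\<^sup>2)\<^sup>2 + 9 * (9 * y\<^sup>2)\<^sup>2" by (rule sq)
  also have "\<dots> = 729 / 512 * x ^ 4 + 729 * y ^ 4"
    unfolding power_mult_distrib by (simp add: power_divide)
  also have "\<dots> \<le> 3 / 2 * x ^ 4 + 729 * y ^ 4" by simp
  finally show ?thesis .
qed

definition block_osc :: "(nat \<Rightarrow> 'a \<Rightarrow> real) \<Rightarrow> nat \<Rightarrow> nat \<Rightarrow> 'a \<Rightarrow> real" where
  "block_osc w a h \<sigma> = Max ((\<lambda>j. \<bar>w (a + j) \<sigma> - w a \<sigma>\<bar>) ` {..h})"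

lemma block_osc_ge: "j \<le> h \<Longrightarrow> \<bar>w (a + j) \<sigma> - w a \<sigma>\<bar> \<le> block_osc w a h \<sigma>"
  unfolding block_osc_def by (intro Max_ge) auto

lemma block_osc_attained:
  obtains j where "j \<le> h" "block_osc w a h \<sigma> = \<bar>w (a + j) \<sigma> - w a \<sigma>\<bar>"
proof -
  have "block_osc w a h \<sigma> \<in> (\<lambda>j. \<bar>w (a + j) \<sigma> - w a \<sigma>\<bar>) ` {..h}"
    unfolding block_osc_def by (intro Max_in) auto
  then show ?thesis using that by auto
qed

lemma block_osc_nonneg: "0 \<le> block_osc w a h \<sigma>"
  using block_osc_ge[of 0 h w a \<sigma>] by simp

text \<open>The maximum over the right half is compared with the midpoint.  The weight \<open>3/2\<close> makes the number of blocks grow slower than the bound \<open>4 ^ r\<close>, so the recursion closes.\<close>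

lemma block_osc_double:
  "(block_osc w a (h + h) \<sigma>) ^ 4 \<le> 3 / 2 * ((block_osc w a h \<sigma>) ^ 4 + (block_osc w (a + h) h \<sigma>) ^ 4)
     + 729 * (w (a + h) \<sigma> - w a \<sigma>) ^ 4"
proof -
  obtain j where j: "j \<le> h + h" "block_osc w a (h + h) \<sigma> = \<bar>w (a + j) \<sigma> - w a \<sigma>\<bar>"
    by (rule block_osc_attained)
  show ?thesis
  proof (cases "j \<le> h")
    case True
    have "(block_osc w a (h + h) \<sigma>) ^ 4 \<le> (block_osc w a h \<sigma>) ^ 4"
      unfolding j(2) by (intro power_mono block_osc_ge True) auto
    moreover have "0 \<le> (block_osc w a h \<sigma>) ^ 4" "0 \<le> (block_osc w (a + h) h \<sigma>) ^ 4"
      "0 \<le> (w (a + h) \<sigma> - w a \<sigma>) ^ 4" by simp_all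
    ultimately show ?thesis by argo
  next
    case False
    define i where "i = j - h"
    have i: "i \<le> h" "a + j = (a + h) + i" using j False by (auto simp: i_def)
    have "(block_osc w a (h + h) \<sigma>) ^ 4 = ((w ((a + h) + i) \<sigma> - w (a + h) \<sigma>) + (w (a + h) \<sigma> - w a \<sigma>)) ^ 4"
      unfolding j(2) i(2) by simp
    also have "\<dots> \<le> 3 / 2 * (w ((a + h) + i) \<sigma> - w (a + h) \<sigma>) ^ 4 + 729 * (w (a + h) \<sigma> - w a \<sigma>) ^ 4"
      by (rule power4_sum_le_weighted)
    finally have A: "(block_osc w a (h + h) \<sigma>) ^ 4
      \<le> 3 / 2 * (w ((a + h) + i) \<sigma> - w (a + h) \<sigma>) ^ 4 + 729 * (w (a + h) \<sigma> - w a \<sigma>) ^ 4" .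
    have "(w ((a + h) + i) \<sigma> - w (a + h) \<sigma>) ^ 4 = \<bar>w ((a + h) + i) \<sigma> - w (a + h) \<sigma>\<bar> ^ 4" by simp
    also have "\<dots> \<le> (block_osc w (a + h) h \<sigma>) ^ 4"
      by (intro power_mono block_osc_ge i) auto
    finally show ?thesis using A zero_le_power[OF block_osc_nonneg[of w a h \<sigma>], of 4] by argo
  qed
qed

text \<open>Both halves together contribute the factor 3 and the midpoint one more, in total 4,
  which is the growth of the squared block length under doubling. Thus the weight 729 of the
  midpoint is also the constant of the bound.\<close>

lemma block_osc_moment:
  fixes w :: "nat \<Rightarrow> (nat \<Rightarrow> nat) \<Rightarrow> real"
  assumes w: "\<And>a b. a \<le> b \<Longrightarrow> pexp n (\<lambda>\<sigma>. (w b \<sigma> - w a \<sigma>) ^ 4) \<le> K * (real (b - a))\<^sup>2"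
  shows "pexp n (\<lambda>\<sigma>. (block_osc w a (2 ^ r) \<sigma>) ^ 4) \<le> 729 * K * 4 ^ r"
proof (induction r arbitrary: a)
  case 0
  have K: "0 \<le> K"
    using order_trans[OF pexp_nonneg w[of 0 1]] by simp
  have "block_osc w a 1 \<sigma> ^ 4 = (w (a + 1) \<sigma> - w a \<sigma>) ^ 4" for \<sigma>
  proof -
    have "{..1} = {0, 1::nat}" by auto
    then have "block_osc w a 1 \<sigma> = \<bar>w (a + 1) \<sigma> - w a \<sigma>\<bar>"
      by (simp add: block_osc_def)
    then show ?thesis by simp
  qed
  then have "pexp n (\<lambda>\<sigma>. (block_osc w a (2 ^ 0) \<sigma>) ^ 4) \<le> K * 1"
    using w[of a "a + 1"] by simp
  then show ?case using K by simp
next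
  case (Suc r)
  have "pexp n (\<lambda>\<sigma>. (block_osc w a (2 ^ Suc r) \<sigma>) ^ 4)
    \<le> pexp n (\<lambda>\<sigma>. 3 / 2 * ((block_osc w a (2 ^ r) \<sigma>) ^ 4 + (block_osc w (a + 2 ^ r) (2 ^ r) \<sigma>) ^ 4)
     + 729 * (w (a + 2 ^ r) \<sigma> - w a \<sigma>) ^ 4)"
    using block_osc_double[of w a "2 ^ r"] by (intro pexp_mono) (simp add: mult_2)
  also have "\<dots> = 3 / 2 * (pexp n (\<lambda>\<sigma>. (block_osc w a (2 ^ r) \<sigma>) ^ 4)
      + pexp n (\<lambda>\<sigma>. (block_osc w (a + 2 ^ r) (2 ^ r) \<sigma>) ^ 4))
      + 729 * pexp n (\<lambda>\<sigma>. (w (a + 2 ^ r) \<sigma> - w a \<sigma>) ^ 4)"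
    by (simp only: pexp_mult_left pexp_add)
  also have "\<dots> \<le> 3 / 2 * (729 * K * 4 ^ r + 729 * K * 4 ^ r) + 729 * (K * 4 ^ r)"
  proof -
    have "pexp n (\<lambda>\<sigma>. (w (a + 2 ^ r) \<sigma> - w a \<sigma>) ^ 4) \<le> K * 4 ^ r"
      using w[of a "a + 2 ^ r"] by (simp add: power2_eq_square power_mult_distrib[symmetric])
    then show ?thesis using Suc.IH[of a] Suc.IH[of "a + 2 ^ r"] by (intro add_mono mult_left_mono) auto
  qed
  finally show ?case by simp
qed


section \<open>A central limit theorem for the pair count\<close>

lemma next_avg_of_real: "next_avg n m (\<lambda>\<sigma>. complex_of_real (F \<sigma>)) \<sigma> = complex_of_real (next_avg n m F \<sigma>)"
  by (simp add: next_avg_def scaleR_conv_of_real)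

definition step_var :: "nat \<Rightarrow> nat \<Rightarrow> real" where
  "step_var n l = pexp n (\<lambda>\<sigma>. (mart_diff n 2 l \<sigma>)\<^sup>2)"

lemma step_var_bounds:
  assumes "l < n"
  shows "0 \<le> step_var n l" "step_var n l \<le> 4"
proof -
  show "0 \<le> step_var n l" unfolding step_var_def by (rule pexp_nonneg) simp
  have "step_var n l \<le> pexp n (\<lambda>\<sigma>. 2\<^sup>2)"
    unfolding step_var_def
  proof (rule pexp_mono)
    fix \<sigma> assume "\<sigma> \<in> perms n"
    then show "(mart_diff n 2 l \<sigma>)\<^sup>2 \<le> 2\<^sup>2"
      using abs_mart_diff_le[OF assms, of \<sigma> 2] by (intro abs_le_square_iff[THEN iffD1]) simp
  qed
  then show "step_var n l \<le> 4" by simp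
qed

text \<open>\<open>G\<close> collects the terms of first and second order, whose conditional mean is
  explicit. The remainder \<open>H\<close> consists of a cubic error, at most 8/6 |c|^3 because
  differences are bounded by 2, and the quadratic error of \<open>exp (- y)\<close> with y at most 2
  c^2.\<close>

lemma norm_next_avg_iexp_le:
  assumes l: "l < n" and \<sigma>: "\<sigma> \<in> perms n"
  shows "cmod (next_avg n l (\<lambda>\<sigma>. iexp (c * mart_diff n 2 l \<sigma>) - complex_of_real (exp (- (c\<^sup>2 * step_var n l / 2)))) \<sigma>)
    \<le> c\<^sup>2 / 2 * \<bar>next_avg n l (\<lambda>\<sigma>. (mart_diff n 2 l \<sigma>)\<^sup>2) \<sigma> - step_var n l\<bar> + (4 / 3 * \<bar>c\<bar> ^ 3 + 2 * c ^ 4)"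
proof -
  define D v where "D = mart_diff n 2 l" and "v = step_var n l"
  have v: "0 \<le> v" "v \<le> 4" using step_var_bounds[OF l] by (simp_all add: v_def)
  define G where "G \<sigma> = \<i> * complex_of_real (c * D \<sigma>) - complex_of_real (c\<^sup>2 / 2 * ((D \<sigma>)\<^sup>2 - v))" for \<sigma>
  define H where "H \<sigma> = iexp (c * D \<sigma>) - complex_of_real (exp (- (c\<^sup>2 * v / 2))) - G \<sigma>" for \<sigma>
  have H: "cmod (H \<sigma>) \<le> 4 / 3 * \<bar>c\<bar> ^ 3 + 2 * c ^ 4" if \<sigma>: "\<sigma> \<in> perms n" for \<sigma>
  proof -
    define x where "x = c * D \<sigma>"
    define y where "y = c\<^sup>2 * v / 2"
    have D: "\<bar>D \<sigma>\<bar> \<le> 2" using abs_mart_diff_le[OF l \<sigma>, of 2] by (simp add: D_def)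
    have y: "0 \<le> y" "y \<le> 2 * c\<^sup>2"
      using v mult_left_mono[OF v(2), of "c\<^sup>2"] by (simp_all add: y_def)
    have "H \<sigma> = (iexp x - (\<Sum>k\<le>2. (\<i> * x) ^ k / fact k)) - complex_of_real (exp (- y) - (1 - y))"
      by (simp add: H_def G_def x_def y_def numeral_2_eq_2 power_mult_distrib field_simps)
    also have "cmod \<dots> \<le> \<bar>x\<bar> ^ 3 / 6 + y\<^sup>2 / 2"
    proof (rule order_trans[OF norm_triangle_ineq4 add_mono])
      show "cmod (iexp x - (\<Sum>k\<le>2. (\<i> * x) ^ k / fact k)) \<le> \<bar>x\<bar> ^ 3 / 6"
        using iexp_approx1[of x 2] by (simp add: fact_numeral)
      have "1 - y \<le> exp (- y)" using exp_ge_add_one_self[of "- y"] by simp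
      moreover have "exp (- y) \<le> 1 - y + y\<^sup>2 / 2"
      proof -
        have d: "(\<lambda>y. 1 - y + y\<^sup>2 / 2 - exp (- y)) 0 \<le> (\<lambda>y. 1 - y + y\<^sup>2 / 2 - exp (- y)) y"
        proof (rule DERIV_nonneg_imp_nondecreasing[OF y(1)])
          fix z :: real
          have "((\<lambda>y. 1 - y + y\<^sup>2 / 2 - exp (- y)) has_real_derivative (- 1 + z + exp (- z))) (at z)"
            by (auto intro!: derivative_eq_intros)
          moreover have "0 \<le> - 1 + z + exp (- z)" using exp_ge_add_one_self[of "- z"] by simp
          ultimately show "\<exists>d. ((\<lambda>y. 1 - y + y\<^sup>2 / 2 - exp (- y)) has_real_derivative d) (at z) \<and> 0 \<le> d" by blast
        qed
        then show ?thesis by simp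
      qed
      ultimately show "cmod (complex_of_real (exp (- y) - (1 - y))) \<le> y\<^sup>2 / 2"
        unfolding norm_of_real by (simp add: abs_le_iff)
    qed
    also have "\<bar>x\<bar> ^ 3 / 6 + y\<^sup>2 / 2 \<le> (\<bar>c\<bar> ^ 3 * 2 ^ 3) / 6 + (2 * c\<^sup>2)\<^sup>2 / 2"
      unfolding x_def abs_mult power_mult_distrib[of "\<bar>c\<bar>"] using D y
      by (intro add_mono divide_right_mono mult_left_mono power_mono) auto
    finally show ?thesis by (simp add: power_mult_distrib)
  qed
  have avg_D: "next_avg n l (\<lambda>\<sigma>. D \<sigma>) \<sigma> = 0"
    unfolding D_def by (rule next_avg_mart_diff[OF l \<sigma>])
  have "next_avg n l G \<sigma> = \<i> * of_real (c * next_avg n l D \<sigma>)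
      - of_real (c\<^sup>2 / 2 * (next_avg n l (\<lambda>\<sigma>. (D \<sigma>)\<^sup>2) \<sigma> - v))"
    unfolding G_def next_avg_diff next_avg_mult_left next_avg_of_real next_avg_const[OF l] ..
  then have avg_G: "next_avg n l G \<sigma> = - of_real (c\<^sup>2 / 2 * (next_avg n l (\<lambda>\<sigma>. (D \<sigma>)\<^sup>2) \<sigma> - v))"
    using avg_D by simp
  have "next_avg n l (\<lambda>\<sigma>. iexp (c * D \<sigma>) - complex_of_real (exp (- (c\<^sup>2 * v / 2)))) \<sigma>
      = next_avg n l (\<lambda>\<sigma>. G \<sigma> + H \<sigma>) \<sigma>" by (simp add: H_def)
  also have "cmod \<dots> \<le> cmod (next_avg n l G \<sigma>) + cmod (next_avg n l H \<sigma>)"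
    unfolding next_avg_add by (rule norm_triangle_ineq)
  also have "cmod (next_avg n l G \<sigma>) = c\<^sup>2 / 2 * \<bar>next_avg n l (\<lambda>\<sigma>. (D \<sigma>)\<^sup>2) \<sigma> - v\<bar>"
    unfolding avg_G norm_minus_cancel norm_of_real abs_mult by simp
  also have "cmod (next_avg n l H \<sigma>) \<le> next_avg n l (\<lambda>_. 4 / 3 * \<bar>c\<bar> ^ 3 + 2 * c ^ 4) \<sigma>"
    by (rule order_trans[OF norm_next_avg_le next_avg_mono[OF l \<sigma> H]])
  finally show ?thesis unfolding next_avg_const[OF l] by (simp add: D_def v_def)
qed

text \<open>Lindeberg telescoping: \<open>E (iexp T\<^sub>l) * exp (V\<^sub>l / 2)\<close> changes little from step to step, since the
  next increment has conditional mean 0 and a conditional variance close to \<open>step_var\<close>.\<close>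

lemma char_mart_diff_sum:
  assumes "B \<le> n"
  shows "cmod (pexp n (\<lambda>\<sigma>. iexp (\<Sum>l<B. c l * mart_diff n 2 l \<sigma>))
      - complex_of_real (exp (- (\<Sum>l<B. (c l)\<^sup>2 * step_var n l) / 2)))
    \<le> (\<Sum>l<B. (c l)\<^sup>2 / 2 * pexp n (\<lambda>\<sigma>. \<bar>next_avg n l (\<lambda>\<sigma>. (mart_diff n 2 l \<sigma>)\<^sup>2) \<sigma> - step_var n l\<bar>)
        + (4 / 3 * \<bar>c l\<bar> ^ 3 + 2 * (c l) ^ 4))"
proof -
  define T where "T l \<sigma> = (\<Sum>i<l. c i * mart_diff n 2 i \<sigma>)" for l \<sigma>
  define V where "V l = (\<Sum>i<l. (c i)\<^sup>2 * step_var n i)" for l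
  define \<phi> where "\<phi> l = pexp n (\<lambda>\<sigma>. iexp (T l \<sigma>))" for l
  define e where "e l = (c l)\<^sup>2 / 2 * pexp n (\<lambda>\<sigma>. \<bar>next_avg n l (\<lambda>\<sigma>. (mart_diff n 2 l \<sigma>)\<^sup>2) \<sigma> - step_var n l\<bar>)
        + (4 / 3 * \<bar>c l\<bar> ^ 3 + 2 * (c l) ^ 4)" for l
  have e_nonneg: "0 \<le> e l" for l
    unfolding e_def by (intro add_nonneg_nonneg mult_nonneg_nonneg pexp_nonneg) auto
  have step: "cmod (\<phi> (Suc l) - \<phi> l * of_real (exp (- ((c l)\<^sup>2 * step_var n l / 2)))) \<le> e l" if "l < B" for l
  proof -
    have l: "l < n" using that assms by simp
    let ?g = "\<lambda>\<sigma>. iexp (c l * mart_diff n 2 l \<sigma>) - complex_of_real (exp (- ((c l)\<^sup>2 * step_var n l / 2)))"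
    have past: "in_past n l (\<lambda>\<sigma>. iexp (T l \<sigma>))"
      unfolding T_def
      by (intro in_past_comp[where g = iexp] in_past_sum in_past_comp[where g = "\<lambda>x. c _ * x"] in_past_mart_diff l) auto
    have "\<phi> (Suc l) - \<phi> l * of_real (exp (- ((c l)\<^sup>2 * step_var n l / 2))) = pexp n (\<lambda>\<sigma>. iexp (T l \<sigma>) * ?g \<sigma>)"
      by (simp add: \<phi>_def T_def pexp_mult_right[symmetric] pexp_diff[symmetric] exp_add right_diff_distrib distrib_left)
    also have "\<dots> = pexp n (\<lambda>\<sigma>. iexp (T l \<sigma>) * next_avg n l ?g \<sigma>)"
      by (rule pexp_mult_past[OF l past])
    finally have eq: "\<phi> (Suc l) - \<phi> l * of_real (exp (- ((c l)\<^sup>2 * step_var n l / 2)))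
      = pexp n (\<lambda>\<sigma>. iexp (T l \<sigma>) * next_avg n l ?g \<sigma>)" .
    have "cmod (pexp n (\<lambda>\<sigma>. iexp (T l \<sigma>) * next_avg n l ?g \<sigma>)) \<le> pexp n (\<lambda>\<sigma>. cmod (iexp (T l \<sigma>) * next_avg n l ?g \<sigma>))"
      by (rule norm_pexp_le)
    also have "\<dots> \<le> pexp n (\<lambda>\<sigma>. (c l)\<^sup>2 / 2 * \<bar>next_avg n l (\<lambda>\<sigma>. (mart_diff n 2 l \<sigma>)\<^sup>2) \<sigma> - step_var n l\<bar>
        + (4 / 3 * \<bar>c l\<bar> ^ 3 + 2 * (c l) ^ 4))"
    proof (rule pexp_mono)
      fix \<sigma> assume "\<sigma> \<in> perms n"
      from norm_next_avg_iexp_le[OF l this, of "c l"]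
      show "cmod (iexp (T l \<sigma>) * next_avg n l ?g \<sigma>)
        \<le> (c l)\<^sup>2 / 2 * \<bar>next_avg n l (\<lambda>\<sigma>. (mart_diff n 2 l \<sigma>)\<^sup>2) \<sigma> - step_var n l\<bar>
        + (4 / 3 * \<bar>c l\<bar> ^ 3 + 2 * (c l) ^ 4)"
        by (simp only: norm_mult norm_exp_i_times mult_1_left)
    qed
    also have "\<dots> = e l" by (simp only: e_def pexp_add pexp_mult_left pexp_const)
    finally show ?thesis unfolding eq .
  qed
  have "cmod (\<phi> k - of_real (exp (- V k / 2))) \<le> (\<Sum>l<k. e l)" if "k \<le> B" for k
    using that
  proof (induction k)
    case 0
    then show ?case by (simp add: \<phi>_def T_def V_def)
  next
    case (Suc k)
    have k: "k < n" using Suc.prems assms by simp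
    let ?q = "exp (- ((c k)\<^sup>2 * step_var n k / 2))"
    \<comment> \<open>Since \<open>?q\<close> is at most 1, the error of the earlier steps is passed
      on without growth.\<close>
    have q: "0 \<le> ?q" "?q \<le> 1" using step_var_bounds[OF k] by auto
    have "exp (- V (Suc k) / 2) = exp (- V k / 2) * ?q"
      unfolding exp_add[symmetric] V_def by (simp add: field_simps)
    then have "\<phi> (Suc k) - of_real (exp (- V (Suc k) / 2))
        = (\<phi> (Suc k) - \<phi> k * of_real ?q) + (\<phi> k - of_real (exp (- V k / 2))) * of_real ?q"
      by (simp add: algebra_simps)
    also have "cmod \<dots> \<le> e k + cmod (\<phi> k - of_real (exp (- V k / 2))) * ?q"
    proof (rule order_trans[OF norm_triangle_ineq add_mono])
      show "cmod (\<phi> (Suc k) - \<phi> k * of_real ?q) \<le> e k" using step Suc.prems by simp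
    qed (simp add: norm_mult)
    also have "\<dots> \<le> e k + cmod (\<phi> k - of_real (exp (- V k / 2)))"
      using q by (intro add_left_mono mult_left_le) auto
    also have "\<dots> \<le> (\<Sum>l<Suc k. e l)" using Suc by simp
    finally show ?case .
  qed
  from this[OF order_refl] show ?thesis by (simp add: \<phi>_def T_def V_def e_def)
qed

section \<open>Concentration of the conditional variances\<close>

lemma pexp_abs_le_sqrt: "pexp n (\<lambda>\<sigma>. \<bar>F \<sigma>\<bar>) \<le> sqrt (pexp n (\<lambda>\<sigma>. (F \<sigma> :: real)\<^sup>2))"
  using pexp_square_mean[of n "\<lambda>\<sigma>. \<bar>F \<sigma>\<bar>"] by (intro real_le_rsqrt) simp

text \<open>The conditional variance is a Lipschitz function of the two counts: the square of the
  pair count causes no harm because count and mean are both at most \<open>u\<close>. The centred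
  counts of pairs and triples are at most 2 and 3 times sqrt n in L1, giving 26 = 10 * 2 + 2 * 3.
  Replacing \<open>q'\<close> by the true mean doubles this. Two remaining sites are required for
  the moment bound on triples.\<close>

lemma next_avg_square_concentrated:
  assumes n: "1 < n" and l: "l + 2 \<le> n"
  shows "pexp n (\<lambda>\<sigma>. \<bar>next_avg n l (\<lambda>\<sigma>. (mart_diff n 2 l \<sigma>)\<^sup>2) \<sigma> - step_var n l\<bar>)
    \<le> 52 * sqrt n / real (n - l)"
proof -
  have ln: "l < n" using l by simp
  define u where "u = real (n - l)"
  have u: "0 < u" using ln by (simp add: u_def)
  define a b where "a = pexp n (windows n 2 l)" and "b = pexp n (windows n 3 l)"
  define q where "q \<sigma> = next_avg n l (\<lambda>\<sigma>. (mart_diff n 2 l \<sigma>)\<^sup>2) \<sigma>" for \<sigma>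
  define q' where "q' = (2 * a + 2 * b) / u - (2 / u * a)\<^sup>2"
  have a: "0 \<le> a" "a \<le> u"
  proof -
    show "0 \<le> a" unfolding a_def by (intro pexp_nonneg windows_nonneg)
    have "a \<le> pexp n (\<lambda>_. u)" unfolding a_def u_def by (intro pexp_mono windows_le ln) auto
    then show "a \<le> u" by simp
  qed
  have E: "pexp n (\<lambda>\<sigma>. \<bar>q \<sigma> - q'\<bar>) \<le> 26 * sqrt n / u"
  proof -
    have "pexp n (\<lambda>\<sigma>. \<bar>q \<sigma> - q'\<bar>) \<le> pexp n (\<lambda>\<sigma>. (10 * \<bar>centred n 2 l \<sigma>\<bar> + 2 * \<bar>centred n 3 l \<sigma>\<bar>) / u)"
    proof (rule pexp_mono)
      fix \<sigma> assume \<sigma>: "\<sigma> \<in> perms n"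
      define x y z where "x = centred n 2 l \<sigma>" and "y = windows n 2 l \<sigma>" and "z = centred n 3 l \<sigma>"
      have y: "0 \<le> y" "y \<le> u" "x = y - a"
        using windows_le[OF ln \<sigma>, of 2] by (simp_all add: x_def y_def u_def centred_def a_def windows_nonneg)
      have q: "q \<sigma> = (2 * y + 2 * (z + b)) / u - (2 / u * y)\<^sup>2"
        unfolding q_def by (subst next_avg_square_mart_diff[OF ln \<sigma>]) (simp add: y_def z_def u_def centred_def b_def)
      have "q \<sigma> - q' = (2 * x + 2 * z) / u - 4 * x * ((y + a) / u) / u"
        using u unfolding q q'_def y(3) by (simp add: field_simps power2_eq_square)
      also have "\<bar>\<dots>\<bar> \<le> (2 * \<bar>x\<bar> + 2 * \<bar>z\<bar>) / u + 8 * \<bar>x\<bar> / u"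
      proof (rule order_trans[OF abs_triangle_ineq4 add_mono])
        show "\<bar>(2 * x + 2 * z) / u\<bar> \<le> (2 * \<bar>x\<bar> + 2 * \<bar>z\<bar>) / u"
          using u by (simp add: abs_divide divide_right_mono)
        have "0 \<le> (y + a) / u" "(y + a) / u \<le> 2" using y a u by (auto simp: field_simps)
        then have "\<bar>x\<bar> * \<bar>(y + a) / u\<bar> \<le> \<bar>x\<bar> * 2" by (intro mult_left_mono) auto
        then have "\<bar>4 * x * ((y + a) / u)\<bar> \<le> 8 * \<bar>x\<bar>" by (simp add: abs_mult)
        then show "\<bar>4 * x * ((y + a) / u) / u\<bar> \<le> 8 * \<bar>x\<bar> / u"
          unfolding abs_divide[of _ u] using u by (intro frac_le) auto
      qed
      also have "\<dots> = (10 * \<bar>x\<bar> + 2 * \<bar>z\<bar>) / u" by (simp add: add_divide_distrib)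
      finally show "\<bar>q \<sigma> - q'\<bar> \<le> (10 * \<bar>centred n 2 l \<sigma>\<bar> + 2 * \<bar>centred n 3 l \<sigma>\<bar>) / u"
        by (simp only: x_def z_def)
    qed
    also have "\<dots> = (10 * pexp n (\<lambda>\<sigma>. \<bar>centred n 2 l \<sigma>\<bar>) + 2 * pexp n (\<lambda>\<sigma>. \<bar>centred n 3 l \<sigma>\<bar>)) / u"
      by (simp only: pexp_divide pexp_add pexp_mult_left)
    also have "\<dots> \<le> (10 * (2 * sqrt n) + 2 * (3 * sqrt n)) / u"
    proof (intro divide_right_mono add_mono mult_left_mono)
      have "pexp n (\<lambda>\<sigma>. \<bar>centred n r l \<sigma>\<bar>) \<le> real r * sqrt n" if r: "r \<le> 3" for r
      proof -
        have "pexp n (\<lambda>\<sigma>. (centred n r l \<sigma>)\<^sup>2) \<le> (real r)\<^sup>2 * l"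
          using l r by (intro centred_moments(1)) auto
        also have "\<dots> \<le> (real r)\<^sup>2 * n" using ln by (intro mult_left_mono) auto
        finally have "sqrt (pexp n (\<lambda>\<sigma>. (centred n r l \<sigma>)\<^sup>2)) \<le> real r * sqrt n"
          using real_sqrt_le_mono by (fastforce simp: real_sqrt_mult)
        then show ?thesis using pexp_abs_le_sqrt[of n "centred n r l"] by linarith
      qed
      from this[of 2] this[of 3] show "pexp n (\<lambda>\<sigma>. \<bar>centred n 2 l \<sigma>\<bar>) \<le> 2 * sqrt n"
        "pexp n (\<lambda>\<sigma>. \<bar>centred n 3 l \<sigma>\<bar>) \<le> 3 * sqrt n" by simp_all
    qed (use u in auto)
    finally show ?thesis by simp
  qed
  have v: "step_var n l = pexp n q"
    unfolding step_var_def q_def by (rule pexp_next_avg[OF ln, symmetric])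
  have "\<bar>q' - step_var n l\<bar> \<le> 26 * sqrt n / u"
  proof -
    have "\<bar>q' - step_var n l\<bar> = \<bar>pexp n (\<lambda>\<sigma>. q \<sigma> - q')\<bar>"
      by (simp add: v pexp_diff abs_minus_commute)
    also have "\<dots> \<le> pexp n (\<lambda>\<sigma>. \<bar>q \<sigma> - q'\<bar>)" by (rule abs_pexp_le)
    finally show ?thesis using E by linarith
  qed
  moreover have "pexp n (\<lambda>\<sigma>. \<bar>q \<sigma> - step_var n l\<bar>) \<le> pexp n (\<lambda>\<sigma>. \<bar>q \<sigma> - q'\<bar> + \<bar>q' - step_var n l\<bar>)"
    by (rule pexp_mono) simp
  ultimately have "pexp n (\<lambda>\<sigma>. \<bar>q \<sigma> - step_var n l\<bar>) \<le> 26 * sqrt n / u + 26 * sqrt n / u"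
    using E by (simp only: pexp_add pexp_const)
  then show ?thesis by (simp add: q_def u_def)
qed

text \<open>The product of the factors 1 - 2/(n - k) over l < k < m, after telescoping: the weight
  with which the difference of step \<open>l\<close> is still present at time
  \<open>m\<close>.\<close>

definition ratio :: "nat \<Rightarrow> nat \<Rightarrow> nat \<Rightarrow> real" where
  "ratio n l m = (real n - m) * (real n - m - 1) / ((real n - l - 1) * (real n - l - 2))"

lemma centred_eq_sum_mart_diff:
  assumes "m + 2 \<le> n" "\<sigma> \<in> perms n"
  shows "centred n 2 m \<sigma> = (\<Sum>l<m. ratio n l m * mart_diff n 2 l \<sigma>)"
  using assms(1)
proof (induction m)
  case (Suc m)
  have ratio: "(1 - 2 / real (n - m)) * ratio n l m = ratio n l (Suc m)" for l
  proof -
    have "(1 - 2 / x) * (x * (x - 1) / y) = (x - 1) * (x - 1 - 1) / y" if "x > 0" for x y :: real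
      using that by (cases "y = 0") (auto simp: field_simps)
    moreover have "real n - real m = real (n - m)" "real n - real (Suc m) = real (n - m) - 1" "real (n - m) > 0"
      using Suc.prems by (simp_all add: of_nat_diff)
    ultimately show ?thesis by (simp only: ratio_def)
  qed
  have "centred n 2 (Suc m) \<sigma> = (1 - 2 / real (n - m)) * centred n 2 m \<sigma> + mart_diff n 2 m \<sigma>"
    using Suc.prems by (subst centred_Suc) auto
  also have "\<dots> = (\<Sum>l<m. (1 - 2 / real (n - m)) * ratio n l m * mart_diff n 2 l \<sigma>) + mart_diff n 2 m \<sigma>"
    using Suc by (simp add: sum_distrib_left mult.assoc)
  also have "mart_diff n 2 m \<sigma> = ratio n m (Suc m) * mart_diff n 2 m \<sigma>"
  proof -
    have "real n - real m - 1 \<noteq> 0" "real n - real m - 2 \<noteq> 0" using Suc.prems by linarith+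
    moreover have "real n - real (Suc m) = real n - real m - 1"
      "real n - real (Suc m) - 1 = real n - real m - 2" by simp_all
    ultimately have "ratio n m (Suc m) = 1" unfolding ratio_def by (simp only: divide_self_if mult_eq_0_iff simp_thms if_False)
    then show ?thesis by simp
  qed
  finally show ?case by (simp add: ratio)
qed (simp add: centred_0 assms)

lemma ratio_bounds:
  assumes "l < m" "m + 2 \<le> n"
  shows "0 \<le> ratio n l m" "ratio n l m \<le> 1"
proof -
  have le: "real l + 1 \<le> m" "real m + 2 \<le> n" using assms by linarith+
  show "0 \<le> ratio n l m" unfolding ratio_def using le by (intro divide_nonneg_nonneg mult_nonneg_nonneg) auto
  have "(real n - m) * (real n - m - 1) \<le> (real n - l - 1) * (real n - l - 2)"
    using le by (intro mult_mono) auto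
  moreover have "0 < (real n - l - 1) * (real n - l - 2)" using le by (intro mult_pos_pos) auto
  ultimately show "ratio n l m \<le> 1" unfolding ratio_def by simp
qed

text \<open>Martingale differences are orthogonal. Hence the exponent in the Gaussian approximation
  is exactly the variance of the linear combination, and the single \<open>step_var\<close> never
  have to be evaluated.\<close>

lemma pexp_square_mart_diff_sum:
  assumes "B \<le> n"
  shows "pexp n (\<lambda>\<sigma>. (\<Sum>l<B. c l * mart_diff n 2 l \<sigma>)\<^sup>2) = (\<Sum>l<B. (c l)\<^sup>2 * step_var n l)"
  using assms
proof (induction B)
  case (Suc B)
  have l: "B < n" using Suc.prems by simp
  define T where "T \<sigma> = (\<Sum>l<B. c l * mart_diff n 2 l \<sigma>)" for \<sigma>
  have past: "in_past n B T"
    unfolding T_def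
    by (intro in_past_sum in_past_comp[where g = "\<lambda>x. c _ * x"] in_past_mart_diff l) auto
  have "pexp n (\<lambda>\<sigma>. T \<sigma> * mart_diff n 2 B \<sigma>) = pexp n (\<lambda>\<sigma>. T \<sigma> * next_avg n B (mart_diff n 2 B) \<sigma>)"
    by (rule pexp_mult_past[OF l past])
  also have "\<dots> = pexp n (\<lambda>_. 0)" by (rule pexp_cong) (simp add: next_avg_mart_diff[OF l])
  finally have orth: "pexp n (\<lambda>\<sigma>. T \<sigma> * mart_diff n 2 B \<sigma>) = 0" by simp
  have "pexp n (\<lambda>\<sigma>. (\<Sum>l<Suc B. c l * mart_diff n 2 l \<sigma>)\<^sup>2)
      = pexp n (\<lambda>\<sigma>. (T \<sigma>)\<^sup>2 + 2 * c B * (T \<sigma> * mart_diff n 2 B \<sigma>) + (c B)\<^sup>2 * (mart_diff n 2 B \<sigma>)\<^sup>2)"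
    by (rule pexp_cong) (simp add: T_def power2_sum power_mult_distrib)
  also have "\<dots> = pexp n (\<lambda>\<sigma>. (T \<sigma>)\<^sup>2) + (c B)\<^sup>2 * step_var n B"
    by (simp only: pexp_add pexp_mult_left orth step_var_def)
  also have "pexp n (\<lambda>\<sigma>. (T \<sigma>)\<^sup>2) = (\<Sum>l<B. (c l)\<^sup>2 * step_var n l)"
    unfolding T_def using Suc by simp
  finally show ?case by simp
qed simp

text \<open>Conditioning on the past multiplies the covariance with the count at time
  \<open>p\<close> by 1 - 2/u at each later step, and this product telescopes.\<close>

lemma pexp_centred_mult:
  assumes "1 < n" "p \<le> q" "q + 2 \<le> n"
  shows "pexp n (\<lambda>\<sigma>. centred n 2 p \<sigma> * centred n 2 q \<sigma>)
    = (real n - q) * (real n - q - 1) / ((real n - p) * (real n - p - 1)) * pair_var n (real n - p)"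
  using assms(2,3)
proof (induction q rule: dec_induct)
  case base
  have "real n - p > 1" using base assms by linarith
  moreover have "pexp n (\<lambda>\<sigma>. centred n 2 p \<sigma> * centred n 2 p \<sigma>) = pair_var n (real n - p)"
    using pexp_centred_square[OF assms(1), of p] base by (simp add: power2_eq_square of_nat_diff)
  ultimately show ?case by simp
next
  case (step q)
  have q: "q < n" using step.prems by simp
  have "pexp n (\<lambda>\<sigma>. centred n 2 p \<sigma> * mart_diff n 2 q \<sigma>) = pexp n (\<lambda>\<sigma>. centred n 2 p \<sigma> * next_avg n q (mart_diff n 2 q) \<sigma>)"
    using q step.hyps by (intro pexp_mult_past in_past_centred) auto
  also have "\<dots> = pexp n (\<lambda>_. 0)" by (rule pexp_cong) (simp add: next_avg_mart_diff[OF q])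
  finally have orth: "pexp n (\<lambda>\<sigma>. centred n 2 p \<sigma> * mart_diff n 2 q \<sigma>) = 0" by simp
  have "pexp n (\<lambda>\<sigma>. centred n 2 p \<sigma> * centred n 2 (Suc q) \<sigma>)
      = pexp n (\<lambda>\<sigma>. (1 - 2 / real (n - q)) * (centred n 2 p \<sigma> * centred n 2 q \<sigma>) + centred n 2 p \<sigma> * mart_diff n 2 q \<sigma>)"
    by (rule pexp_cong) (simp add: centred_Suc[OF q] distrib_left)
  also have "\<dots> = (1 - 2 / real (n - q)) * pexp n (\<lambda>\<sigma>. centred n 2 p \<sigma> * centred n 2 q \<sigma>)"
    by (simp only: pexp_add pexp_mult_left orth)
  also have "\<dots> = (1 - 2 / (real n - q)) * ((real n - q) * (real n - q - 1) / ((real n - p) * (real n - p - 1)) * pair_var n (real n - p))"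
    using step q by (simp add: of_nat_diff)
  also have "\<dots> = ((1 - 2 / (real n - q)) * (real n - q)) * (real n - q - 1) / ((real n - p) * (real n - p - 1)) * pair_var n (real n - p)"
    by simp
  also have "(1 - 2 / (real n - q)) * (real n - q) = real n - q - 2"
    using q by (simp add: field_simps)
  finally show ?case by (simp add: mult.commute algebra_simps)
qed


section \<open>Limits of the covariances\<close>

definition limit_cov :: "real \<Rightarrow> real \<Rightarrow> real" where
  "limit_cov s t = (min s t)\<^sup>2 * (1 - max s t)\<^sup>2"

lemma limit_cov_commute: "limit_cov s t = limit_cov t s"
  by (simp add: limit_cov_def min.commute max.commute)

text \<open>The last two terms of \<open>pair_var\<close> are of order N^2, whereas the variance is
  of order N. The right-hand side has this cancellation already carried out, so that every factor
  converges separately.\<close>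

lemma pair_var_scaled:
  fixes N y :: real
  assumes "N > 1"
  shows "pair_var N (N * y) / N = y * (y - 1 / N) *
    (1 + 2 * (y - 2 / N) * (N / (N - 1)) - 4 * y * (N / (N - 1)) + 6 / (N - 1) + y * (y - 1 / N) * (N / (N - 1)))"
proof -
  define i k where "i = inverse N" and "k = inverse (N - 1)"
  have i: "N * i = 1" and k: "(N - 1) * k = 1" using assms by (simp_all add: i_def k_def)
  define w where "w = y * (y - i)"
  have e0: "N * y * (N * y - 1) * i * i = w"
    using i unfolding w_def by algebra
  have e2: "N * y * (N * y - 1) * (N * y - 2) * (i * k) * i = w * ((N * y - 2) * k)"
    unfolding e0[symmetric] by (simp only: mult_ac)
  have e3: "N * y * (N * y - 1) * (N * y - 2) * (N * y - 3) * (i * k) * i = w * ((N * y - 2) * (N * y - 3) * k)"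
    unfolding e0[symmetric] by (simp only: mult_ac)
  have e4: "(N * y * (N * y - 1) * i)\<^sup>2 * i = w * (N * y * (N * y - 1) * i)"
    unfolding e0[symmetric] power2_eq_square by (simp only: mult_ac)
  have a: "(N * y - 2) * k = (y - 2 * i) * (N * k)"
    using i by algebra
  \<comment> \<open>This is the cancellation: both products are of order N, their difference is
    bounded.\<close>
  have b: "(N * y - 2) * (N * y - 3) * k - N * y * (N * y - 1) * i
      = - 4 * y * (N * k) + 6 * k + w * (N * k)"
  proof -
    have "N * w = (N * i) * (N * y * (N * y - 1) * i)" unfolding e0[symmetric] by (simp only: mult_ac)
    then have "N * y * (N * y - 1) * i = N * w" by (simp only: i mult_1_left)
    moreover have "N * w = (N - 1) * N * k * w" using k by algebra
    moreover have "N * N * w = N * y * (N * y - 1)" using i unfolding w_def by algebra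
    ultimately show ?thesis by algebra
  qed
  have "pair_var N (N * y) / N = N * y * (N * y - 1) * i * i + 2 * (N * y * (N * y - 1) * (N * y - 2) * (i * k) * i)
      + N * y * (N * y - 1) * (N * y - 2) * (N * y - 3) * (i * k) * i - (N * y * (N * y - 1) * i)\<^sup>2 * i"
    unfolding pair_var_def divide_inverse inverse_mult_distrib i_def[symmetric] k_def[symmetric]
    by (simp only: distrib_right left_diff_distrib mult.assoc)
  also have "\<dots> = w * (1 + 2 * ((N * y - 2) * k) + ((N * y - 2) * (N * y - 3) * k - N * y * (N * y - 1) * i))"
    unfolding e0 e2 e3 e4 by (simp only: distrib_left right_diff_distrib mult_1_right)
  also have "\<dots> = w * (1 + 2 * ((y - 2 * i) * (N * k)) + (- 4 * y * (N * k) + 6 * k + w * (N * k)))"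
    unfolding a b ..
  finally show ?thesis unfolding w_def i_def k_def divide_inverse by (simp add: add.assoc)
qed

lemma floor_quotient_tendsto:
  assumes "0 \<le> t"
  shows "(\<lambda>n. real (nat \<lfloor>real n * t\<rfloor>) / real n) \<longlonglongrightarrow> t"
proof (rule LIMSEQ_offset[where k = 1], rule real_tendsto_sandwich)
  have *: "real n * t - 1 \<le> real (nat \<lfloor>real n * t\<rfloor>)" "real (nat \<lfloor>real n * t\<rfloor>) \<le> real n * t" for n
  proof -
    have "0 \<le> real n * t" using assms by simp
    then show "real n * t - 1 \<le> real (nat \<lfloor>real n * t\<rfloor>)" "real (nat \<lfloor>real n * t\<rfloor>) \<le> real n * t"
      by linarith+
  qed
  show "\<forall>\<^sub>F n in sequentially. t - 1 / real (n + 1) \<le> real (nat \<lfloor>real (n + 1) * t\<rfloor>) / real (n + 1)"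
  proof (intro always_eventually allI)
    fix n
    define x where "x = real (n + 1)"
    have "t - 1 / x = (x * t - 1) / x" by (simp add: x_def field_simps)
    also have "\<dots> \<le> real (nat \<lfloor>x * t\<rfloor>) / x"
      using *(1)[of "n + 1"] by (intro divide_right_mono) (simp_all only: x_def of_nat_0_le_iff)
    finally show "t - 1 / real (n + 1) \<le> real (nat \<lfloor>real (n + 1) * t\<rfloor>) / real (n + 1)"
      by (simp only: x_def)
  qed
  show "\<forall>\<^sub>F n in sequentially. real (nat \<lfloor>real (n + 1) * t\<rfloor>) / real (n + 1) \<le> t"
    using *(2) by (intro always_eventually allI) (simp add: pos_divide_le_eq mult.commute del: of_nat_add of_nat_Suc)
  have "(\<lambda>n. 1 / real (n + 1)) \<longlonglongrightarrow> 0"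
    using LIMSEQ_ignore_initial_segment[OF lim_1_over_n, of 1] by simp
  then show "(\<lambda>n. t - 1 / real (n + 1)) \<longlonglongrightarrow> t"
    using tendsto_diff[OF tendsto_const] by fastforce
qed simp

lemma floor_mult_gap:
  assumes "0 < \<delta>" "t \<le> 1 - \<delta>" "0 \<le> t" "real n * \<delta> \<ge> 2"
  shows "nat \<lfloor>real n * t\<rfloor> + 2 \<le> n" "real n * \<delta> \<le> real n - real (nat \<lfloor>real n * t\<rfloor>)"
proof -
  have "real n * t \<le> real n * (1 - \<delta>)" using assms by (intro mult_left_mono) auto
  moreover have "0 \<le> real n * t" using assms by simp
  ultimately have "real (nat \<lfloor>real n * t\<rfloor>) \<le> real n - real n * \<delta>"
    unfolding right_diff_distrib by linarith
  then show "nat \<lfloor>real n * t\<rfloor> + 2 \<le> n" "real n * \<delta> \<le> real n - real (nat \<lfloor>real n * t\<rfloor>)"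
    using assms(4) by linarith+
qed

lemma eventually_mult_ge:
  assumes "0 < \<delta>"
  shows "\<forall>\<^sub>F n in sequentially. C \<le> real n * \<delta>"
proof -
  have "\<forall>\<^sub>F n in sequentially. C / \<delta> \<le> real n" by real_asymp
  then show ?thesis by eventually_elim (use assms in \<open>simp add: field_simps\<close>)
qed

lemma cov_tendsto:
  assumes st: "0 \<le> s" "s \<le> t" "t < 1"
  shows "(\<lambda>n. pexp n (\<lambda>\<sigma>. centred n 2 (nat \<lfloor>real n * s\<rfloor>) \<sigma> * centred n 2 (nat \<lfloor>real n * t\<rfloor>) \<sigma>) / real n)
    \<longlonglongrightarrow> limit_cov s t"
proof -
  define y z where "y n = 1 - real (nat \<lfloor>real n * s\<rfloor>) / real n"
    and "z n = 1 - real (nat \<lfloor>real n * t\<rfloor>) / real n" for n :: nat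
  have y: "y \<longlonglongrightarrow> 1 - s" and z: "z \<longlonglongrightarrow> 1 - t"
    unfolding y_def z_def using st by (intro tendsto_intros floor_quotient_tendsto; simp)+
  have i: "(\<lambda>n. c / real n) \<longlonglongrightarrow> 0" for c by real_asymp
  have r: "(\<lambda>n. real n / (real n - 1)) \<longlonglongrightarrow> 1" and k: "(\<lambda>n. 6 / (real n - 1)) \<longlonglongrightarrow> 0"
    by real_asymp+
  let ?R = "\<lambda>n. (z n * (z n - 1 / real n)) / (y n * (y n - 1 / real n)) *
      (y n * (y n - 1 / real n) *
       (1 + 2 * (y n - 2 / real n) * (real n / (real n - 1)) - 4 * y n * (real n / (real n - 1))
         + 6 / (real n - 1) + y n * (y n - 1 / real n) * (real n / (real n - 1))))"
  have "?R \<longlonglongrightarrow> ((1 - t) * ((1 - t) - 0)) / ((1 - s) * ((1 - s) - 0)) *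
      ((1 - s) * ((1 - s) - 0) * (1 + 2 * ((1 - s) - 0) * 1 - 4 * (1 - s) * 1 + 0 + (1 - s) * ((1 - s) - 0) * 1))"
    by (intro tendsto_intros y z i r k) (use st in auto)
  also have "((1 - t) * ((1 - t) - 0)) / ((1 - s) * ((1 - s) - 0)) *
      ((1 - s) * ((1 - s) - 0) * (1 + 2 * ((1 - s) - 0) * 1 - 4 * (1 - s) * 1 + 0 + (1 - s) * ((1 - s) - 0) * 1))
      = limit_cov s t"
  proof -
    \<comment> \<open>With y = 1 - s the bracket tends to 1 - 2 y + y^2, the square of s.\<close>
    have "1 + 2 * (1 - s) - 4 * (1 - s) + (1 - s) * (1 - s) = s\<^sup>2" by algebra
    then show ?thesis using st by (simp add: limit_cov_def min_absorb1 max_absorb2 power2_eq_square)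
  qed
  finally have lim: "?R \<longlonglongrightarrow> limit_cov s t" .
  have "\<forall>\<^sub>F n in sequentially. ?R n =
      pexp n (\<lambda>\<sigma>. centred n 2 (nat \<lfloor>real n * s\<rfloor>) \<sigma> * centred n 2 (nat \<lfloor>real n * t\<rfloor>) \<sigma>) / real n"
    using eventually_mult_ge[OF diff_gt_0_iff_gt[THEN iffD2, OF st(3)], of 2] eventually_gt_at_top[of 1]
  proof eventually_elim
    case (elim n)
    define p q where "p = nat \<lfloor>real n * s\<rfloor>" and "q = nat \<lfloor>real n * t\<rfloor>"
    have q: "q + 2 \<le> n" using floor_mult_gap(1)[of "1 - t" t n] elim st by (simp add: q_def)
    have "real n * s \<le> real n * t" using st by (intro mult_left_mono) auto
    then have pq: "p \<le> q" unfolding p_def q_def by (intro nat_mono floor_mono)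
    have py: "real n - real p = real n * y n" and qz: "real n - real q = real n * z n"
      using elim by (simp_all add: y_def z_def p_def q_def field_simps)
    have n0: "real n \<noteq> 0" using elim by simp
    have fac: "real n * x - 1 = real n * (x - 1 / real n)" for x
      using n0 by (simp add: right_diff_distrib)
    have "pexp n (\<lambda>\<sigma>. centred n 2 p \<sigma> * centred n 2 q \<sigma>) / real n
      = (real n * z n) * (real n * (z n - 1 / real n)) / ((real n * y n) * (real n * (y n - 1 / real n)))
        * (pair_var n (real n * y n) / n)"
      unfolding pexp_centred_mult[OF elim(2) pq q] py qz fac by simp
    also have "(real n * z n) * (real n * (z n - 1 / real n)) / ((real n * y n) * (real n * (y n - 1 / real n)))
      = (z n * (z n - 1 / real n)) / (y n * (y n - 1 / real n))"
      using n0 by simp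
    finally show ?case
      using pair_var_scaled[of "real n" "y n"] elim by (simp only: p_def q_def)
  qed
  with lim show ?thesis by (rule Lim_transform_eventually)
qed

text \<open>A gap \<open>\<delta>\<close> below 1 keeps at least a proportion
  \<open>\<delta>\<close> of the sites unoccupied at all steps involved. The coefficients
  \<open>c n l\<close> are of order n^(-1/2), so each step costs \<open>err n / n\<close>, and fewer
  than \<open>n\<close> steps add up to an error of order n^(-1/2).\<close>

lemma clt_lt_1:
  fixes J :: "'i set" and t a :: "'i \<Rightarrow> real"
  assumes J: "finite J" and t: "\<And>j. j \<in> J \<Longrightarrow> 0 \<le> t j \<and> t j < 1"
  shows "(\<lambda>n. pexp n (\<lambda>\<sigma>. iexp (\<Sum>j\<in>J. a j * centred n 2 (nat \<lfloor>real n * t j\<rfloor>) \<sigma> / sqrt n)))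
    \<longlonglongrightarrow> complex_of_real (exp (- (\<Sum>i\<in>J. \<Sum>j\<in>J. a i * a j * limit_cov (t i) (t j)) / 2))"
proof -
  define m where "m n j = nat \<lfloor>real n * t j\<rfloor>" for n j
  \<comment> \<open>The inserted 1 makes the minimum meaningful for empty \<open>J\<close> and
    bounds it by 1.\<close>
  define \<delta> where "\<delta> = Min (insert 1 ((\<lambda>j. 1 - t j) ` J))"
  have \<delta>: "0 < \<delta>" "\<delta> \<le> 1"
    using J t unfolding \<delta>_def by (auto intro: Min_le)
  have \<delta>t: "t j \<le> 1 - \<delta>" if "j \<in> J" for j
  proof -
    have "\<delta> \<le> 1 - t j" unfolding \<delta>_def using J that by (intro Min_le) auto
    then show ?thesis by simp
  qed
  define A where "A = (\<Sum>j\<in>J. \<bar>a j\<bar>)"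
  define B where "B n = nat \<lfloor>real n * (1 - \<delta>)\<rfloor>" for n
  define c where "c n l = (\<Sum>j\<in>J. a j / sqrt n * (if l < m n j then ratio n l (m n j) else 0))" for n l
  define S where "S n \<sigma> = (\<Sum>j\<in>J. a j * centred n 2 (m n j) \<sigma> / sqrt n)" for n \<sigma>
  define V where "V n = pexp n (\<lambda>\<sigma>. (S n \<sigma>)\<^sup>2)" for n
  have A: "0 \<le> A" unfolding A_def by (intro sum_nonneg) auto
  have mB: "m n j \<le> B n" if "j \<in> J" for n j
    unfolding m_def B_def using \<delta>t[OF that] by (intro nat_mono floor_mono mult_left_mono) auto
  define err where "err n = 26 * A\<^sup>2 / (\<delta> * sqrt n) + 4 / 3 * A ^ 3 / sqrt n + 2 * A ^ 4 / n" for n :: nat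
  have err: "err \<longlonglongrightarrow> 0" unfolding err_def using \<delta>(1) by real_asymp
  have main: "\<forall>\<^sub>F n in sequentially. cmod (pexp n (\<lambda>\<sigma>. iexp (S n \<sigma>)) - of_real (exp (- V n / 2))) \<le> err n"
    using eventually_mult_ge[OF \<delta>(1), of 2] eventually_gt_at_top[of 1]
  proof eventually_elim
    case (elim n)
    note gap = floor_mult_gap[OF \<delta>(1) order_refl _ elim(1), folded B_def]
    have Bn: "B n + 2 \<le> n" "real n * \<delta> \<le> real n - real (B n)" using gap \<delta> by auto
    have n: "0 < sqrt n" using elim by simp
    have mn: "m n j + 2 \<le> n" if "j \<in> J" for j using mB[OF that, of n] Bn by simp
    have S: "S n \<sigma> = (\<Sum>l<B n. c n l * mart_diff n 2 l \<sigma>)" if \<sigma>: "\<sigma> \<in> perms n" for \<sigma>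
    proof -
      have "S n \<sigma> = (\<Sum>j\<in>J. \<Sum>l<B n. a j / sqrt n * (if l < m n j then ratio n l (m n j) else 0) * mart_diff n 2 l \<sigma>)"
        unfolding S_def
      proof (intro sum.cong refl)
        fix j assume j: "j \<in> J"
        have "centred n 2 (m n j) \<sigma> = (\<Sum>l<m n j. ratio n l (m n j) * mart_diff n 2 l \<sigma>)"
          by (rule centred_eq_sum_mart_diff[OF mn[OF j] \<sigma>])
        also have "\<dots> = (\<Sum>l<B n. (if l < m n j then ratio n l (m n j) else 0) * mart_diff n 2 l \<sigma>)"
          using mB[OF j, of n] by (intro sum.mono_neutral_cong_left) auto
        finally show "a j * centred n 2 (m n j) \<sigma> / sqrt n
          = (\<Sum>l<B n. a j / sqrt n * (if l < m n j then ratio n l (m n j) else 0) * mart_diff n 2 l \<sigma>)"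
          by (simp only: sum_distrib_left times_divide_eq_left sum_divide_distrib mult.assoc)
      qed
      also have "\<dots> = (\<Sum>l<B n. c n l * mart_diff n 2 l \<sigma>)"
        unfolding c_def sum_distrib_right by (rule sum.swap)
      finally show ?thesis .
    qed
    have c: "\<bar>c n l\<bar> \<le> A / sqrt n" for l
    proof -
      have "\<bar>c n l\<bar> \<le> (\<Sum>j\<in>J. \<bar>a j / sqrt n * (if l < m n j then ratio n l (m n j) else 0)\<bar>)"
        unfolding c_def by (rule sum_abs)
      also have "\<dots> \<le> (\<Sum>j\<in>J. \<bar>a j\<bar> / sqrt n)"
      proof (rule sum_mono)
        fix j assume "j \<in> J"
        then have "\<bar>if l < m n j then ratio n l (m n j) else 0\<bar> \<le> 1"
          using ratio_bounds[OF _ mn, of l j] by simp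
        then have "\<bar>a j / sqrt n\<bar> * \<bar>if l < m n j then ratio n l (m n j) else 0\<bar> \<le> \<bar>a j / sqrt n\<bar> * 1"
          by (rule mult_left_mono) simp
        then show "\<bar>a j / sqrt n * (if l < m n j then ratio n l (m n j) else 0)\<bar> \<le> \<bar>a j\<bar> / sqrt n"
          unfolding abs_mult using n by simp
      qed
      also have "\<dots> = A / sqrt n" by (simp add: A_def sum_divide_distrib)
      finally show ?thesis .
    qed
    have V: "V n = (\<Sum>l<B n. (c n l)\<^sup>2 * step_var n l)"
    proof -
      have "V n = pexp n (\<lambda>\<sigma>. (\<Sum>l<B n. c n l * mart_diff n 2 l \<sigma>)\<^sup>2)"
        unfolding V_def by (rule pexp_cong) (simp only: S)
      then show ?thesis using Bn by (simp only: pexp_square_mart_diff_sum)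
    qed
    have "pexp n (\<lambda>\<sigma>. iexp (S n \<sigma>)) = pexp n (\<lambda>\<sigma>. iexp (\<Sum>l<B n. c n l * mart_diff n 2 l \<sigma>))"
      by (rule pexp_cong) (simp only: S)
    then have "cmod (pexp n (\<lambda>\<sigma>. iexp (S n \<sigma>)) - of_real (exp (- V n / 2)))
      \<le> (\<Sum>l<B n. (c n l)\<^sup>2 / 2 * pexp n (\<lambda>\<sigma>. \<bar>next_avg n l (\<lambda>\<sigma>. (mart_diff n 2 l \<sigma>)\<^sup>2) \<sigma> - step_var n l\<bar>)
        + (4 / 3 * \<bar>c n l\<bar> ^ 3 + 2 * (c n l) ^ 4))"
      unfolding V using Bn by (simp only: char_mart_diff_sum)
    also have "\<dots> \<le> (\<Sum>l<B n. err n / n)"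
    proof (rule sum_mono)
      fix l assume "l \<in> {..<B n}"
      then have l: "l + 2 \<le> n" "real n * \<delta> \<le> real (n - l)" using Bn by (auto simp: of_nat_diff)
      have c2: "(c n l)\<^sup>2 \<le> A\<^sup>2 / n" and c4: "(c n l) ^ 4 \<le> A ^ 4 / (real n)\<^sup>2"
        and c3: "\<bar>c n l\<bar> ^ 3 \<le> A ^ 3 / (n * sqrt n)"
      proof -
        have "\<bar>c n l\<bar>\<^sup>2 \<le> (A / sqrt n)\<^sup>2" "\<bar>c n l\<bar> ^ 4 \<le> (A / sqrt n) ^ 4" "\<bar>c n l\<bar> ^ 3 \<le> (A / sqrt n) ^ 3"
          by (intro power_mono c; simp)+
        moreover have "sqrt n ^ 4 = (real n)\<^sup>2" "sqrt n ^ 3 = n * sqrt n"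
          by (simp_all add: power4_eq_xxxx power3_eq_cube power2_eq_square)
        ultimately show "(c n l)\<^sup>2 \<le> A\<^sup>2 / n" "(c n l) ^ 4 \<le> A ^ 4 / (real n)\<^sup>2" "\<bar>c n l\<bar> ^ 3 \<le> A ^ 3 / (n * sqrt n)"
          by (simp_all add: power_divide)
      qed
      have "pexp n (\<lambda>\<sigma>. \<bar>next_avg n l (\<lambda>\<sigma>. (mart_diff n 2 l \<sigma>)\<^sup>2) \<sigma> - step_var n l\<bar>) \<le> 52 * sqrt n / real (n - l)"
        by (rule next_avg_square_concentrated[OF elim(2) l(1)])
      also have "\<dots> \<le> 52 * sqrt n / (real n * \<delta>)"
        using l elim \<delta> by (intro divide_left_mono) auto
      finally have q: "pexp n (\<lambda>\<sigma>. \<bar>next_avg n l (\<lambda>\<sigma>. (mart_diff n 2 l \<sigma>)\<^sup>2) \<sigma> - step_var n l\<bar>) \<le> 52 * sqrt n / (real n * \<delta>)" .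
      have "(c n l)\<^sup>2 / 2 * pexp n (\<lambda>\<sigma>. \<bar>next_avg n l (\<lambda>\<sigma>. (mart_diff n 2 l \<sigma>)\<^sup>2) \<sigma> - step_var n l\<bar>)
        + (4 / 3 * \<bar>c n l\<bar> ^ 3 + 2 * (c n l) ^ 4)
        \<le> A\<^sup>2 / n / 2 * (52 * sqrt n / (real n * \<delta>)) + (4 / 3 * (A ^ 3 / (n * sqrt n)) + 2 * (A ^ 4 / (real n)\<^sup>2))"
        using c2 c3 c4 q by (intro add_mono mult_mono mult_left_mono divide_right_mono pexp_nonneg) auto
      also have "\<dots> = err n / n"
      proof -
        have "A\<^sup>2 / (r * r) / 2 * (52 * r / (r * r * \<delta>)) + (4 / 3 * (A ^ 3 / (r * r * r)) + 2 * (A ^ 4 / (r * r)\<^sup>2))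
          = (26 * A\<^sup>2 / (\<delta> * r) + 4 / 3 * A ^ 3 / r + 2 * A ^ 4 / (r * r)) / (r * r)" if "r > 0" for r
          using that \<delta>(1) by (simp add: field_simps power2_eq_square)
        from this[OF n] show ?thesis unfolding err_def by simp
      qed
      finally show "(c n l)\<^sup>2 / 2 * pexp n (\<lambda>\<sigma>. \<bar>next_avg n l (\<lambda>\<sigma>. (mart_diff n 2 l \<sigma>)\<^sup>2) \<sigma> - step_var n l\<bar>)
        + (4 / 3 * \<bar>c n l\<bar> ^ 3 + 2 * (c n l) ^ 4) \<le> err n / n" .
    qed
    also have "\<dots> = real (B n) * (err n / n)" by simp
    also have "\<dots> \<le> real n * (err n / n)"
      using Bn A \<delta> unfolding err_def by (intro mult_right_mono divide_nonneg_nonneg add_nonneg_nonneg) auto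
    also have "\<dots> = err n" using elim by simp
    finally show ?case .
  qed
  have cov: "(\<lambda>n. pexp n (\<lambda>\<sigma>. centred n 2 (m n i) \<sigma> * centred n 2 (m n j) \<sigma>) / n) \<longlonglongrightarrow> limit_cov (t i) (t j)"
    if "i \<in> J" "j \<in> J" for i j
  proof (cases "t i \<le> t j")
    case True
    then show ?thesis unfolding m_def using t that by (intro cov_tendsto) auto
  next
    case False
    then have "(\<lambda>n. pexp n (\<lambda>\<sigma>. centred n 2 (m n j) \<sigma> * centred n 2 (m n i) \<sigma>) / n) \<longlonglongrightarrow> limit_cov (t j) (t i)"
      unfolding m_def using t that by (intro cov_tendsto) auto
    then show ?thesis by (simp only: limit_cov_commute[of "t j"] mult.commute)
  qed
  have V: "V n = (\<Sum>i\<in>J. \<Sum>j\<in>J. a i * a j * (pexp n (\<lambda>\<sigma>. centred n 2 (m n i) \<sigma> * centred n 2 (m n j) \<sigma>) / n))" for n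
  proof -
    have "V n = pexp n (\<lambda>\<sigma>. \<Sum>i\<in>J. \<Sum>j\<in>J. a i * a j / n * (centred n 2 (m n i) \<sigma> * centred n 2 (m n j) \<sigma>))"
      unfolding V_def
    proof (rule pexp_cong)
      fix \<sigma>
      have "(S n \<sigma>)\<^sup>2 = (\<Sum>i\<in>J. \<Sum>j\<in>J. (a i * centred n 2 (m n i) \<sigma> / sqrt n) * (a j * centred n 2 (m n j) \<sigma> / sqrt n))"
        unfolding S_def power2_eq_square by (rule sum_product)
      also have "\<dots> = (\<Sum>i\<in>J. \<Sum>j\<in>J. a i * a j / n * (centred n 2 (m n i) \<sigma> * centred n 2 (m n j) \<sigma>))"
        by (intro sum.cong refl) simp
      finally show "(S n \<sigma>)\<^sup>2 = (\<Sum>i\<in>J. \<Sum>j\<in>J. a i * a j / n * (centred n 2 (m n i) \<sigma> * centred n 2 (m n j) \<sigma>))" .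
    qed
    then show ?thesis unfolding pexp_sum pexp_mult_left by simp
  qed
  have "V \<longlonglongrightarrow> (\<Sum>i\<in>J. \<Sum>j\<in>J. a i * a j * limit_cov (t i) (t j))"
    unfolding V by (intro tendsto_sum tendsto_mult tendsto_const cov)
  then have "(\<lambda>n. complex_of_real (exp (- V n / 2))) \<longlonglongrightarrow> of_real (exp (- (\<Sum>i\<in>J. \<Sum>j\<in>J. a i * a j * limit_cov (t i) (t j)) / 2))"
    by (intro tendsto_intros) auto
  moreover have "(\<lambda>n. pexp n (\<lambda>\<sigma>. iexp (S n \<sigma>)) - of_real (exp (- V n / 2))) \<longlonglongrightarrow> 0"
    by (rule Lim_null_comparison[OF main err])
  ultimately have "(\<lambda>n. (pexp n (\<lambda>\<sigma>. iexp (S n \<sigma>)) - of_real (exp (- V n / 2))) + of_real (exp (- V n / 2)))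
      \<longlonglongrightarrow> 0 + complex_of_real (exp (- (\<Sum>i\<in>J. \<Sum>j\<in>J. a i * a j * limit_cov (t i) (t j)) / 2))"
    by (intro tendsto_add)
  then show ?thesis by (simp add: S_def m_def)
qed


section \<open>The scaled number of runs\<close>

lemma cmod_iexp_diff_le: "cmod (iexp x - iexp y) \<le> \<bar>x - y\<bar>"
proof -
  have "iexp x - iexp y = iexp y * (iexp (x - y) - 1)"
    by (simp add: right_diff_distrib exp_add[symmetric] distrib_left[symmetric])
  also have "cmod \<dots> = cmod (iexp (x - y) - 1)" by (simp add: norm_mult)
  also have "\<dots> \<le> \<bar>x - y\<bar>" using iexp_approx1[of "x - y" 0] by simp
  finally show ?thesis .
qed

lemma centred_full: "centred n 2 n \<sigma> = 0"
proof -
  have "windows n 2 n = (\<lambda>\<sigma>. 0)" by (simp add: windows_def fun_eq_iff)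
  then show ?thesis by (simp add: centred_def)
qed

lemma limit_cov_1: "s \<le> 1 \<Longrightarrow> limit_cov s 1 = 0" "s \<le> 1 \<Longrightarrow> limit_cov 1 s = 0"
  by (simp_all add: limit_cov_def max_def)

lemma char_scaled_runs_tendsto:
  fixes J :: "'i set" and t a :: "'i \<Rightarrow> real"
  assumes J: "finite J" and t: "\<And>j. j \<in> J \<Longrightarrow> t j \<in> {0..1}"
  shows "(\<lambda>n. pexp n (\<lambda>\<sigma>. iexp (\<Sum>j\<in>J. a j * scaled_runs n \<sigma> (t j))))
    \<longlonglongrightarrow> complex_of_real (exp (- (\<Sum>i\<in>J. \<Sum>j\<in>J. a i * a j * limit_cov (t i) (t j)) / 2))"
proof -
  define J' where "J' = {j\<in>J. t j < 1}"
  have J': "finite J'" "J' \<subseteq> J" using J by (auto simp: J'_def)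
  define S where "S n \<sigma> = (\<Sum>j\<in>J'. - a j * centred n 2 (nat \<lfloor>real n * t j\<rfloor>) \<sigma> / sqrt n)" for n \<sigma>
  define q where "q = (\<Sum>i\<in>J. \<Sum>j\<in>J. a i * a j * limit_cov (t i) (t j))"
  have tJ: "t j \<le> 1" if "j \<in> J" for j using t[OF that] by simp
  have t1: "t j = 1" if "j \<in> J - J'" for j using t[of j] that by (auto simp: J'_def)
  have "q = (\<Sum>i\<in>J. \<Sum>j\<in>J'. a i * a j * limit_cov (t i) (t j))"
    unfolding q_def by (intro sum.cong refl sum.mono_neutral_right J J') (simp add: t1 limit_cov_1 tJ)
  also have "\<dots> = (\<Sum>i\<in>J'. \<Sum>j\<in>J'. - a i * - a j * limit_cov (t i) (t j))"
    by (intro sum.mono_neutral_cong_right J J') (use J'(2) tJ in \<open>auto simp: t1 limit_cov_1 subset_iff\<close>)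
  finally have q: "q = (\<Sum>i\<in>J'. \<Sum>j\<in>J'. - a i * - a j * limit_cov (t i) (t j))" .
  have lim: "(\<lambda>n. pexp n (\<lambda>\<sigma>. iexp (S n \<sigma>))) \<longlonglongrightarrow> complex_of_real (exp (- q / 2))"
    unfolding S_def q
    by (rule clt_lt_1[OF J'(1), where t = t and a = "\<lambda>j. - a j"]) (use t J' in \<open>auto simp: J'_def\<close>)
  define A where "A = (\<Sum>j\<in>J. \<bar>a j\<bar>)"
  have "(\<lambda>n. pexp n (\<lambda>\<sigma>. iexp (\<Sum>j\<in>J. a j * scaled_runs n \<sigma> (t j))) - pexp n (\<lambda>\<sigma>. iexp (S n \<sigma>))) \<longlonglongrightarrow> 0"
  proof (rule Lim_null_comparison)
    show "(\<lambda>n. A * 4 / sqrt (real n)) \<longlonglongrightarrow> 0" by real_asymp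
    show "\<forall>\<^sub>F n in sequentially. cmod (pexp n (\<lambda>\<sigma>. iexp (\<Sum>j\<in>J. a j * scaled_runs n \<sigma> (t j)))
        - pexp n (\<lambda>\<sigma>. iexp (S n \<sigma>))) \<le> A * 4 / sqrt (real n)"
      using eventually_gt_at_top[of 0]
    proof eventually_elim
      case (elim n)
      have "cmod (pexp n (\<lambda>\<sigma>. iexp (\<Sum>j\<in>J. a j * scaled_runs n \<sigma> (t j))) - pexp n (\<lambda>\<sigma>. iexp (S n \<sigma>)))
          \<le> pexp n (\<lambda>\<sigma>. cmod (iexp (\<Sum>j\<in>J. a j * scaled_runs n \<sigma> (t j)) - iexp (S n \<sigma>)))"
        unfolding pexp_diff[symmetric] by (rule norm_pexp_le)
      also have "\<dots> \<le> pexp n (\<lambda>\<sigma>. A * 4 / sqrt (real n))"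
      proof (rule pexp_mono)
        fix \<sigma> assume \<sigma>: "\<sigma> \<in> perms n"
        have "S n \<sigma> = (\<Sum>j\<in>J. - a j * centred n 2 (nat \<lfloor>real n * t j\<rfloor>) \<sigma> / sqrt n)"
          unfolding S_def by (intro sum.mono_neutral_left J J') (simp add: t1 centred_full)
        then have "(\<Sum>j\<in>J. a j * scaled_runs n \<sigma> (t j)) - S n \<sigma>
          = (\<Sum>j\<in>J. a j * ((sqrt n * scaled_runs n \<sigma> (t j) + centred n 2 (nat \<lfloor>real n * t j\<rfloor>) \<sigma>) / sqrt n))"
          using elim by (simp add: sum_subtractf[symmetric] field_simps)
        also have "\<bar>\<dots>\<bar> \<le> (\<Sum>j\<in>J. \<bar>a j\<bar> * (4 / sqrt n))"
        proof (rule order_trans[OF sum_abs sum_mono])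
          fix j assume "j \<in> J"
          then have "\<bar>sqrt n * scaled_runs n \<sigma> (t j) + centred n 2 (nat \<lfloor>real n * t j\<rfloor>) \<sigma>\<bar> / sqrt n \<le> 4 / sqrt n"
            using elim by (intro divide_right_mono scaled_runs_approx[OF \<sigma>] t) auto
          then show "\<bar>a j * ((sqrt n * scaled_runs n \<sigma> (t j) + centred n 2 (nat \<lfloor>real n * t j\<rfloor>) \<sigma>) / sqrt n)\<bar>
            \<le> \<bar>a j\<bar> * (4 / sqrt n)"
            unfolding abs_mult abs_divide by (intro mult_left_mono) auto
        qed
        also have "\<dots> = A * 4 / sqrt n" by (simp add: A_def sum_distrib_right sum_divide_distrib)
        finally show "cmod (iexp (\<Sum>j\<in>J. a j * scaled_runs n \<sigma> (t j)) - iexp (S n \<sigma>)) \<le> A * 4 / sqrt (real n)"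
          by (rule order_trans[OF cmod_iexp_diff_le])
      qed
      finally show ?case by simp
    qed
  qed
  from tendsto_add[OF this lim] show ?thesis by (simp add: q_def)
qed

text \<open>The square is at most twice that of the approximation error 4 plus twice that of the
  centred count, whose mean is at most 4 n. This yields 32 / n + 8.\<close>

lemma scaled_runs_second_moment:
  assumes "0 < n" "t \<in> {0..1}"
  shows "pexp n (\<lambda>\<sigma>. (scaled_runs n \<sigma> t)\<^sup>2) \<le> 40"
proof -
  define m where "m = nat \<lfloor>real n * t\<rfloor>"
  have "real n * t \<le> n" using assms by (intro mult_left_le) auto
  then have m: "m \<le> n" unfolding m_def by linarith
  have "pexp n (\<lambda>\<sigma>. (scaled_runs n \<sigma> t)\<^sup>2) \<le> pexp n (\<lambda>\<sigma>. 2 / n * (centred n 2 m \<sigma>)\<^sup>2 + 32 / n)"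
  proof (rule pexp_mono)
    fix \<sigma> assume \<sigma>: "\<sigma> \<in> perms n"
    define x c where "x = sqrt n * scaled_runs n \<sigma> t" and "c = centred n 2 m \<sigma>"
    have "\<bar>x + c\<bar> \<le> 4" unfolding x_def c_def m_def by (rule scaled_runs_approx[OF \<sigma> assms])
    then have "(x + c)\<^sup>2 \<le> 4\<^sup>2" by (intro abs_le_square_iff[THEN iffD1]) simp
    moreover have "x\<^sup>2 \<le> 2 * (x + c)\<^sup>2 + 2 * c\<^sup>2"
    proof -
      have "0 \<le> (x + 2 * c)\<^sup>2" by simp
      also have "\<dots> = 2 * (x + c)\<^sup>2 + 2 * c\<^sup>2 - x\<^sup>2" by algebra
      finally show ?thesis by simp
    qed
    ultimately have "x\<^sup>2 \<le> 32 + 2 * c\<^sup>2" by simp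
    then have "x\<^sup>2 / n \<le> (32 + 2 * c\<^sup>2) / n" by (rule divide_right_mono) simp
    moreover have "x\<^sup>2 / n = (scaled_runs n \<sigma> t)\<^sup>2" using assms by (simp add: x_def power_mult_distrib)
    ultimately show "(scaled_runs n \<sigma> t)\<^sup>2 \<le> 2 / n * (centred n 2 m \<sigma>)\<^sup>2 + 32 / n"
      by (simp add: c_def add_divide_distrib add.commute)
  qed
  also have "\<dots> = 2 / n * pexp n (\<lambda>\<sigma>. (centred n 2 m \<sigma>)\<^sup>2) + 32 / n"
    by (simp only: pexp_add pexp_mult_left pexp_const)
  also have "\<dots> \<le> 2 / n * (4 * real n) + 32 / n"
  proof (intro add_right_mono mult_left_mono)
    have "pexp n (\<lambda>\<sigma>. (centred n 2 m \<sigma>)\<^sup>2) \<le> (real 2)\<^sup>2 * m"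
      by (rule centred_moments(1)[OF m]) (use m in auto)
    also have "\<dots> \<le> 4 * real n" using m by simp
    finally show "pexp n (\<lambda>\<sigma>. (centred n 2 m \<sigma>)\<^sup>2) \<le> 4 * real n" .
  qed auto
  also have "\<dots> \<le> 8 + 32"
    using assms by (intro add_mono) (auto simp: divide_le_eq)
  finally show ?thesis by simp
qed

section \<open>Oscillation between grid points\<close>

lemma le_eps_power4:
  fixes x \<epsilon> :: real
  assumes "0 \<le> x" "0 < \<epsilon>"
  shows "x \<le> \<epsilon> + x ^ 4 / \<epsilon> ^ 3"
proof (cases "x \<le> \<epsilon>")
  case False
  then have "x * \<epsilon> ^ 3 \<le> x * x ^ 3" using assms by (intro mult_left_mono power_mono) auto
  also have "x * x ^ 3 = x ^ 4" by (simp add: power4_eq_xxxx power3_eq_cube)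
  finally have "x \<le> x ^ 4 / \<epsilon> ^ 3" using assms by (simp add: pos_le_divide_eq)
  then show ?thesis using assms by simp
qed (use assms in \<open>simp add: add_increasing2\<close>)

lemma power2_between:
  fixes x :: real
  assumes "1 < x"
  obtains r where "x \<le> 2 ^ r" "2 ^ r \<le> 2 * x"
proof -
  define r where "r = (LEAST r. x \<le> 2 ^ r)"
  have "\<exists>r. x \<le> 2 ^ r" using real_arch_pow[of 2 x] by (auto intro: less_imp_le)
  then have r: "x \<le> 2 ^ r" unfolding r_def by (rule LeastI_ex)
  then obtain k where k: "r = Suc k" using assms by (cases r) auto
  have "\<not> x \<le> 2 ^ k" using not_less_Least[of k "\<lambda>r. x \<le> 2 ^ r"] k by (simp add: r_def)
  then have "2 ^ r \<le> 2 * x" by (simp add: k)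
  with r show ?thesis by (rule that)
qed

text \<open>The maximum over the blocks is replaced by the sum of fourth powers. A block has at most
  4 n / M steps, so its fourth moment is at most 729 * 16859136 * 16 (n / M)^2; the final factor 2
  bounds (M + 1) / M. The term \<open>8 / sqrt n\<close> pays twice for the distance between runs
  and centred count.\<close>

lemma scaled_runs_oscillation:
  assumes M: "0 < M" "M \<le> n" and \<epsilon>: "0 < \<epsilon>"
  obtains U where "\<And>\<sigma> t. \<sigma> \<in> perms n \<Longrightarrow> t \<in> {0..1} \<Longrightarrow>
      \<bar>scaled_runs n \<sigma> t - scaled_runs n \<sigma> (real (nat \<lfloor>real M * t\<rfloor>) / real M)\<bar> \<le> U \<sigma>"
    and "pexp n U \<le> 8 / sqrt n + \<epsilon> + 393289924608 / (\<epsilon> ^ 3 * real M)"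
    and "\<And>\<sigma>. 0 < U \<sigma>"
proof -
  have n: "0 < n" using M by simp
  \<comment> \<open>A block of n / M steps gains up to one step by rounding; since
    \<open>M \<le> n\<close>, doubling covers this.\<close>
  define x where "x = 2 * real n / real M"
  have x: "1 < x" using M by (simp add: x_def)
  obtain r where r: "x \<le> 2 ^ r" "2 ^ r \<le> 2 * x" using power2_between[OF x] .
  \<comment> \<open>The count is frozen at time \<open>n\<close>, so that a dyadic block may extend
    beyond the end.\<close>
  define w where "w j = centred n 2 (min j n)" for j
  define p where "p i = nat \<lfloor>real n * (real i / real M)\<rfloor>" for i
  define b where "b i \<sigma> = block_osc w (p i) (2 ^ r) \<sigma>" for i \<sigma>
  define U where "U \<sigma> = 8 / sqrt n + \<epsilon> + (\<Sum>i\<le>M. b i \<sigma> ^ 4) / ((real n)\<^sup>2 * \<epsilon> ^ 3)" for \<sigma>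
  show ?thesis
  proof (rule that)
    fix \<sigma> :: "nat \<Rightarrow> nat"
    have "0 < 8 / sqrt n + \<epsilon>" using n \<epsilon> by (simp add: add_pos_pos)
    moreover have "0 \<le> (\<Sum>i\<le>M. b i \<sigma> ^ 4) / ((real n)\<^sup>2 * \<epsilon> ^ 3)"
      using \<epsilon> by (intro divide_nonneg_nonneg sum_nonneg) auto
    ultimately show "0 < U \<sigma>" unfolding U_def by linarith
  next
    fix \<sigma> t assume \<sigma>: "\<sigma> \<in> perms n" and t: "t \<in> {0..1::real}"
    define i s where "i = nat \<lfloor>real M * t\<rfloor>" and "s = real i / real M"
    have Mt: "0 \<le> real M * t" "real M * t \<le> M" using t by (auto intro: mult_left_le)
    then have i: "real i \<le> real M * t" "real M * t < real i + 1" unfolding i_def by linarith+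
    have iM: "i \<le> M" using i(1) Mt by linarith
    have s: "s \<in> {0..1}" "s \<le> t" "t \<le> s + 1 / real M"
      using M i iM by (auto simp: s_def field_simps)
    define q where "q = nat \<lfloor>real n * t\<rfloor>"
    have p: "p i = nat \<lfloor>real n * s\<rfloor>" by (simp add: p_def s_def)
    have nt: "real n * s \<le> real n * t" "real n * t \<le> real n * s + real n / real M" "0 \<le> real n * s" "real n * t \<le> n"
      using s t mult_left_mono[OF s(3), of "real n"] by (auto intro: mult_left_mono mult_left_le simp: distrib_left)
    have pq: "p i \<le> q" unfolding p q_def using nt by (intro nat_mono floor_mono)
    have qn: "q \<le> n" unfolding q_def using nt by linarith
    have "real q - real (p i) \<le> real n / real M + 1" unfolding p q_def using nt by linarith
    also have "\<dots> \<le> 2 ^ r"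
    proof -
      have "1 \<le> real n / real M" using M by simp
      then show ?thesis using r(1) unfolding x_def by (simp only: times_divide_eq_right[symmetric])
    qed
    finally have "real (q - p i) \<le> real (2 ^ r)" using pq by (simp add: of_nat_diff)
    then have qp: "q - p i \<le> 2 ^ r" by (simp only: of_nat_le_iff)
    have "\<bar>w (p i + (q - p i)) \<sigma> - w (p i) \<sigma>\<bar> \<le> b i \<sigma>"
      unfolding b_def by (rule block_osc_ge[OF qp])
    then have osc: "\<bar>centred n 2 q \<sigma> - centred n 2 (p i) \<sigma>\<bar> \<le> b i \<sigma>"
      using pq qn by (simp add: w_def min_absorb1)
    have "\<bar>sqrt n * scaled_runs n \<sigma> t - sqrt n * scaled_runs n \<sigma> s\<bar> \<le> b i \<sigma> + 8"
      using scaled_runs_approx[OF \<sigma> n t] scaled_runs_approx[OF \<sigma> n s(1)] osc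
      unfolding p[symmetric] q_def[symmetric] by linarith
    then have "\<bar>scaled_runs n \<sigma> t - scaled_runs n \<sigma> s\<bar> * sqrt n \<le> b i \<sigma> + 8"
      by (simp add: right_diff_distrib[symmetric] abs_mult mult.commute)
    then have "\<bar>scaled_runs n \<sigma> t - scaled_runs n \<sigma> s\<bar> \<le> (b i \<sigma> + 8) / sqrt n"
      using n by (simp add: pos_le_divide_eq)
    also have "\<dots> = 8 / sqrt n + b i \<sigma> / sqrt n" by (simp add: add_divide_distrib)
    also have "\<dots> \<le> U \<sigma>"
    proof -
      \<comment> \<open>This plays the role of Markov's inequality: the bound is additive, so it can
        be averaged directly.\<close>
      have "b i \<sigma> / sqrt n \<le> \<epsilon> + (b i \<sigma> / sqrt n) ^ 4 / \<epsilon> ^ 3"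
        using \<epsilon> by (intro le_eps_power4 divide_nonneg_nonneg) (auto simp: b_def block_osc_nonneg)
      also have "(b i \<sigma> / sqrt n) ^ 4 / \<epsilon> ^ 3 = b i \<sigma> ^ 4 / ((real n)\<^sup>2 * \<epsilon> ^ 3)"
      proof -
        have "sqrt n ^ 4 = (real n)\<^sup>2" by (simp add: power4_eq_xxxx power2_eq_square)
        then show ?thesis by (simp add: power_divide)
      qed
      finally have "b i \<sigma> / sqrt n \<le> \<epsilon> + b i \<sigma> ^ 4 / ((real n)\<^sup>2 * \<epsilon> ^ 3)" .
      moreover have "b i \<sigma> ^ 4 / ((real n)\<^sup>2 * \<epsilon> ^ 3) \<le> (\<Sum>i\<le>M. b i \<sigma> ^ 4) / ((real n)\<^sup>2 * \<epsilon> ^ 3)"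
        using iM \<epsilon> by (intro divide_right_mono member_le_sum) auto
      ultimately show ?thesis unfolding U_def by linarith
    qed
    finally show "\<bar>scaled_runs n \<sigma> t - scaled_runs n \<sigma> (real (nat \<lfloor>real M * t\<rfloor>) / real M)\<bar> \<le> U \<sigma>"
      unfolding s_def i_def .
  next
    have incr: "pexp n (\<lambda>\<sigma>. (w b \<sigma> - w a \<sigma>) ^ 4) \<le> 16859136 * (real (b - a))\<^sup>2" if "a \<le> b" for a b
    proof -
      have "pexp n (\<lambda>\<sigma>. (w b \<sigma> - w a \<sigma>) ^ 4) \<le> 16859136 * (real (min b n - min a n))\<^sup>2"
        unfolding w_def using that by (intro centred_increment) auto
      also have "\<dots> \<le> 16859136 * (real (b - a))\<^sup>2"
        by (intro mult_left_mono power_mono of_nat_mono) auto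
      finally show ?thesis .
    qed
    have b4: "pexp n (\<lambda>\<sigma>. b i \<sigma> ^ 4) \<le> 196644962304 * (real n / real M)\<^sup>2" for i
    proof -
      have "pexp n (\<lambda>\<sigma>. b i \<sigma> ^ 4) \<le> 729 * 16859136 * 4 ^ r"
        unfolding b_def by (rule block_osc_moment[OF incr])
      also have "(4 :: real) ^ r = (2 ^ r)\<^sup>2" by (simp add: power2_eq_square power_mult_distrib[symmetric])
      also have "729 * 16859136 * (2 ^ r)\<^sup>2 \<le> 729 * 16859136 * (2 * x)\<^sup>2"
        using r(2) by (intro mult_left_mono power_mono) auto
      also have "(2 * x)\<^sup>2 = 16 * (real n / real M)\<^sup>2" by (simp add: x_def power_mult_distrib power_divide)
      finally show ?thesis by simp
    qed
    have "pexp n U = 8 / sqrt n + \<epsilon> + (\<Sum>i\<le>M. pexp n (\<lambda>\<sigma>. b i \<sigma> ^ 4)) / ((real n)\<^sup>2 * \<epsilon> ^ 3)"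
      unfolding U_def by (simp only: pexp_add pexp_const pexp_divide pexp_sum)
    also have "\<dots> \<le> 8 / sqrt n + \<epsilon> + (\<Sum>i\<le>M. 196644962304 * (real n / real M)\<^sup>2) / ((real n)\<^sup>2 * \<epsilon> ^ 3)"
      using \<epsilon> by (intro add_left_mono divide_right_mono sum_mono b4) auto
    also have "(\<Sum>i\<le>M. 196644962304 * (real n / real M)\<^sup>2) / ((real n)\<^sup>2 * \<epsilon> ^ 3)
      = 196644962304 * ((real M + 1) / real M) / (\<epsilon> ^ 3 * real M)"
      using n M \<epsilon> by (simp add: power_divide power2_eq_square field_simps)
    also have "\<dots> \<le> 196644962304 * 2 / (\<epsilon> ^ 3 * real M)"
      using M \<epsilon> by (intro divide_right_mono mult_left_mono) (auto simp: divide_le_eq)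
    finally show "pexp n U \<le> 8 / sqrt n + \<epsilon> + 393289924608 / (\<epsilon> ^ 3 * real M)" by simp
  qed
qed


section \<open>Weak convergence in metric spaces\<close>

text \<open>The Lipschitz envelopes \<open>g k\<close>, infimal convolutions of \<open>f\<close>
  with multiples of the distance, lie below \<open>f\<close> and converge to it pointwise. A lower
  bound for the limit thus holds already for some envelope, and convergence for that envelope
  suffices.\<close>

lemma liminf_of_lipschitz:
  fixes X :: "nat \<Rightarrow> 'a \<Rightarrow> 'c::metric_space" and f :: "'c \<Rightarrow> real"
  assumes M: "\<And>n. prob_space (M n)" "\<And>n. X n \<in> measurable (M n) borel"
    and N: "prob_space N" "Y \<in> measurable N borel"
    and lip: "\<And>g :: 'c \<Rightarrow> real. \<And>L. bounded (range g) \<Longrightarrow> (\<And>x y. \<bar>g x - g y\<bar> \<le> L * dist x y) \<Longrightarrow>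
        (\<lambda>n. \<integral>\<omega>. g (X n \<omega>) \<partial>M n) \<longlonglongrightarrow> (\<integral>\<omega>. g (Y \<omega>) \<partial>N)"
    and f: "continuous_on UNIV f" "bounded (range f)"
    and c: "c < (\<integral>\<omega>. f (Y \<omega>) \<partial>N)"
  shows "\<forall>\<^sub>F n in sequentially. c < (\<integral>\<omega>. f (X n \<omega>) \<partial>M n)"
proof -
  obtain B where B: "\<And>x. \<bar>f x\<bar> \<le> B" using f(2) by (auto simp: bounded_iff)
  have B0: "0 \<le> B" using B[of undefined] by simp
  define g where "g k x = (INF y. f y + real k * dist x y)" for k :: nat and x
  have bdd: "bdd_below (range (\<lambda>y. f y + real k * dist x y))" for k x
  proof (rule bdd_belowI2)
    fix y show "- B \<le> f y + real k * dist x y" using B[of y] by (simp add: abs_le_iff add_increasing2)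
  qed
  have g_le: "g k x \<le> f y + real k * dist x y" for k x y
    unfolding g_def by (rule cINF_lower[OF bdd]) simp
  have g_le_f: "g k x \<le> f x" for k x using g_le[of k x x] by simp
  have g_ge: "a \<le> g k x" if "\<And>y. a \<le> f y + real k * dist x y" for a k x
    unfolding g_def by (rule cINF_greatest) (use that in auto)
  have g_ge_B: "- B \<le> g k x" for k x
  proof (rule g_ge)
    fix y show "- B \<le> f y + real k * dist x y" using B[of y] by (simp add: abs_le_iff add_increasing2)
  qed
  have g_B: "\<bar>g k x\<bar> \<le> B" for k x
    using g_ge_B[of k x] g_le_f[of k x] B[of x] by (simp add: abs_le_iff)
  have g_lip1: "g k x \<le> g k y + real k * dist x y" for k x y
  proof -
    have "g k x - real k * dist x y \<le> g k y"
    proof (rule g_ge)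
      fix z
      have "real k * dist x z \<le> real k * (dist x y + dist y z)"
        by (intro mult_left_mono dist_triangle) simp
      then show "g k x - real k * dist x y \<le> f z + real k * dist y z"
        using g_le[of k x z] by (simp add: distrib_left)
    qed
    then show ?thesis by simp
  qed
  have g_lip: "\<bar>g k x - g k y\<bar> \<le> real k * dist x y" for k x y
    using g_lip1[of k x y] g_lip1[of k y x] by (simp add: abs_le_iff dist_commute)
  have g_cont: "continuous_on UNIV (g k)" for k
  proof -
    have "(real k)-lipschitz_on UNIV (g k)"
      by (rule lipschitz_onI) (use g_lip in \<open>auto simp: dist_real_def\<close>)
    then show ?thesis by (rule lipschitz_on_continuous_on)
  qed
  have g_lim: "(\<lambda>k. g k x) \<longlonglongrightarrow> f x" for x
  proof (rule LIMSEQ_I)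
    fix r :: real assume r: "0 < r"
    have "(f \<longlongrightarrow> f x) (at x)" using f(1) by (simp add: continuous_on_def)
    then obtain d where d: "0 < d" "\<And>y. y \<noteq> x \<Longrightarrow> dist y x < d \<Longrightarrow> dist (f y) (f x) < r / 2"
      using r unfolding tendsto_iff eventually_at by (metis UNIV_I half_gt_zero)
    \<comment> \<open>Points at distance at least \<open>d\<close> from \<open>x\<close> cost 2 B,
      which is as much as \<open>f\<close> can gain there.\<close>
    obtain k0 :: nat where k0: "2 * B / d \<le> k0" using real_arch_simple by blast
    have "norm (g k x - f x) < r" if "k \<ge> k0" for k
    proof -
      have "f x - r / 2 \<le> g k x"
      proof (rule g_ge)
        fix y
        show "f x - r / 2 \<le> f y + real k * dist x y"
        proof (cases "dist y x < d")
          case True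
          then have "\<bar>f y - f x\<bar> < r / 2" using d(2)[of y] r by (cases "y = x") (auto simp: dist_real_def)
          moreover have "0 \<le> real k * dist x y" by simp
          ultimately show ?thesis by linarith
        next
          case False
          have "2 * B \<le> real k0 * d" using k0 d(1) by (simp add: pos_divide_le_eq)
          also have "\<dots> \<le> real k * dist x y" using that False d(1) by (intro mult_mono) (auto simp: dist_commute)
          finally show ?thesis using B[of x] B[of y] r by linarith
        qed
      qed
      then show ?thesis using g_le_f[of k x] r by simp
    qed
    then show "\<exists>k0. \<forall>k\<ge>k0. norm (g k x - f x) < r" by blast
  qed
  have meas: "h \<in> borel_measurable borel" if "continuous_on UNIV h" for h :: "'c \<Rightarrow> real"
    using that by (rule borel_measurable_continuous_onI)
  interpret N: prob_space N by (rule N)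
  have "(\<lambda>k. \<integral>\<omega>. g k (Y \<omega>) \<partial>N) \<longlonglongrightarrow> (\<integral>\<omega>. f (Y \<omega>) \<partial>N)"
  proof (rule integral_dominated_convergence[where w = "\<lambda>_. B"])
    show "(\<lambda>\<omega>. f (Y \<omega>)) \<in> borel_measurable N" using measurable_compose[OF N(2) meas[OF f(1)]] .
    show "(\<lambda>\<omega>. g k (Y \<omega>)) \<in> borel_measurable N" for k using measurable_compose[OF N(2) meas[OF g_cont]] .
  qed (use g_lim g_B in auto)
  then have "\<forall>\<^sub>F k in sequentially. c < (\<integral>\<omega>. g k (Y \<omega>) \<partial>N)" using c by (rule order_tendstoD)
  then obtain k where k: "c < (\<integral>\<omega>. g k (Y \<omega>) \<partial>N)" by (auto dest: eventually_happens)
  have "(\<lambda>n. \<integral>\<omega>. g k (X n \<omega>) \<partial>M n) \<longlonglongrightarrow> (\<integral>\<omega>. g k (Y \<omega>) \<partial>N)"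
    by (rule lip[OF _ g_lip]) (auto simp: bounded_iff intro: g_B)
  then have "\<forall>\<^sub>F n in sequentially. c < (\<integral>\<omega>. g k (X n \<omega>) \<partial>M n)" using k by (rule order_tendstoD)
  then show ?thesis
  proof eventually_elim
    case (elim n)
    interpret Mn: prob_space "M n" by (rule M)
    have "(\<integral>\<omega>. g k (X n \<omega>) \<partial>M n) \<le> (\<integral>\<omega>. f (X n \<omega>) \<partial>M n)"
    proof (rule integral_mono)
      show "integrable (M n) (\<lambda>\<omega>. g k (X n \<omega>))"
        by (rule Mn.integrable_const_bound[where B = B])
          (use g_B measurable_compose[OF M(2) meas[OF g_cont]] in auto)
      show "integrable (M n) (\<lambda>\<omega>. f (X n \<omega>))"
        by (rule Mn.integrable_const_bound[where B = B])
          (use B measurable_compose[OF M(2) meas[OF f(1)]] in auto)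
    qed (rule g_le_f)
    with elim show ?case by simp
  qed
qed

text \<open>The lower bounds for \<open>f\<close> and for \<open>- f\<close> together give
  convergence.\<close>

lemma converges_in_distribution_lipschitz:
  fixes X :: "nat \<Rightarrow> 'a \<Rightarrow> 'c::metric_space"
  assumes M: "\<And>n. prob_space (M n)" "\<And>n. X n \<in> measurable (M n) borel"
    and N: "prob_space N" "Y \<in> measurable N borel"
    and lip: "\<And>g :: 'c \<Rightarrow> real. \<And>L. bounded (range g) \<Longrightarrow> (\<And>x y. \<bar>g x - g y\<bar> \<le> L * dist x y) \<Longrightarrow>
        (\<lambda>n. \<integral>\<omega>. g (X n \<omega>) \<partial>M n) \<longlonglongrightarrow> (\<integral>\<omega>. g (Y \<omega>) \<partial>N)"
  shows "converges_in_distribution M X N Y"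
  unfolding converges_in_distribution_def
proof (intro conjI allI impI M N)
  fix f :: "'c \<Rightarrow> real" assume f: "continuous_on UNIV f \<and> bounded (range f)"
  show "(\<lambda>n. \<integral>\<omega>. f (X n \<omega>) \<partial>M n) \<longlonglongrightarrow> (\<integral>\<omega>. f (Y \<omega>) \<partial>N)"
  proof (rule order_tendstoI)
    fix c assume "c < (\<integral>\<omega>. f (Y \<omega>) \<partial>N)"
    then show "\<forall>\<^sub>F n in sequentially. c < (\<integral>\<omega>. f (X n \<omega>) \<partial>M n)"
      using f by (intro liminf_of_lipschitz[OF M N lip]) auto
  next
    fix c assume c: "(\<integral>\<omega>. f (Y \<omega>) \<partial>N) < c"
    have "continuous_on UNIV (\<lambda>x. - f x)" "bounded (range (\<lambda>x. - f x))"
      using f by (auto intro: continuous_on_minus simp: bounded_iff)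
    then have "\<forall>\<^sub>F n in sequentially. - c < (\<integral>\<omega>. - f (X n \<omega>) \<partial>M n)"
      using c by (intro liminf_of_lipschitz[OF M N lip]) auto
    then show "\<forall>\<^sub>F n in sequentially. (\<integral>\<omega>. f (X n \<omega>) \<partial>M n) < c" by simp
  qed
qed

section \<open>From characteristic functions to Lipschitz functions of several variables\<close>

text \<open>The phase \<open>c\<close> includes sines among the generators, and the product formula
  for cosines makes the class an algebra.\<close>

inductive trig_poly :: "nat \<Rightarrow> ((nat \<Rightarrow> real) \<Rightarrow> real) \<Rightarrow> bool" for k where
  cos: "trig_poly k (\<lambda>x. a * cos ((\<Sum>j<k. \<theta> j * x j) + c))"
| add: "trig_poly k f \<Longrightarrow> trig_poly k g \<Longrightarrow> trig_poly k (\<lambda>x. f x + g x)"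

lemma trig_poly_mult:
  assumes "trig_poly k f" "trig_poly k g"
  shows "trig_poly k (\<lambda>x. f x * g x)"
  using assms(1)
proof induction
  case (cos a \<theta> c)
  show ?case using assms(2)
  proof induction
    case (cos b \<eta> d)
    have "(\<lambda>x. a * cos ((\<Sum>j<k. \<theta> j * x j) + c) * (b * cos ((\<Sum>j<k. \<eta> j * x j) + d)))
      = (\<lambda>x. a * b / 2 * cos ((\<Sum>j<k. (\<theta> j - \<eta> j) * x j) + (c - d)) + a * b / 2 * cos ((\<Sum>j<k. (\<theta> j + \<eta> j) * x j) + (c + d)))"
    proof
      fix x :: "nat \<Rightarrow> real"
      define u v where "u = (\<Sum>j<k. \<theta> j * x j) + c" and "v = (\<Sum>j<k. \<eta> j * x j) + d"
      have A: "(\<Sum>j<k. (\<theta> j - \<eta> j) * x j) + (c - d) = u - v"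
        and B: "(\<Sum>j<k. (\<theta> j + \<eta> j) * x j) + (c + d) = u + v"
        by (simp_all add: u_def v_def left_diff_distrib distrib_right sum.distrib sum_subtractf)
      have "a * cos u * (b * cos v) = a * b / 2 * cos (u - v) + a * b / 2 * cos (u + v)"
        by (simp add: cos_diff cos_add field_simps)
      then show "a * cos ((\<Sum>j<k. \<theta> j * x j) + c) * (b * cos ((\<Sum>j<k. \<eta> j * x j) + d))
        = a * b / 2 * cos ((\<Sum>j<k. (\<theta> j - \<eta> j) * x j) + (c - d)) + a * b / 2 * cos ((\<Sum>j<k. (\<theta> j + \<eta> j) * x j) + (c + d))"
        unfolding A B by (simp only: u_def v_def)
    qed
    then show ?case by (simp only:) (intro trig_poly.add trig_poly.cos)
  next
    case (add f g)
    then show ?case by (simp only: distrib_left) (rule trig_poly.add)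
  qed
next
  case (add f1 f2)
  then show ?case by (simp only: distrib_right) (rule trig_poly.add)
qed

lemma trig_poly_const: "trig_poly k (\<lambda>x. c)"
  using trig_poly.cos[of k c "\<lambda>_. 0" 0] by simp

lemma trig_poly_sin:
  assumes "j < k"
  shows "trig_poly k (\<lambda>x. sin (x j / R))"
proof -
  have "(\<Sum>i<k. (if i = j then 1 / R else 0) * x i) = x j / R" for x :: "nat \<Rightarrow> real"
    using assms by (simp add: if_distrib[where f = "\<lambda>c. c * _"] cong: if_cong)
  then show ?thesis
    using trig_poly.cos[of k 1 "\<lambda>i. if i = j then 1 / R else 0" "- (pi / 2)"] by (simp add: cos_diff)
qed

text \<open>Pinning the coordinates from \<open>k\<close> on to 0 keeps the cube compact inside the
  functions on all naturals, with distinct points separated by the first \<open>k\<close>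
  coordinates.\<close>

lemma compact_finite_cube: "compact {s :: nat \<Rightarrow> real. \<forall>j. s j \<in> (if j < k then {-1..1} else {0})}"
proof -
  have "compactin (product_topology (\<lambda>_. euclidean) UNIV) (PiE UNIV (\<lambda>j. if j < k then {-1..1::real} else {0}))"
    unfolding compactin_PiE by auto
  then have "compact (PiE UNIV (\<lambda>j :: nat. if j < k then {-1..1::real} else {0}))"
    unfolding euclidean_product_topology compactin_euclidean_iff .
  then show ?thesis by (simp only: PiE_UNIV_domain Pi_def UNIV_I simp_thms)
qed

lemma abs_sin_diff_le: "\<bar>sin u - u\<bar> \<le> u\<^sup>2 / 2" for u :: real
proof -
  have "\<bar>Im (iexp u - (1 + \<i> * u))\<bar> \<le> cmod (iexp u - (1 + \<i> * u))" by (rule abs_Im_le_cmod)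
  also have "\<dots> \<le> u\<^sup>2 / 2" using iexp_approx1[of u 1] by (simp add: power2_eq_square)
  finally show ?thesis by (simp add: Im_exp)
qed

lemma trig_poly_cont: "trig_poly k f \<Longrightarrow> continuous_on UNIV f"
proof (induction rule: trig_poly.induct)
  case (cos a \<theta> c)
  have "continuous_on UNIV (\<lambda>x :: nat \<Rightarrow> real. x j)" for j
    by (rule continuous_on_product_coordinates)
  then show ?case by (intro continuous_intros) auto
qed (intro continuous_intros)

lemma trig_poly_bounded: "trig_poly k f \<Longrightarrow> \<exists>B. \<forall>x. \<bar>f x\<bar> \<le> B"
proof (induction rule: trig_poly.induct)
  case (cos a \<theta> c)
  then show ?case by (intro exI[of _ "\<bar>a\<bar>"]) (auto simp: abs_mult mult_left_le)
next
  case (add f g)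
  then obtain B C where "\<forall>x. \<bar>f x\<bar> \<le> B" "\<forall>x. \<bar>g x\<bar> \<le> C" by blast
  then show ?case by (intro exI[of _ "B + C"] allI order_trans[OF abs_triangle_ineq add_mono]) auto
qed

lemma (in prob_space) trig_poly_integrable:
  assumes f: "trig_poly k f" and Y: "\<And>j. (\<lambda>\<omega>. Y \<omega> j) \<in> borel_measurable M"
  shows "integrable M (\<lambda>\<omega>. f (Y \<omega>))"
proof -
  obtain B where "\<And>x. \<bar>f x\<bar> \<le> B" using trig_poly_bounded[OF f] by blast
  moreover have "(\<lambda>\<omega>. f (Y \<omega>)) \<in> borel_measurable M"
    by (rule measurable_compose[OF measurable_coordinatewise_then_product[OF Y]])
      (rule borel_measurable_continuous_onI[OF trig_poly_cont[OF f]])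
  ultimately show ?thesis by (intro integrable_const_bound[where B = B]) auto
qed

lemma (in prob_space) expectation_cos:
  assumes "X \<in> borel_measurable M"
  shows "(\<integral>\<omega>. cos (X \<omega> + c) \<partial>M) = Re (iexp c * (\<integral>\<omega>. iexp (X \<omega>) \<partial>M))"
proof -
  have "integrable M (\<lambda>\<omega>. iexp (X \<omega>))" using assms by (intro integrable_iexp) auto
  then have i: "integrable M (\<lambda>\<omega>. iexp c * iexp (X \<omega>))" by (rule integrable_mult_right)
  have "(\<integral>\<omega>. cos (X \<omega> + c) \<partial>M) = (\<integral>\<omega>. Re (iexp c * iexp (X \<omega>)) \<partial>M)"
    by (rule Bochner_Integration.integral_cong) (auto simp: exp_add[symmetric] Re_exp distrib_left[symmetric] add.commute)
  also have "\<dots> = Re (\<integral>\<omega>. iexp c * iexp (X \<omega>) \<partial>M)" by (rule integral_Re[OF i])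
  finally show ?thesis by simp
qed

lemma trig_poly_tendsto:
  assumes P: "\<And>n. prob_space (P n)" "\<And>n j. (\<lambda>\<omega>. Y n \<omega> j) \<in> borel_measurable (P n)"
    and Q: "prob_space Q" "\<And>j. (\<lambda>\<omega>. Z \<omega> j) \<in> borel_measurable Q"
    and char: "\<And>\<theta>. (\<lambda>n. \<integral>\<omega>. iexp (\<Sum>j<k. \<theta> j * Y n \<omega> j) \<partial>P n) \<longlonglongrightarrow> (\<integral>\<omega>. iexp (\<Sum>j<k. \<theta> j * Z \<omega> j) \<partial>Q)"
    and h: "trig_poly k h"
  shows "(\<lambda>n. \<integral>\<omega>. h (Y n \<omega>) \<partial>P n) \<longlonglongrightarrow> (\<integral>\<omega>. h (Z \<omega>) \<partial>Q)"
  using h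
proof induction
  case (cos a \<theta> c)
  have "(\<integral>\<omega>. a * cos ((\<Sum>j<k. \<theta> j * Y n \<omega> j) + c) \<partial>P n)
    = a * Re (iexp c * (\<integral>\<omega>. iexp (\<Sum>j<k. \<theta> j * Y n \<omega> j) \<partial>P n))" for n
    unfolding integral_mult_right_zero
    by (subst prob_space.expectation_cos[OF P(1)]) (use P(2) in auto)
  moreover have "(\<integral>\<omega>. a * cos ((\<Sum>j<k. \<theta> j * Z \<omega> j) + c) \<partial>Q)
    = a * Re (iexp c * (\<integral>\<omega>. iexp (\<Sum>j<k. \<theta> j * Z \<omega> j) \<partial>Q))"
    unfolding integral_mult_right_zero
    by (subst prob_space.expectation_cos[OF Q(1)]) (use Q(2) in auto)
  ultimately show ?case by (simp only:) (intro tendsto_intros char)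
next
  case (add f g)
  have "(\<integral>\<omega>. f (Y n \<omega>) + g (Y n \<omega>) \<partial>P n) = (\<integral>\<omega>. f (Y n \<omega>) \<partial>P n) + (\<integral>\<omega>. g (Y n \<omega>) \<partial>P n)" for n
    by (rule Bochner_Integration.integral_add)
      (rule prob_space.trig_poly_integrable[OF P(1) _ P(2)], rule add.hyps)+
  moreover have "(\<integral>\<omega>. f (Z \<omega>) + g (Z \<omega>) \<partial>Q) = (\<integral>\<omega>. f (Z \<omega>) \<partial>Q) + (\<integral>\<omega>. g (Z \<omega>) \<partial>Q)"
    by (rule Bochner_Integration.integral_add)
      (rule prob_space.trig_poly_integrable[OF Q(1) _ Q(2)], rule add.hyps)+
  ultimately show ?case using add by (simp add: tendsto_add)
qed

text \<open>Only finitely many coordinates matter, and each is continuous in the product topology.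
  The target is a general metric space so that step paths in the Skorohod space are covered
  too.\<close>

lemma lipschitz_coordinates_continuous:
  fixes G :: "(nat \<Rightarrow> real) \<Rightarrow> 'c::metric_space"
  assumes "\<And>x y. dist (G x) (G y) \<le> L * (\<Sum>j<k. \<bar>x j - y j\<bar>)"
  shows "continuous_on UNIV G"
  unfolding continuous_on_def
proof
  fix x :: "nat \<Rightarrow> real"
  have "((\<lambda>y :: nat \<Rightarrow> real. y j) \<longlongrightarrow> x j) (at x)" for j
  proof -
    have "continuous_on UNIV (\<lambda>y :: nat \<Rightarrow> real. y j)" by (rule continuous_on_product_coordinates)
    then show ?thesis by (simp add: continuous_on_def)
  qed
  then have "((\<lambda>y. L * (\<Sum>j<k. \<bar>y j - x j\<bar>)) \<longlongrightarrow> L * (\<Sum>j<k. \<bar>x j - x j\<bar>)) (at x)"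
    by (intro tendsto_intros)
  then have "((\<lambda>y. L * (\<Sum>j<k. \<bar>y j - x j\<bar>)) \<longlongrightarrow> 0) (at x)" by simp
  from real_tendsto_sandwich[OF _ _ tendsto_const this]
  have "((\<lambda>y. dist (G y) (G x)) \<longlongrightarrow> 0) (at x)"
    by (simp add: assms)
  then have "(G \<longlongrightarrow> G x) (at x)" by (rule tendsto_dist_iff[THEN iffD2])
  then show "(G \<longlongrightarrow> G x) (at x within UNIV)" .
qed

text \<open>Replacing each coordinate \<open>x j\<close> by \<open>R * sin (x j / R)\<close> costs at most a second moment over
  \<open>2 * R\<close>, and the resulting function of the bounded variables \<open>sin (x j / R)\<close> is uniformly close to
  a polynomial in them, that is, to a trigonometric polynomial in \<open>x\<close>.\<close>

lemma trig_poly_approx: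
  fixes G :: "(nat \<Rightarrow> real) \<Rightarrow> real"
  assumes lip: "\<And>x y. \<bar>G x - G y\<bar> \<le> L * (\<Sum>j<k. \<bar>x j - y j\<bar>)" and R: "0 < R" and \<epsilon>: "0 < \<epsilon>" and L: "0 \<le> L"
  obtains h where "trig_poly k h" "\<And>x. \<bar>G x - h x\<bar> \<le> \<epsilon> + L * (\<Sum>j<k. (x j)\<^sup>2) / (2 * R)"
proof -
  define S where "S = {s :: nat \<Rightarrow> real. \<forall>j. s j \<in> (if j < k then {-1..1} else {0})}"
  define s where "s x j = (if j < k then sin (x j / R) else 0)" for x :: "nat \<Rightarrow> real" and j
  define g where "g y = G (\<lambda>j. R * y j)" for y
  have sS: "s x \<in> S" for x by (simp add: S_def s_def)
  \<comment> \<open>The Stone-Weierstrass algebra consists of the continuous functions on the cube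
    whose pullback along \<open>s\<close> is a trigonometric polynomial. It contains the
    coordinates, which pull back to sines.\<close>
  have "\<exists>q. (continuous_on S q \<and> trig_poly k (\<lambda>x. q (s x))) \<and> (\<forall>y\<in>S. \<bar>g y - q y\<bar> < \<epsilon>)"
  proof (rule Stone_Weierstrass_HOL)
    show "compact S" unfolding S_def by (rule compact_finite_cube)
    show "continuous_on S (\<lambda>x. c) \<and> trig_poly k (\<lambda>x. c)" for c by (simp add: trig_poly_const)
    fix f h :: "(nat \<Rightarrow> real) \<Rightarrow> real"
    assume fh: "(continuous_on S f \<and> trig_poly k (\<lambda>x. f (s x))) \<and> (continuous_on S h \<and> trig_poly k (\<lambda>x. h (s x)))"
    then show "continuous_on S (\<lambda>x. f x + h x) \<and> trig_poly k (\<lambda>x. f (s x) + h (s x))"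
      by (auto intro: continuous_intros trig_poly.add)
    show "continuous_on S (\<lambda>x. f x * h x) \<and> trig_poly k (\<lambda>x. f (s x) * h (s x))"
      using fh by (auto intro: continuous_intros trig_poly_mult)
  next
    fix x y assume xy: "x \<in> S \<and> y \<in> S \<and> x \<noteq> y"
    then obtain j where j: "x j \<noteq> y j" by blast
    moreover have "j < k"
    proof (rule ccontr)
      assume "\<not> j < k"
      moreover have "x j \<in> (if j < k then {-1..1} else {0})" "y j \<in> (if j < k then {-1..1} else {0})"
        using xy unfolding S_def by blast+
      ultimately show False using j by simp
    qed
    moreover have "continuous_on S (\<lambda>y :: nat \<Rightarrow> real. y j)"
      by (rule continuous_on_subset[OF continuous_on_product_coordinates]) simp
    ultimately show "\<exists>f. (continuous_on S f \<and> trig_poly k (\<lambda>x. f (s x))) \<and> f x \<noteq> f y"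
      by (intro exI[of _ "\<lambda>y. y j"]) (simp add: s_def trig_poly_sin)
  next
    have "dist (g x) (g y) \<le> (L * R) * (\<Sum>j<k. \<bar>x j - y j\<bar>)" for x y
      using lip[of "\<lambda>j. R * x j" "\<lambda>j. R * y j"] R
      by (simp add: g_def dist_real_def right_diff_distrib[symmetric] abs_mult sum_distrib_left[symmetric] mult.assoc)
    then have "continuous_on UNIV g" by (rule lipschitz_coordinates_continuous)
    then show "continuous_on S g" by (rule continuous_on_subset) simp
  qed (use \<epsilon> in auto)
  then obtain q where q: "trig_poly k (\<lambda>x. q (s x))" "\<And>y. y \<in> S \<Longrightarrow> \<bar>g y - q y\<bar> < \<epsilon>" by blast
  have "\<bar>G x - q (s x)\<bar> \<le> \<epsilon> + L * (\<Sum>j<k. (x j)\<^sup>2) / (2 * R)" for x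
  proof -
    have "\<bar>G x - g (s x)\<bar> \<le> L * (\<Sum>j<k. \<bar>x j - R * s x j\<bar>)" unfolding g_def by (rule lip)
    also have "\<dots> \<le> L * (\<Sum>j<k. (x j)\<^sup>2 / (2 * R))"
    proof (intro mult_left_mono sum_mono L)
      fix j assume "j \<in> {..<k}"
      then have "x j - R * s x j = - (R * (sin (x j / R) - x j / R))" using R by (simp add: s_def right_diff_distrib)
      then have "\<bar>x j - R * s x j\<bar> = R * \<bar>sin (x j / R) - x j / R\<bar>" using R by (simp add: abs_mult)
      also have "\<dots> \<le> R * ((x j / R)\<^sup>2 / 2)" using R by (intro mult_left_mono abs_sin_diff_le) auto
      also have "\<dots> = (x j)\<^sup>2 / (2 * R)" using R by (simp add: power_divide power2_eq_square)
      finally show "\<bar>x j - R * s x j\<bar> \<le> (x j)\<^sup>2 / (2 * R)" .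
    qed
    also have "\<dots> = L * (\<Sum>j<k. (x j)\<^sup>2) / (2 * R)" by (simp add: sum_divide_distrib[symmetric])
    finally show ?thesis using q(2)[OF sS[of x]] by linarith
  qed
  with q(1) show ?thesis by (rule that)
qed

lemma expectation_diff_le:
  fixes G h :: "(nat \<Rightarrow> real) \<Rightarrow> real"
  assumes P: "prob_space P" "\<And>j. (\<lambda>\<omega>. Y \<omega> j) \<in> borel_measurable P"
    and sq: "\<And>j. j < k \<Longrightarrow> integrable P (\<lambda>\<omega>. (Y \<omega> j)\<^sup>2)" "\<And>j. j < k \<Longrightarrow> (\<integral>\<omega>. (Y \<omega> j)\<^sup>2 \<partial>P) \<le> C"
    and f: "integrable P (\<lambda>\<omega>. G (Y \<omega>))" "integrable P (\<lambda>\<omega>. h (Y \<omega>))"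
    and le: "\<And>x. \<bar>G x - h x\<bar> \<le> \<epsilon> + L * (\<Sum>j<k. (x j)\<^sup>2) / (2 * R)" and R: "0 < R" and L: "0 \<le> L"
  shows "\<bar>(\<integral>\<omega>. G (Y \<omega>) \<partial>P) - (\<integral>\<omega>. h (Y \<omega>) \<partial>P)\<bar> \<le> \<epsilon> + L * (k * C) / (2 * R)"
proof -
  interpret prob_space P by (rule P)
  have "\<bar>(\<integral>\<omega>. G (Y \<omega>) \<partial>P) - (\<integral>\<omega>. h (Y \<omega>) \<partial>P)\<bar> = \<bar>\<integral>\<omega>. G (Y \<omega>) - h (Y \<omega>) \<partial>P\<bar>"
    using f by simp
  also have "\<dots> \<le> (\<integral>\<omega>. \<bar>G (Y \<omega>) - h (Y \<omega>)\<bar> \<partial>P)" by (rule integral_abs_bound)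
  also have "\<dots> \<le> (\<integral>\<omega>. \<epsilon> + L * (\<Sum>j<k. (Y \<omega> j)\<^sup>2) / (2 * R) \<partial>P)"
  proof (intro integral_mono le)
    show "integrable P (\<lambda>\<omega>. \<bar>G (Y \<omega>) - h (Y \<omega>)\<bar>)"
      using f by (intro integrable_abs Bochner_Integration.integrable_diff)
    show "integrable P (\<lambda>\<omega>. \<epsilon> + L * (\<Sum>j<k. (Y \<omega> j)\<^sup>2) / (2 * R))"
      by (intro Bochner_Integration.integrable_add integrable_const Bochner_Integration.integrable_divide
          integrable_mult_right Bochner_Integration.integrable_sum sq(1)) auto
  qed
  also have "\<dots> = \<epsilon> + L * (\<Sum>j<k. (\<integral>\<omega>. (Y \<omega> j)\<^sup>2 \<partial>P)) / (2 * R)"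
  proof -
    have S: "integrable P (\<lambda>\<omega>. \<Sum>j<k. (Y \<omega> j)\<^sup>2)"
      by (intro Bochner_Integration.integrable_sum sq(1)) auto
    have "(\<integral>\<omega>. (\<Sum>j<k. (Y \<omega> j)\<^sup>2) \<partial>P) = (\<Sum>j<k. (\<integral>\<omega>. (Y \<omega> j)\<^sup>2 \<partial>P))"
      by (intro Bochner_Integration.integral_sum sq(1)) auto
    with S show ?thesis
      by (subst Bochner_Integration.integral_add) (auto simp: prob_space)
  qed
  also have "\<dots> \<le> \<epsilon> + L * (\<Sum>j<k. C) / (2 * R)"
    using R L sq by (intro add_left_mono divide_right_mono mult_left_mono sum_mono) auto
  finally show ?thesis by simp
qed

text \<open>A continuity theorem in \<open>k\<close> variables. The uniform second moments take the
  place of tightness: they make the passage to sines cheap on average, uniformly in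
  \<open>n\<close>.\<close>

lemma lipschitz_tendsto_of_char:
  fixes G :: "(nat \<Rightarrow> real) \<Rightarrow> real"
  assumes P: "\<And>n. prob_space (P n)" "\<And>n j. (\<lambda>\<omega>. Y n \<omega> j) \<in> borel_measurable (P n)"
    and Q: "prob_space Q" "\<And>j. (\<lambda>\<omega>. Z \<omega> j) \<in> borel_measurable Q"
    and char: "\<And>\<theta>. (\<lambda>n. \<integral>\<omega>. iexp (\<Sum>j<k. \<theta> j * Y n \<omega> j) \<partial>P n) \<longlonglongrightarrow> (\<integral>\<omega>. iexp (\<Sum>j<k. \<theta> j * Z \<omega> j) \<partial>Q)"
    and sqP: "\<And>n j. j < k \<Longrightarrow> integrable (P n) (\<lambda>\<omega>. (Y n \<omega> j)\<^sup>2)" "\<And>n j. j < k \<Longrightarrow> (\<integral>\<omega>. (Y n \<omega> j)\<^sup>2 \<partial>P n) \<le> C"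
    and sqQ: "\<And>j. j < k \<Longrightarrow> integrable Q (\<lambda>\<omega>. (Z \<omega> j)\<^sup>2)" "\<And>j. j < k \<Longrightarrow> (\<integral>\<omega>. (Z \<omega> j)\<^sup>2 \<partial>Q) \<le> C"
    and G: "\<And>x. \<bar>G x\<bar> \<le> B" and lip: "\<And>x y. \<bar>G x - G y\<bar> \<le> L * (\<Sum>j<k. \<bar>x j - y j\<bar>)" and L: "0 \<le> L"
  shows "(\<lambda>n. \<integral>\<omega>. G (Y n \<omega>) \<partial>P n) \<longlonglongrightarrow> (\<integral>\<omega>. G (Z \<omega>) \<partial>Q)"
proof (rule LIMSEQ_I)
  fix r :: real assume r: "0 < r"
  \<comment> \<open>Chosen to make the error of the sines at most \<open>r / 8\<close>; the maximum
    with 1 ensures positivity. The total error then stays below 5 r / 8.\<close>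
  define R where "R = max 1 (4 * (L * (k * C)) / r)"
  have R: "0 < R" "L * (k * C) / (2 * R) \<le> r / 8"
  proof -
    show "0 < R" by (simp add: R_def)
    moreover have "4 * (L * (k * C)) / r \<le> R" unfolding R_def by (rule max.cobounded2)
    ultimately show "L * (k * C) / (2 * R) \<le> r / 8" using r by (simp add: field_simps)
  qed
  have r8: "0 < r / 8" using r by simp
  obtain h where h: "trig_poly k h" "\<And>x. \<bar>G x - h x\<bar> \<le> r / 8 + L * (\<Sum>j<k. (x j)\<^sup>2) / (2 * R)"
    using trig_poly_approx[OF lip R(1) r8 L] by blast
  have Gc: "continuous_on UNIV G"
    by (rule lipschitz_coordinates_continuous[where L = L and k = k]) (use lip in \<open>simp add: dist_real_def\<close>)
  have GiP: "integrable M (\<lambda>\<omega>. G (W \<omega>))"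
    if "prob_space M" "\<And>j. (\<lambda>\<omega>. W \<omega> j) \<in> borel_measurable M" for M :: "'x measure" and W
    by (rule finite_measure.integrable_const_bound[where B = B, OF prob_space.finite_measure[OF that(1)]])
      (use G measurable_compose[OF measurable_coordinatewise_then_product[OF that(2)] borel_measurable_continuous_onI[OF Gc]] in auto)
  have dP: "\<bar>(\<integral>\<omega>. G (Y n \<omega>) \<partial>P n) - (\<integral>\<omega>. h (Y n \<omega>) \<partial>P n)\<bar> \<le> r / 8 + r / 8" for n
    using expectation_diff_le[where Y = "Y n" and k = k, OF P(1)[of n] P(2) sqP GiP[OF P(1)[of n] P(2)] prob_space.trig_poly_integrable[OF P(1)[of n] h(1) P(2)] h(2) R(1) L] R(2)
    by linarith
  have dQ: "\<bar>(\<integral>\<omega>. G (Z \<omega>) \<partial>Q) - (\<integral>\<omega>. h (Z \<omega>) \<partial>Q)\<bar> \<le> r / 8 + r / 8"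
    using expectation_diff_le[where Y = Z and k = k, OF Q sqQ GiP[OF Q] prob_space.trig_poly_integrable[OF Q(1) h(1) Q(2)] h(2) R(1) L] R(2)
    by linarith
  have "(\<lambda>n. \<integral>\<omega>. h (Y n \<omega>) \<partial>P n) \<longlonglongrightarrow> (\<integral>\<omega>. h (Z \<omega>) \<partial>Q)"
    by (rule trig_poly_tendsto[OF P Q char h(1)])
  then obtain N where N: "\<And>n. n \<ge> N \<Longrightarrow> norm ((\<integral>\<omega>. h (Y n \<omega>) \<partial>P n) - (\<integral>\<omega>. h (Z \<omega>) \<partial>Q)) < r / 8"
    using LIMSEQ_D[OF _ r8] by blast
  have "norm ((\<integral>\<omega>. G (Y n \<omega>) \<partial>P n) - (\<integral>\<omega>. G (Z \<omega>) \<partial>Q)) < r" if "n \<ge> N" for n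
    using N[OF that] dP[of n] dQ r unfolding real_norm_def by linarith
  then show "\<exists>N. \<forall>n\<ge>N. norm ((\<integral>\<omega>. G (Y n \<omega>) \<partial>P n) - (\<integral>\<omega>. G (Z \<omega>) \<partial>Q)) < r" by blast
qed


section \<open>Step paths\<close>

text \<open>The identity is an admissible time change. The proof passes to \<open>e + d\<close>
  because members of \<open>skorohod_close\<close> are positive, while \<open>e\<close> may be
  0.\<close>

lemma dist_cadlag_path_le:
  assumes "cadlag_on_unit x" "cadlag_on_unit y" "0 \<le> e" "\<And>t. t \<in> {0..1} \<Longrightarrow> \<bar>x t - y t\<bar> \<le> e"
  shows "dist (cadlag_path x) (cadlag_path y) \<le> e"
proof (rule field_le_epsilon)
  fix d :: real assume d: "0 < d"
  have "e + d \<in> skorohod_close (cadlag_fun (cadlag_path x)) (cadlag_fun (cadlag_path y))"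
    unfolding skorohod_close_def
  proof (intro CollectI conjI bexI[OF _ time_changes_id] ballI)
    fix t :: real assume t: "t \<in> {0..1}"
    show "\<bar>cadlag_fun (cadlag_path x) t - cadlag_fun (cadlag_path y) (id t)\<bar> \<le> e + d"
      using assms(4)[OF t] t d by (simp add: cadlag_fun_path assms(1,2))
  qed (use assms(3) d in auto)
  then show "dist (cadlag_path x) (cadlag_path y) \<le> e + d"
    unfolding dist_cadlag_def by (rule cInf_lower[OF _ skorohod_close_bdd])
qed

definition step_path :: "nat \<Rightarrow> (nat \<Rightarrow> real) \<Rightarrow> real \<Rightarrow> real" where
  "step_path m y t = y (nat \<lfloor>real m * t\<rfloor>)"

lemma cadlag_on_unit_step_path:
  assumes m: "0 < m"
  shows "cadlag_on_unit (step_path m y)"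
  unfolding cadlag_on_unit_def
proof (intro conjI ballI)
  fix t :: real assume "t \<in> {0..<1}"
  have "((\<lambda>s. real m * s) \<longlongrightarrow> real m * t) (at t within {t<..1})" by (intro tendsto_intros)
  then have "\<forall>\<^sub>F s in at t within {t<..1}. real m * s < real_of_int \<lfloor>real m * t\<rfloor> + 1"
    by (rule order_tendstoD) linarith
  moreover have "\<forall>\<^sub>F s in at t within {t<..1}. t < s" by (simp add: eventually_at_filter)
  ultimately have "\<forall>\<^sub>F s in at t within {t<..1}. step_path m y s = step_path m y t"
  proof eventually_elim
    case (elim s)
    then have "real m * t \<le> real m * s" by (simp add: mult_left_mono)
    then have "\<lfloor>real m * s\<rfloor> = \<lfloor>real m * t\<rfloor>" using elim by linarith
    then show ?case by (simp add: step_path_def)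
  qed
  then show "(step_path m y \<longlongrightarrow> step_path m y t) (at t within {t<..1})" by (rule tendsto_eventually)
next
  fix t :: real assume "t \<in> {0<..1}"
  have "((\<lambda>s. real m * s) \<longlongrightarrow> real m * t) (at t within {0..<t})" by (intro tendsto_intros)
  then have "\<forall>\<^sub>F s in at t within {0..<t}. real_of_int (\<lceil>real m * t\<rceil> - 1) < real m * s"
    by (rule order_tendstoD) linarith
  moreover have "\<forall>\<^sub>F s in at t within {0..<t}. s < t" by (simp add: eventually_at_filter)
  ultimately have "\<forall>\<^sub>F s in at t within {0..<t}. step_path m y s = y (nat (\<lceil>real m * t\<rceil> - 1))"
  proof eventually_elim
    case (elim s)
    then have "real m * s < real m * t" using m by simp
    then have "\<lfloor>real m * s\<rfloor> = \<lceil>real m * t\<rceil> - 1" using elim by linarith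
    then show ?case by (simp add: step_path_def)
  qed
  then show "\<exists>l. (step_path m y \<longlongrightarrow> l) (at t within {0..<t})" by (blast intro: tendsto_eventually)
qed

lemma floor_grid:
  assumes "0 < m" "t \<in> {0..1}"
  shows "nat \<lfloor>real m * t\<rfloor> < Suc m" "real (nat \<lfloor>real m * t\<rfloor>) / m \<in> {0..1}"
    "\<bar>real (nat \<lfloor>real m * t\<rfloor>) / m - t\<bar> \<le> 1 / m"
proof -
  have "0 \<le> real m * t" "real m * t \<le> m" using assms by (auto intro: mult_left_le)
  then have i: "real (nat \<lfloor>real m * t\<rfloor>) \<le> real m * t" "real m * t \<le> real (nat \<lfloor>real m * t\<rfloor>) + 1"
    "real (nat \<lfloor>real m * t\<rfloor>) \<le> m" by linarith+
  then show "nat \<lfloor>real m * t\<rfloor> < Suc m" by linarith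
  show "real (nat \<lfloor>real m * t\<rfloor>) / m \<in> {0..1}" using i(3) assms(1) by simp
  define i' where "i' = real (nat \<lfloor>real m * t\<rfloor>)"
  have "i' / m - t = (i' - m * t) / m" using assms(1) by (simp add: field_simps)
  moreover have "\<bar>i' - m * t\<bar> \<le> 1"
    using i(1,2) unfolding i'_def[symmetric] by (simp add: abs_le_iff)
  ultimately show "\<bar>real (nat \<lfloor>real m * t\<rfloor>) / m - t\<bar> \<le> 1 / m"
    unfolding i'_def[symmetric] by (simp add: abs_divide divide_right_mono)
qed

text \<open>A maximum of coordinate differences is at most their sum. There are \<open>Suc m\<close>
  values because the time 1 has its own index \<open>m\<close>.\<close>

lemma dist_step_path_le:
  assumes "0 < m"
  shows "dist (cadlag_path (step_path m x)) (cadlag_path (step_path m y)) \<le> (\<Sum>j<Suc m. \<bar>x j - y j\<bar>)"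
proof (rule dist_cadlag_path_le)
  fix t :: real assume t: "t \<in> {0..1}"
  show "\<bar>step_path m x t - step_path m y t\<bar> \<le> (\<Sum>j<Suc m. \<bar>x j - y j\<bar>)"
    unfolding step_path_def
    by (rule member_le_sum[where f = "\<lambda>j. \<bar>x j - y j\<bar>"]) (use floor_grid(1)[OF assms t] in auto)
qed (auto intro: cadlag_on_unit_step_path assms sum_nonneg simp del: sum.lessThan_Suc)

section \<open>The limit process\<close>

lemma normal_variable_facts:
  assumes M: "prob_space M" and Y: "normal_variable M Y"
  shows "integrable M Y" "integrable M (\<lambda>\<omega>. (Y \<omega>)\<^sup>2)"
    "(\<integral>\<omega>. Y \<omega> \<partial>M) = 0 \<Longrightarrow> (\<integral>\<omega>. iexp (Y \<omega>) \<partial>M) = of_real (exp (- (\<integral>\<omega>. (Y \<omega>)\<^sup>2 \<partial>M) / 2))"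
proof -
  interpret prob_space M by (rule M)
  have meas: "Y \<in> borel_measurable M" using Y by (simp add: normal_variable_def)
  obtain \<mu> where "(AE \<omega> in M. Y \<omega> = \<mu>) \<or> (\<exists>\<sigma>>0. distributed M lborel Y (normal_density \<mu> \<sigma>))"
    using Y by (auto simp: normal_variable_def)
  then have "integrable M Y \<and> integrable M (\<lambda>\<omega>. (Y \<omega>)\<^sup>2) \<and> ((\<integral>\<omega>. Y \<omega> \<partial>M) = 0 \<longrightarrow>
    (\<integral>\<omega>. iexp (Y \<omega>) \<partial>M) = of_real (exp (- (\<integral>\<omega>. (Y \<omega>)\<^sup>2 \<partial>M) / 2)))"
  proof (elim disjE exE conjE)
    assume ae: "AE \<omega> in M. Y \<omega> = \<mu>"
    have c: "integral\<^sup>L M (\<lambda>\<omega>. g (Y \<omega>)) = g \<mu>" and i: "integrable M (\<lambda>\<omega>. g (Y \<omega>))"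
      if [measurable]: "g \<in> borel_measurable borel" for g :: "real \<Rightarrow> 'x::{banach, second_countable_topology}"
    proof -
      note [measurable] = meas
      have "integral\<^sup>L M (\<lambda>\<omega>. g (Y \<omega>)) = integral\<^sup>L M (\<lambda>\<omega>. g \<mu>)"
        by (rule integral_cong_AE) (use ae in auto)
      then show "integral\<^sup>L M (\<lambda>\<omega>. g (Y \<omega>)) = g \<mu>" by (simp add: prob_space)
      have "integrable M (\<lambda>\<omega>. g (Y \<omega>)) \<longleftrightarrow> integrable M (\<lambda>\<omega>. g \<mu>)"
        by (rule integrable_cong_AE) (use ae in auto)
      then show "integrable M (\<lambda>\<omega>. g (Y \<omega>))" by simp
    qed
    have "(\<lambda>x. iexp x) \<in> borel_measurable borel" by measurable
    then show ?thesis
      using c[of "\<lambda>x. x"] c[of "\<lambda>x. x\<^sup>2"] c[of iexp] i[of "\<lambda>x. x"] i[of "\<lambda>x. x\<^sup>2"] by simp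
  next
    fix \<sigma> :: real assume \<sigma>: "0 < \<sigma>" and D: "distributed M lborel Y (normal_density \<mu> \<sigma>)"
    have int: "integrable M (\<lambda>\<omega>. (Y \<omega> - \<mu>) ^ k)" for k
      using integrable_normal_moment[OF \<sigma>, of \<mu> k]
      by (subst distributed_integrable[OF D, symmetric]) auto
    have i1: "integrable M Y"
      using Bochner_Integration.integrable_add[OF int[of 1] integrable_const[of \<mu>]] by simp
    have "integrable M (\<lambda>\<omega>. (Y \<omega> - \<mu>) ^ 2 + 2 * \<mu> * Y \<omega> - \<mu>\<^sup>2)"
      by (intro Bochner_Integration.integrable_diff Bochner_Integration.integrable_add int i1
          integrable_mult_right integrable_const)
    moreover have "(\<lambda>\<omega>. (Y \<omega> - \<mu>) ^ 2 + 2 * \<mu> * Y \<omega> - \<mu>\<^sup>2) = (\<lambda>\<omega>. (Y \<omega>)\<^sup>2)"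
      by (simp add: fun_eq_iff power2_eq_square algebra_simps)
    ultimately have i2: "integrable M (\<lambda>\<omega>. (Y \<omega>)\<^sup>2)" by simp
    have "(\<integral>\<omega>. iexp (Y \<omega>) \<partial>M) = of_real (exp (- (\<integral>\<omega>. (Y \<omega>)\<^sup>2 \<partial>M) / 2))" if "(\<integral>\<omega>. Y \<omega> \<partial>M) = 0"
    proof -
      have \<mu>: "\<mu> = 0" using normal_distributed_expectation[OF \<sigma> D] that by simp
      have v: "(\<integral>\<omega>. (Y \<omega>)\<^sup>2 \<partial>M) = \<sigma>\<^sup>2" using normal_distributed_variance[OF \<sigma> D] that by simp
      have "distributed M lborel (\<lambda>\<omega>. Y \<omega> / \<sigma>) std_normal_density"
        using D normal_standard_normal_convert[OF \<sigma>, of Y \<mu>] by (simp add: \<mu>)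
      then have d: "distr M lborel (\<lambda>\<omega>. Y \<omega> / \<sigma>) = std_normal_distribution"
        by (simp add: distributed_distr_eq_density)
      have "(\<integral>\<omega>. iexp (Y \<omega>) \<partial>M) = (\<integral>\<omega>. iexp (\<sigma> * (Y \<omega> / \<sigma>)) \<partial>M)" using \<sigma> by simp
      also have "\<dots> = (\<integral>x. iexp (\<sigma> * x) \<partial>distr M lborel (\<lambda>\<omega>. Y \<omega> / \<sigma>))"
        using meas by (subst integral_distr) auto
      also have "\<dots> = char std_normal_distribution \<sigma>" unfolding d char_def ..
      finally show ?thesis by (simp add: char_std_normal_distribution v)
    qed
    then show ?thesis using i1 i2 by blast
  qed
  then show "integrable M Y" "integrable M (\<lambda>\<omega>. (Y \<omega>)\<^sup>2)"
    "(\<integral>\<omega>. Y \<omega> \<partial>M) = 0 \<Longrightarrow> (\<integral>\<omega>. iexp (Y \<omega>) \<partial>M) = of_real (exp (- (\<integral>\<omega>. (Y \<omega>)\<^sup>2 \<partial>M) / 2))"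
    by blast+
qed

context
  fixes M :: "'v measure" and Z :: "real \<Rightarrow> 'v \<Rightarrow> real"
  assumes Z: "limit_process M Z"
begin

lemma limit_process_prob_space: "prob_space M"
  using Z by (simp add: limit_process_def gaussian_process_def)

lemma limit_process_measurable: "t \<in> {0..1} \<Longrightarrow> Z t \<in> borel_measurable M"
  using Z unfolding limit_process_def gaussian_process_def by blast

lemma limit_process_normal: "finite F \<Longrightarrow> F \<subseteq> {0..1} \<Longrightarrow> normal_variable M (\<lambda>\<omega>. \<Sum>t\<in>F. a t * Z t \<omega>)"
  using Z unfolding limit_process_def gaussian_process_def by blast

lemma limit_process_square_integrable:
  assumes "t \<in> {0..1}"
  shows "integrable M (Z t)" "integrable M (\<lambda>\<omega>. (Z t \<omega>)\<^sup>2)"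
  using normal_variable_facts(1,2)[OF limit_process_prob_space limit_process_normal[of "{t}" "\<lambda>_. 1"]] assms
  by simp_all

lemma limit_process_cov:
  assumes "s \<in> {0..1}" "t \<in> {0..1}"
  shows "(\<integral>\<omega>. Z s \<omega> * Z t \<omega> \<partial>M) = limit_cov s t"
proof -
  have c: "(\<integral>\<omega>. Z s \<omega> * Z t \<omega> \<partial>M) = s\<^sup>2 * (1 - t)\<^sup>2" if "0 \<le> s" "s \<le> t" "t \<le> 1" for s t
    using Z that unfolding limit_process_def by blast
  show ?thesis
  proof (cases "s \<le> t")
    case True
    then show ?thesis using c[of s t] assms by (simp add: limit_cov_def min_absorb1 max_absorb2)
  next
    case False
    then show ?thesis using c[of t s] assms by (simp add: limit_cov_def min_absorb2 max_absorb1 mult.commute)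
  qed
qed

lemma limit_process_mult_integrable:
  assumes "s \<in> {0..1}" "t \<in> {0..1}"
  shows "integrable M (\<lambda>\<omega>. Z s \<omega> * Z t \<omega>)"
proof (rule Bochner_Integration.integrable_bound)
  show "integrable M (\<lambda>\<omega>. (Z s \<omega>)\<^sup>2 + (Z t \<omega>)\<^sup>2)"
    by (intro Bochner_Integration.integrable_add limit_process_square_integrable assms)
  show "(\<lambda>\<omega>. Z s \<omega> * Z t \<omega>) \<in> borel_measurable M"
    using limit_process_measurable assms by (intro borel_measurable_times)
  have "\<bar>x * y\<bar> \<le> x\<^sup>2 + y\<^sup>2" for x y :: real
  proof -
    have "2 * (\<bar>x\<bar> * \<bar>y\<bar>) \<le> x\<^sup>2 + y\<^sup>2"
      using sum_squares_bound[of "\<bar>x\<bar>" "\<bar>y\<bar>"] by (simp add: mult.assoc)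
    moreover have "0 \<le> \<bar>x\<bar> * \<bar>y\<bar>" by simp
    ultimately show ?thesis unfolding abs_mult by linarith
  qed
  then show "AE \<omega> in M. norm (Z s \<omega> * Z t \<omega>) \<le> norm ((Z s \<omega>)\<^sup>2 + (Z t \<omega>)\<^sup>2)" by simp
qed

text \<open>\<open>gaussian_process\<close> speaks of sums over sets of times. Injectivity lets the
  indexed family be rewritten as such a sum.\<close>

lemma limit_process_char:
  fixes t :: "nat \<Rightarrow> real"
  assumes inj: "inj_on t {..<k}" and t: "\<And>j. j < k \<Longrightarrow> t j \<in> {0..1}"
  shows "(\<integral>\<omega>. iexp (\<Sum>j<k. \<theta> j * Z (t j) \<omega>) \<partial>M)
    = of_real (exp (- (\<Sum>i<k. \<Sum>j<k. \<theta> i * \<theta> j * limit_cov (t i) (t j)) / 2))"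
proof -
  interpret prob_space M by (rule limit_process_prob_space)
  let ?Y = "\<lambda>\<omega>. \<Sum>j<k. \<theta> j * Z (t j) \<omega>"
  define a where "a = \<theta> \<circ> inv_into {..<k} t"
  have "(\<lambda>\<omega>. \<Sum>s\<in>t ` {..<k}. a s * Z s \<omega>) = ?Y"
    by (rule ext, subst sum.reindex[OF inj]) (auto simp: a_def inv_into_f_f[OF inj] intro!: sum.cong)
  moreover have "normal_variable M (\<lambda>\<omega>. \<Sum>s\<in>t ` {..<k}. a s * Z s \<omega>)"
    using t by (intro limit_process_normal) auto
  ultimately have N: "normal_variable M ?Y" by simp
  have mean0: "(\<integral>\<omega>. Z s \<omega> \<partial>M) = 0" if "s \<in> {0..1}" for s
    using Z that unfolding limit_process_def by blast
  have "(\<integral>\<omega>. ?Y \<omega> \<partial>M) = (\<Sum>j<k. (\<integral>\<omega>. \<theta> j * Z (t j) \<omega> \<partial>M))"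
    by (intro Bochner_Integration.integral_sum integrable_mult_right limit_process_square_integrable(1) t) auto
  also have "\<dots> = 0" by (intro sum.neutral) (auto simp: mean0[OF t])
  finally have mean: "(\<integral>\<omega>. ?Y \<omega> \<partial>M) = 0" .
  have "(\<integral>\<omega>. (?Y \<omega>)\<^sup>2 \<partial>M) = (\<integral>\<omega>. (\<Sum>i<k. \<Sum>j<k. \<theta> i * \<theta> j * (Z (t i) \<omega> * Z (t j) \<omega>)) \<partial>M)"
    unfolding power2_eq_square sum_product by (intro Bochner_Integration.integral_cong refl sum.cong) (simp add: mult_ac)
  also have "\<dots> = (\<Sum>i<k. (\<integral>\<omega>. (\<Sum>j<k. \<theta> i * \<theta> j * (Z (t i) \<omega> * Z (t j) \<omega>)) \<partial>M))"
    by (intro Bochner_Integration.integral_sum Bochner_Integration.integrable_sum integrable_mult_right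
        limit_process_mult_integrable t) auto
  also have "\<dots> = (\<Sum>i<k. \<Sum>j<k. (\<integral>\<omega>. \<theta> i * \<theta> j * (Z (t i) \<omega> * Z (t j) \<omega>) \<partial>M))"
    by (intro sum.cong refl Bochner_Integration.integral_sum integrable_mult_right
        limit_process_mult_integrable t) auto
  also have "\<dots> = (\<Sum>i<k. \<Sum>j<k. \<theta> i * \<theta> j * limit_cov (t i) (t j))"
    by (intro sum.cong refl) (simp add: limit_process_cov[OF t t])
  finally show ?thesis
    using normal_variable_facts(3)[OF limit_process_prob_space N mean] by (simp only:)
qed

lemma limit_process_continuous: "\<omega> \<in> space M \<Longrightarrow> continuous_on {0..1} (\<lambda>t. Z t \<omega>)"
  using Z unfolding limit_process_def by blast

text \<open>Nothing is known about \<open>Z\<close> beyond time 1; the default 0 makes all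
  coordinates measurable.\<close>

definition grid_values :: "nat \<Rightarrow> 'v \<Rightarrow> nat \<Rightarrow> real" where
  "grid_values m \<omega> j = (if j < Suc m then Z (real j / real m) \<omega> else 0)"

lemma grid_time: "j < Suc m \<Longrightarrow> 0 < m \<Longrightarrow> real j / real m \<in> {0..1}"
  by simp

lemma grid_values_measurable:
  assumes "0 < m"
  shows "(\<lambda>\<omega>. grid_values m \<omega> j) \<in> borel_measurable M"
  using limit_process_measurable[OF grid_time[OF _ assms], of j] by (cases "j < Suc m") (simp_all add: grid_values_def)

lemma step_path_grid_tendsto:
  assumes \<omega>: "\<omega> \<in> space M"
  shows "(\<lambda>m. cadlag_path (step_path (Suc m) (grid_values (Suc m) \<omega>))) \<longlonglongrightarrow> cadlag_path (\<lambda>t. Z t \<omega>)"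
proof (rule metric_LIMSEQ_I)
  fix r :: real assume r: "0 < r"
  have "uniformly_continuous_on {0..1} (\<lambda>t. Z t \<omega>)"
    by (rule compact_uniformly_continuous[OF limit_process_continuous[OF \<omega>]]) simp
  then obtain d where d: "0 < d" "\<And>s t. s \<in> {0..1} \<Longrightarrow> t \<in> {0..1} \<Longrightarrow> dist t s < d \<Longrightarrow> dist (Z t \<omega>) (Z s \<omega>) < r / 2"
    using r unfolding uniformly_continuous_on_def by (metis half_gt_zero)
  obtain m0 :: nat where m0: "1 / d < real m0" using reals_Archimedean2 by blast
  have "dist (cadlag_path (step_path (Suc m) (grid_values (Suc m) \<omega>))) (cadlag_path (\<lambda>t. Z t \<omega>)) < r" if "m \<ge> m0" for m
  proof -
    have "dist (cadlag_path (step_path (Suc m) (grid_values (Suc m) \<omega>))) (cadlag_path (\<lambda>t. Z t \<omega>)) \<le> r / 2"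
    proof (rule dist_cadlag_path_le)
      fix t :: real assume t: "t \<in> {0..1}"
      define s where "s = real (nat \<lfloor>real (Suc m) * t\<rfloor>) / real (Suc m)"
      note g = floor_grid[OF zero_less_Suc[of m] t, folded s_def]
      have "1 / d < real (Suc m)" using m0 that by linarith
      then have "1 / real (Suc m) < d" using d(1) by (simp add: field_simps)
      then have "dist s t < d" using g(3) by (simp add: dist_real_def)
      then have "dist (Z s \<omega>) (Z t \<omega>) < r / 2" by (rule d(2)[OF t g(2)])
      then show "\<bar>step_path (Suc m) (grid_values (Suc m) \<omega>) t - Z t \<omega>\<bar> \<le> r / 2"
        using g(1) by (simp add: step_path_def grid_values_def s_def dist_real_def)
    qed (use r in \<open>auto intro: cadlag_on_unit_step_path cadlag_on_unit_continuous limit_process_continuous \<omega>\<close>)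
    then show ?thesis using r by simp
  qed
  then show "\<exists>m0. \<forall>m\<ge>m0. dist (cadlag_path (step_path (Suc m) (grid_values (Suc m) \<omega>))) (cadlag_path (\<lambda>t. Z t \<omega>)) < r"
    by blast
qed

text \<open>The step path is a continuous function of its values, hence Borel for the Skorohod
  topology. Continuity of \<open>Z\<close> carries this over to the full path as a pointwise
  limit.\<close>

lemma step_path_grid_measurable:
  "(\<lambda>\<omega>. cadlag_path (step_path (Suc m) (grid_values (Suc m) \<omega>))) \<in> measurable M borel"
proof (rule measurable_compose[OF measurable_coordinatewise_then_product])
  show "(\<lambda>\<omega>. grid_values (Suc m) \<omega> j) \<in> borel_measurable M" for j by (rule grid_values_measurable) simp
  have "continuous_on UNIV (\<lambda>y. cadlag_path (step_path (Suc m) y))"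
    by (rule lipschitz_coordinates_continuous[where L = 1 and k = "Suc (Suc m)"])
      (use dist_step_path_le[of "Suc m"] in \<open>simp del: sum.lessThan_Suc\<close>)
  then show "(\<lambda>y. cadlag_path (step_path (Suc m) y)) \<in> borel_measurable borel"
    by (rule borel_measurable_continuous_onI)
qed

lemma limit_path_measurable: "(\<lambda>\<omega>. cadlag_path (\<lambda>t. Z t \<omega>)) \<in> measurable M borel"
  by (rule borel_measurable_LIMSEQ_metric[OF step_path_grid_measurable step_path_grid_tendsto])

lemma step_functional_tendsto:
  fixes f :: "cadlag \<Rightarrow> real"
  assumes f: "\<And>x. \<bar>f x\<bar> \<le> B" "\<And>x y. \<bar>f x - f y\<bar> \<le> L * dist x y" and L: "0 \<le> L" and m: "0 < m"
  shows "(\<lambda>n. \<integral>\<sigma>. f (cadlag_path (step_path m (\<lambda>j. scaled_runs n \<sigma> (real j / real m)))) \<partial>random_perm n)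
    \<longlonglongrightarrow> (\<integral>\<omega>. f (cadlag_path (step_path m (grid_values m \<omega>))) \<partial>M)"
proof (rule lipschitz_tendsto_of_char[where k = "Suc m" and C = 40 and L = L and B = B
      and G = "\<lambda>y. f (cadlag_path (step_path m y))" and Y = "\<lambda>n \<sigma> j. scaled_runs n \<sigma> (real j / real m)"])
  show "prob_space (random_perm n)" for n by (rule prob_space_random_perm)
  show "(\<lambda>\<sigma>. scaled_runs n \<sigma> (real j / real m)) \<in> borel_measurable (random_perm n)" for n j
    by (rule measurable_random_perm)
  show "prob_space M" by (rule limit_process_prob_space)
  show "(\<lambda>\<omega>. grid_values m \<omega> j) \<in> borel_measurable M" for j by (rule grid_values_measurable[OF m])
  fix \<theta> :: "nat \<Rightarrow> real"
  have "(\<integral>\<omega>. iexp (\<Sum>j<Suc m. \<theta> j * grid_values m \<omega> j) \<partial>M) = (\<integral>\<omega>. iexp (\<Sum>j<Suc m. \<theta> j * Z (real j / real m) \<omega>) \<partial>M)"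
    by (intro Bochner_Integration.integral_cong refl arg_cong[where f = iexp] sum.cong) (simp add: grid_values_def)
  also have "\<dots> = of_real (exp (- (\<Sum>i<Suc m. \<Sum>j<Suc m. \<theta> i * \<theta> j * limit_cov (real i / real m) (real j / real m)) / 2))"
    by (rule limit_process_char) (use m in \<open>auto simp: inj_on_def\<close>)
  finally have *: "(\<integral>\<omega>. iexp (\<Sum>j<Suc m. \<theta> j * grid_values m \<omega> j) \<partial>M)
    = of_real (exp (- (\<Sum>i<Suc m. \<Sum>j<Suc m. \<theta> i * \<theta> j * limit_cov (real i / real m) (real j / real m)) / 2))" .
  show "(\<lambda>n. \<integral>\<sigma>. iexp (\<Sum>j<Suc m. \<theta> j * scaled_runs n \<sigma> (real j / real m)) \<partial>random_perm n)
    \<longlonglongrightarrow> (\<integral>\<omega>. iexp (\<Sum>j<Suc m. \<theta> j * grid_values m \<omega> j) \<partial>M)"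
    unfolding integral_random_perm *
    by (rule char_scaled_runs_tendsto) (use m in auto)
next
  show "integrable (random_perm n) (\<lambda>\<sigma>. (scaled_runs n \<sigma> (real j / real m))\<^sup>2)" for n j
    by (rule integrable_random_perm)
  show "(\<integral>\<sigma>. (scaled_runs n \<sigma> (real j / real m))\<^sup>2 \<partial>random_perm n) \<le> 40" if "j < Suc m" for n j
    unfolding integral_random_perm
    using scaled_runs_second_moment[of n "real j / real m"] grid_time[OF that m]
    \<comment> \<open>For \<open>n = 0\<close> the scaled number of runs is 0 by division by
      zero.\<close>
    by (cases "n = 0") (simp_all add: scaled_runs_def)
  show "integrable M (\<lambda>\<omega>. (grid_values m \<omega> j)\<^sup>2)" if "j < Suc m" for j
    using limit_process_square_integrable(2)[OF grid_time[OF that m]] that by (simp add: grid_values_def)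
  show "(\<integral>\<omega>. (grid_values m \<omega> j)\<^sup>2 \<partial>M) \<le> 40" if "j < Suc m" for j
  proof -
    define t where "t = real j / real m"
    have t: "t \<in> {0..1}" unfolding t_def by (rule grid_time[OF that m])
    have "(\<integral>\<omega>. (grid_values m \<omega> j)\<^sup>2 \<partial>M) = (\<integral>\<omega>. Z t \<omega> * Z t \<omega> \<partial>M)"
      using that by (simp add: grid_values_def t_def power2_eq_square)
    also have "\<dots> = t\<^sup>2 * (1 - t)\<^sup>2" using limit_process_cov[OF t t] by (simp add: limit_cov_def)
    also have "\<dots> \<le> 1" using t by (intro mult_le_one power_le_one) auto
    finally show ?thesis by simp
  qed
  show "\<bar>f (cadlag_path (step_path m x)) - f (cadlag_path (step_path m y))\<bar> \<le> L * (\<Sum>j<Suc m. \<bar>x j - y j\<bar>)" for x y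
    by (rule order_trans[OF f(2) mult_left_mono[OF dist_step_path_le[OF m] L]])
qed (use f L in auto)

text \<open>The grid is fixed before \<open>n\<close> grows: \<open>m\<close> is chosen so large
  that the step path of \<open>Z\<close> is close to \<open>Z\<close> in expectation and the
  oscillation bound is small for all large \<open>n\<close>. The three errors are
  \<open>r / 8\<close>, \<open>r / 8\<close> and \<open>3 / 8 * r\<close>.\<close>

lemma scaled_runs_functional_tendsto:
  fixes f :: "cadlag \<Rightarrow> real"
  assumes f: "\<And>x. \<bar>f x\<bar> \<le> B" "\<And>x y. \<bar>f x - f y\<bar> \<le> L * dist x y" and L: "0 \<le> L"
  shows "(\<lambda>n. \<integral>\<sigma>. f (cadlag_path (scaled_runs n \<sigma>)) \<partial>random_perm n)
    \<longlonglongrightarrow> (\<integral>\<omega>. f (cadlag_path (\<lambda>t. Z t \<omega>)) \<partial>M)"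
proof (rule LIMSEQ_I)
  fix r :: real assume r: "0 < r"
  interpret prob_space M by (rule limit_process_prob_space)
  \<comment> \<open>Each of the three terms of the oscillation bound will be at most
    \<open>\<epsilon>\<close>; \<open>L + 1\<close> keeps the denominator positive for
    \<open>L = 0\<close>.\<close>
  define \<epsilon> where "\<epsilon> = r / (8 * (L + 1))"
  have \<epsilon>: "0 < \<epsilon>" "L * (3 * \<epsilon>) \<le> 3 / 8 * r"
    using r L by (auto simp: \<epsilon>_def field_simps)
  have fc: "continuous_on UNIV f"
  proof -
    have "L-lipschitz_on UNIV f"
      by (rule lipschitz_onI) (use f(2) L in \<open>auto simp: dist_real_def\<close>)
    then show ?thesis by (rule lipschitz_on_continuous_on)
  qed
  then have fm: "f \<in> borel_measurable borel" by (rule borel_measurable_continuous_onI)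
  have "(\<lambda>m. \<integral>\<omega>. f (cadlag_path (step_path (Suc m) (grid_values (Suc m) \<omega>))) \<partial>M)
    \<longlonglongrightarrow> (\<integral>\<omega>. f (cadlag_path (\<lambda>t. Z t \<omega>)) \<partial>M)"
  proof (rule integral_dominated_convergence[where w = "\<lambda>_. B"])
    show "(\<lambda>\<omega>. f (cadlag_path (\<lambda>t. Z t \<omega>))) \<in> borel_measurable M"
      by (rule measurable_compose[OF limit_path_measurable fm])
    show "(\<lambda>\<omega>. f (cadlag_path (step_path (Suc m) (grid_values (Suc m) \<omega>)))) \<in> borel_measurable M" for m
      by (rule measurable_compose[OF step_path_grid_measurable fm])
    show "AE \<omega> in M. (\<lambda>m. f (cadlag_path (step_path (Suc m) (grid_values (Suc m) \<omega>)))) \<longlonglongrightarrow> f (cadlag_path (\<lambda>t. Z t \<omega>))"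
    proof (rule AE_I2)
      fix \<omega> assume "\<omega> \<in> space M"
      show "(\<lambda>m. f (cadlag_path (step_path (Suc m) (grid_values (Suc m) \<omega>)))) \<longlonglongrightarrow> f (cadlag_path (\<lambda>t. Z t \<omega>))"
        by (rule continuous_on_tendsto_compose[OF fc step_path_grid_tendsto]) (use \<open>\<omega> \<in> space M\<close> in auto)
    qed
  qed (use f(1) in auto)
  from LIMSEQ_D[OF this, of "r / 8"] r
  obtain m0 where m0: "\<And>m. m \<ge> m0 \<Longrightarrow> norm ((\<integral>\<omega>. f (cadlag_path (step_path (Suc m) (grid_values (Suc m) \<omega>))) \<partial>M)
    - (\<integral>\<omega>. f (cadlag_path (\<lambda>t. Z t \<omega>)) \<partial>M)) < r / 8" by auto
  obtain m1 :: nat where m1: "393289924608 / \<epsilon> ^ 4 < real m1" using reals_Archimedean2 by blast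
  define m where "m = Suc (max m0 m1)"
  have m: "0 < m" by (simp add: m_def)
  have mC: "393289924608 / (\<epsilon> ^ 3 * real m) \<le> \<epsilon>"
  proof -
    have "393289924608 / \<epsilon> ^ 4 \<le> real m" using m1 unfolding m_def by linarith
    then have "393289924608 \<le> real m * \<epsilon> ^ 4" using \<epsilon> by (simp add: pos_divide_le_eq)
    then have "393289924608 \<le> \<epsilon> * (\<epsilon> ^ 3 * real m)" by (simp add: power4_eq_xxxx power3_eq_cube mult_ac)
    then show ?thesis using \<epsilon> m by (simp add: pos_divide_le_eq)
  qed
  let ?a = "\<integral>\<omega>. f (cadlag_path (step_path m (grid_values m \<omega>))) \<partial>M"
  have a: "\<bar>?a - (\<integral>\<omega>. f (cadlag_path (\<lambda>t. Z t \<omega>)) \<partial>M)\<bar> < r / 8"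
    using m0[of "max m0 m1"] by (simp add: m_def)
  have "\<forall>\<^sub>F n in sequentially. norm ((\<integral>\<sigma>. f (cadlag_path (step_path m (\<lambda>j. scaled_runs n \<sigma> (real j / real m)))) \<partial>random_perm n) - ?a) < r / 8"
    using LIMSEQ_D[OF step_functional_tendsto[OF f L m], of "r / 8"] r unfolding eventually_sequentially by auto
  moreover have "\<forall>\<^sub>F n in sequentially. 8 / sqrt (real n) < \<epsilon>"
  proof (rule order_tendstoD)
    show "(\<lambda>n. 8 / sqrt (real n)) \<longlonglongrightarrow> 0" by real_asymp
  qed (rule \<epsilon>)
  ultimately have "\<forall>\<^sub>F n in sequentially. norm ((\<integral>\<sigma>. f (cadlag_path (scaled_runs n \<sigma>)) \<partial>random_perm n)
      - (\<integral>\<omega>. f (cadlag_path (\<lambda>t. Z t \<omega>)) \<partial>M)) < r"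
    using eventually_ge_at_top[of m]
  proof eventually_elim
    case (elim n)
    obtain U where U: "\<And>\<sigma> t. \<sigma> \<in> perms n \<Longrightarrow> t \<in> {0..1} \<Longrightarrow>
        \<bar>scaled_runs n \<sigma> t - scaled_runs n \<sigma> (real (nat \<lfloor>real m * t\<rfloor>) / real m)\<bar> \<le> U \<sigma>"
      "pexp n U \<le> 8 / sqrt n + \<epsilon> + 393289924608 / (\<epsilon> ^ 3 * real m)" "\<And>\<sigma>. 0 < U \<sigma>"
      using scaled_runs_oscillation[OF m elim(3) \<epsilon>(1)] by blast
    let ?x = "\<lambda>\<sigma>. f (cadlag_path (scaled_runs n \<sigma>))"
    let ?y = "\<lambda>\<sigma>. f (cadlag_path (step_path m (\<lambda>j. scaled_runs n \<sigma> (real j / real m))))"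
    have "\<bar>pexp n ?x - pexp n ?y\<bar> \<le> pexp n (\<lambda>\<sigma>. \<bar>?x \<sigma> - ?y \<sigma>\<bar>)"
      unfolding pexp_diff[symmetric] by (rule abs_pexp_le)
    also have "\<dots> \<le> pexp n (\<lambda>\<sigma>. L * U \<sigma>)"
    proof (rule pexp_mono)
      fix \<sigma> assume \<sigma>: "\<sigma> \<in> perms n"
      have "dist (cadlag_path (scaled_runs n \<sigma>)) (cadlag_path (step_path m (\<lambda>j. scaled_runs n \<sigma> (real j / real m)))) \<le> U \<sigma>"
        by (rule dist_cadlag_path_le[OF cadlag_on_unit_scaled_runs cadlag_on_unit_step_path[OF m] less_imp_le[OF U(3)]])
          (unfold step_path_def, rule U(1)[OF \<sigma>])
      then show "\<bar>?x \<sigma> - ?y \<sigma>\<bar> \<le> L * U \<sigma>"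
        by (rule order_trans[OF f(2) mult_left_mono[OF _ L]])
    qed
    also have "\<dots> = L * pexp n U" by (rule pexp_mult_left)
    also have "\<dots> \<le> L * (3 * \<epsilon>)"
    proof (rule mult_left_mono[OF _ L])
      show "pexp n U \<le> 3 * \<epsilon>" using U(2) mC elim(2) by linarith
    qed
    finally have "\<bar>pexp n ?x - pexp n ?y\<bar> \<le> 3 / 8 * r" using \<epsilon>(2) by linarith
    then show ?case using elim(1) a r unfolding integral_random_perm real_norm_def by linarith
  qed
  then show "\<exists>n0. \<forall>n\<ge>n0. norm ((\<integral>\<sigma>. f (cadlag_path (scaled_runs n \<sigma>)) \<partial>random_perm n)
      - (\<integral>\<omega>. f (cadlag_path (\<lambda>t. Z t \<omega>)) \<partial>M)) < r"
    unfolding eventually_sequentially .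
qed

lemma scaled_runs_converges:
  "converges_in_distribution random_perm (\<lambda>n \<sigma>. cadlag_path (scaled_runs n \<sigma>)) M (\<lambda>\<omega>. cadlag_path (\<lambda>t. Z t \<omega>))"
proof (rule converges_in_distribution_lipschitz)
  fix g :: "cadlag \<Rightarrow> real" and L
  assume b: "bounded (range g)" and g: "\<And>x y. \<bar>g x - g y\<bar> \<le> L * dist x y"
  obtain B where "\<And>x. \<bar>g x\<bar> \<le> B" using b by (auto simp: bounded_iff)
  moreover have "\<bar>g x - g y\<bar> \<le> \<bar>L\<bar> * dist x y" for x y
    by (rule order_trans[OF g mult_right_mono]) auto
  ultimately show "(\<lambda>n. \<integral>\<sigma>. g (cadlag_path (scaled_runs n \<sigma>)) \<partial>random_perm n)
    \<longlonglongrightarrow> (\<integral>\<omega>. g (cadlag_path (\<lambda>t. Z t \<omega>)) \<partial>M)"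
    by (rule scaled_runs_functional_tendsto) simp
qed (rule prob_space_random_perm measurable_random_perm limit_process_prob_space limit_path_measurable)+

end


section \<open>Existence of the limit process\<close>

subsection \<open>Levy's construction of the Brownian bridge\<close>

text \<open>The integral of a Haar function, normalised to height 1.\<close>

definition tent :: "real \<Rightarrow> real" where
  "tent x = max 0 (1 - \<bar>2 * x - 1\<bar>)"

text \<open>The value 0 outside the unit square lets the self-similarity hold for all real
  arguments, so sums over dyadic intervals need no case distinction.\<close>

definition bridge_cov :: "real \<Rightarrow> real \<Rightarrow> real" where
  "bridge_cov x y = (if 0 \<le> min x y \<and> max x y \<le> 1 then min x y * (1 - max x y) else 0)"

lemma tent_nonneg: "0 \<le> tent x" and tent_le_1: "tent x \<le> 1"
  by (auto simp: tent_def)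

lemma tent_outside: "x \<le> 0 \<or> 1 \<le> x \<Longrightarrow> tent x = 0"
  by (auto simp: tent_def)

text \<open>The self-similarity that makes the Schauder expansion of the bridge covariance telescope.\<close>

lemma bridge_cov_split:
  "bridge_cov x y = tent x * tent y / 4 + (bridge_cov (2 * x) (2 * y) + bridge_cov (2 * x - 1) (2 * y - 1)) / 2"
proof -
  have *: "bridge_cov x y = tent x * tent y / 4 + (bridge_cov (2 * x) (2 * y) + bridge_cov (2 * x - 1) (2 * y - 1)) / 2"
    if xy: "x \<le> y" for x y
  proof -
    have b: "bridge_cov a b = (if 0 \<le> a \<and> b \<le> 1 then a * (1 - b) else 0)" if "a \<le> b" for a b
      using that by (simp add: bridge_cov_def min_absorb1 max_absorb2)
    have b1: "bridge_cov x y = (if 0 \<le> x \<and> y \<le> 1 then x * (1 - y) else 0)"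
      and b2: "bridge_cov (2 * x) (2 * y) = (if 0 \<le> 2 * x \<and> 2 * y \<le> 1 then 2 * x * (1 - 2 * y) else 0)"
      and b3: "bridge_cov (2 * x - 1) (2 * y - 1) = (if 0 \<le> 2 * x - 1 \<and> 2 * y - 1 \<le> 1 then (2 * x - 1) * (1 - (2 * y - 1)) else 0)"
      using xy by (intro b; simp)+
    consider "x < 0" | "1 < y" | "0 \<le> x" "y \<le> 1 / 2" | "1 / 2 \<le> x" "y \<le> 1" | "0 \<le> x" "x < 1 / 2" "1 / 2 < y" "y \<le> 1"
      by linarith
    then show ?thesis
    proof cases
      case 1
      then show ?thesis unfolding b1 b2 b3 by (simp add: tent_outside)
    next
      case 2
      then show ?thesis unfolding b1 b2 b3 by (simp add: tent_outside)
    next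
      case 3
      have "tent x = 2 * x" "tent y = 2 * y" using 3 xy by (simp_all add: tent_def)
      moreover have "bridge_cov (2 * x - 1) (2 * y - 1) = 0" unfolding b3 using 3 xy by auto
      ultimately show ?thesis unfolding b1 b2 using 3 xy by (simp add: field_simps)
    next
      case 4
      have t: "tent x = 2 - 2 * x" "tent y = 2 - 2 * y" using 4 xy by (simp_all add: tent_def)
      have z: "bridge_cov (2 * x) (2 * y) = 0" unfolding b2 using 4 xy by auto
      show ?thesis unfolding b1 b3 t z using 4 xy by (simp add: field_simps)
    next
      case 5
      have t: "tent x = 2 * x" "tent y = 2 - 2 * y" using 5 by (simp_all add: tent_def)
      show ?thesis unfolding b1 b2 b3 t using 5 by (simp add: field_simps)
    qed
  qed
  have comm: "bridge_cov a b = bridge_cov b a" for a b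
    by (simp add: bridge_cov_def min.commute max.commute)
  show ?thesis
  proof (cases "x \<le> y")
    case False
    then have "y \<le> x" by simp
    from *[OF this] show ?thesis by (simp only: comm[of x y] comm[of "2 * x" "2 * y"]
        comm[of "2 * x - 1" "2 * y - 1"] mult.commute[of "tent x"])
  qed (rule *)
qed

lemma sum_double: "(\<Sum>k<2 * n. f k) = (\<Sum>k<n. f (2 * k) + f (2 * k + 1))" for f :: "nat \<Rightarrow> real"
  by (induction n) (simp_all add: mult_2_right)

text \<open>The height 2^(-l/2) / 2 is the integral of an L2-normalised Haar function of level
  \<open>l\<close> over the half where it is positive.\<close>

definition schauder :: "nat \<Rightarrow> nat \<Rightarrow> real \<Rightarrow> real" where
  "schauder l k t = sqrt (1 / 2 ^ l) / 2 * tent (2 ^ l * t - real k)"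

text \<open>Iterating the self-similarity \<open>n\<close> times leaves an exact remainder: 2^n
  small copies of the covariance, each scaled by 2^(-n).\<close>

lemma schauder_sum:
  "(\<Sum>l<n. \<Sum>k<2 ^ l. schauder l k s * schauder l k t)
    + (\<Sum>k<2 ^ n. bridge_cov (2 ^ n * s - real k) (2 ^ n * t - real k)) / 2 ^ n = bridge_cov s t"
proof (induction n)
  case (Suc n)
  let ?b = "\<lambda>n k. bridge_cov (2 ^ n * s - real k) (2 ^ n * t - real k)"
  have split: "?b n k = tent (2 ^ n * s - real k) * tent (2 ^ n * t - real k) / 4 + (?b (Suc n) (2 * k) + ?b (Suc n) (2 * k + 1)) / 2" for k
    by (subst bridge_cov_split) (simp add: algebra_simps)
  have sch: "schauder n k s * schauder n k t = tent (2 ^ n * s - real k) * tent (2 ^ n * t - real k) / 4 / 2 ^ n" for k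
  proof -
    have "sqrt (1 / 2 ^ n) * sqrt (1 / 2 ^ n) = (1 / 2 ^ n :: real)" by simp
    then show ?thesis unfolding schauder_def by (simp add: field_simps)
  qed
  have "(\<Sum>k<2 ^ n. ?b n k) = (\<Sum>k<2 ^ n. tent (2 ^ n * s - real k) * tent (2 ^ n * t - real k) / 4)
      + (\<Sum>k<2 ^ n. ?b (Suc n) (2 * k) + ?b (Suc n) (2 * k + 1)) / 2"
    unfolding split by (subst sum.distrib) (simp only: sum_divide_distrib)
  also have "(\<Sum>k<2 ^ n. ?b (Suc n) (2 * k) + ?b (Suc n) (2 * k + 1)) = (\<Sum>k<2 ^ Suc n. ?b (Suc n) k)"
    unfolding power_Suc by (rule sum_double[symmetric])
  finally have "(\<Sum>k<2 ^ n. ?b n k) / 2 ^ n = (\<Sum>k<2 ^ n. schauder n k s * schauder n k t)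
      + (\<Sum>k<2 ^ Suc n. ?b (Suc n) k) / 2 ^ Suc n"
    unfolding sch by (simp add: add_divide_distrib sum_divide_distrib)
  then show ?case using Suc.IH by (simp only: sum.lessThan_Suc)
qed simp

lemma bridge_cov_bounds: "0 \<le> bridge_cov x y" "bridge_cov x y \<le> of_bool (0 < x \<and> x < 1)"
proof -
  show "0 \<le> bridge_cov x y" by (simp add: bridge_cov_def)
  show "bridge_cov x y \<le> of_bool (0 < x \<and> x < 1)"
  proof (cases "0 \<le> min x y \<and> max x y \<le> 1")
    case True
    then have b: "bridge_cov x y = min x y * (1 - max x y)" by (simp only: bridge_cov_def if_True simp_thms)
    show ?thesis
    proof (cases "0 < x \<and> x < 1")
      case True': True
      have "min x y * (1 - max x y) \<le> 1" using True by (intro mult_le_one) auto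
      then show ?thesis using True' b by simp
    next
      case False
      then have "min x y = 0 \<or> max x y = 1" using True by (cases "x \<le> 0") auto
      then show ?thesis using b by auto
    qed
  next
    case False
    then have "bridge_cov x y = 0" unfolding bridge_cov_def by (rule if_not_P)
    then show ?thesis by simp
  qed
qed

lemma sum_unit_interval_le: "(\<Sum>k<n. of_bool (0 < x - real k \<and> x - real k < 1)) \<le> (1 :: real)"
proof -
  have "(\<Sum>k<n. of_bool (0 < x - real k \<and> x - real k < 1)) = real (card {k\<in>{..<n}. 0 < x - real k \<and> x - real k < 1})"
    by (simp add: Int_def)
  also have "card {k\<in>{..<n}. 0 < x - real k \<and> x - real k < 1} \<le> 1"
  proof (rule card_le_Suc0_iff_eq[THEN iffD2, folded One_nat_def])
    show "\<forall>a\<in>{k\<in>{..<n}. 0 < x - real k \<and> x - real k < 1}. \<forall>b\<in>{k\<in>{..<n}. 0 < x - real k \<and> x - real k < 1}. a = b"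
    proof (intro ballI)
      fix a b assume "a \<in> {k\<in>{..<n}. 0 < x - real k \<and> x - real k < 1}" "b \<in> {k\<in>{..<n}. 0 < x - real k \<and> x - real k < 1}"
      then have "real a < real b + 1" "real b < real a + 1" by auto
      then show "a = b" by linarith
    qed
  qed auto
  finally show ?thesis by simp
qed

text \<open>At most one small copy is non-zero at a given point, so the remainder is at most
  2^(-n).\<close>

lemma schauder_sum_tendsto:
  "(\<lambda>n. \<Sum>l<n. \<Sum>k<2 ^ l. schauder l k s * schauder l k t) \<longlonglongrightarrow> bridge_cov s t"
proof -
  let ?r = "\<lambda>n. (\<Sum>k<2 ^ n. bridge_cov (2 ^ n * s - real k) (2 ^ n * t - real k)) / 2 ^ n"
  have "?r \<longlonglongrightarrow> 0"
  proof (rule real_tendsto_sandwich[OF _ _ tendsto_const])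
    show "\<forall>\<^sub>F n in sequentially. 0 \<le> ?r n"
      by (intro always_eventually allI divide_nonneg_nonneg sum_nonneg bridge_cov_bounds) auto
    have "(\<Sum>k<2 ^ n. bridge_cov (2 ^ n * s - real k) (2 ^ n * t - real k)) \<le> 1" for n
      by (rule order_trans[OF sum_mono[OF bridge_cov_bounds(2)] sum_unit_interval_le])
    then have "?r n \<le> 1 / 2 ^ n" for n by (intro divide_right_mono) auto
    then show "\<forall>\<^sub>F n in sequentially. ?r n \<le> (1 / 2) ^ n"
      by (intro always_eventually allI) (simp add: power_divide)
    show "(\<lambda>n. (1 / 2 :: real) ^ n) \<longlonglongrightarrow> 0" by (rule LIMSEQ_realpow_zero) auto
  qed
  then have "(\<lambda>n. bridge_cov s t - ?r n) \<longlonglongrightarrow> bridge_cov s t - 0" by (intro tendsto_intros)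
  moreover have "bridge_cov s t - ?r n = (\<Sum>l<n. \<Sum>k<2 ^ l. schauder l k s * schauder l k t)" for n
    using schauder_sum[of s t n] by linarith
  ultimately show ?thesis by simp
qed

subsection \<open>Gaussian coordinates\<close>

text \<open>The coordinates are indexed by all reals only because the theorem asks for a measure on
  \<open>real \<Rightarrow> real\<close>; countably many of them are used.\<close>

definition gauss_space :: "(real \<Rightarrow> real) measure" where
  "gauss_space = PiM UNIV (\<lambda>_. std_normal_distribution)"

lemma prob_space_std_normal: "prob_space std_normal_distribution"
  by (rule prob_space_normal_density) simp

interpretation gauss: product_prob_space "\<lambda>_ :: real. std_normal_distribution" UNIV
  unfolding product_prob_space_def product_prob_space_axioms_def product_sigma_finite_def
  using prob_space_std_normal prob_space_imp_sigma_finite by blast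

interpretation G: prob_space gauss_space
  unfolding gauss_space_def by (rule gauss.P.prob_space_axioms)

lemma coordinate_measurable_std: "(\<lambda>\<omega>. \<omega> d) \<in> measurable gauss_space std_normal_distribution"
  unfolding gauss_space_def by (rule measurable_component_singleton) simp

lemma coordinate_measurable [measurable]: "(\<lambda>\<omega>. \<omega> d) \<in> borel_measurable gauss_space"
  using coordinate_measurable_std[of d] by (simp add: measurable_def)

lemma distr_coordinate: "distr gauss_space std_normal_distribution (\<lambda>\<omega>. \<omega> d) = std_normal_distribution"
  unfolding gauss_space_def by (rule gauss.PiM_component) simp

lemma indep_coordinates: "G.indep_vars (\<lambda>_. std_normal_distribution) (\<lambda>d \<omega>. \<omega> d) UNIV"
proof (subst G.indep_vars_iff_distr_eq_PiM)
  have "distr gauss_space (PiM UNIV (\<lambda>_. std_normal_distribution)) (\<lambda>\<omega>. \<lambda>d\<in>UNIV. \<omega> d) = gauss_space"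
    unfolding gauss_space_def by (simp add: restrict_UNIV distr_id2)
  then show "distr gauss_space (PiM UNIV (\<lambda>_. std_normal_distribution)) (\<lambda>\<omega>. \<lambda>d\<in>UNIV. \<omega> d)
    = PiM UNIV (\<lambda>d. distr gauss_space std_normal_distribution (\<lambda>\<omega>. \<omega> d))"
    unfolding distr_coordinate by (simp add: gauss_space_def)
qed (auto intro: coordinate_measurable_std)

lemma char_coordinate_sum:
  fixes \<gamma> :: "'i \<Rightarrow> real" and q :: "'i \<Rightarrow> real"
  assumes I: "finite I" and q: "inj_on q I"
  shows "char (distr gauss_space borel (\<lambda>\<omega>. \<Sum>i\<in>I. \<gamma> i * \<omega> (q i))) \<theta> = of_real (exp (- (\<Sum>i\<in>I. (\<gamma> i)\<^sup>2) * \<theta>\<^sup>2 / 2))"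
proof -
  define c where "c = \<gamma> \<circ> inv_into I q"
  have eq: "(\<Sum>i\<in>I. g (\<gamma> i) (q i)) = (\<Sum>d\<in>q ` I. g (c d) d)" for g :: "real \<Rightarrow> real \<Rightarrow> real"
    by (subst sum.reindex[OF q]) (auto simp: c_def inv_into_f_f[OF q] intro!: sum.cong)
  have ind: "G.indep_vars (\<lambda>_. borel) (\<lambda>d \<omega>. c d * \<omega> d) (q ` I)"
    by (rule G.indep_vars_compose2[OF G.indep_vars_subset[OF indep_coordinates]]) auto
  have one: "char (distr gauss_space borel (\<lambda>\<omega>. c d * \<omega> d)) \<theta> = of_real (exp (- (c d)\<^sup>2 * \<theta>\<^sup>2 / 2))" for d
  proof -
    have "char (distr gauss_space borel (\<lambda>\<omega>. c d * \<omega> d)) \<theta> = (\<integral>\<omega>. iexp (\<theta> * (c d * \<omega> d)) \<partial>gauss_space)"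
      unfolding char_def by (subst integral_distr) auto
    also have "\<dots> = (\<integral>\<omega>. iexp ((\<theta> * c d) * \<omega> d) \<partial>gauss_space)" by (simp add: mult.assoc)
    also have "\<dots> = (\<integral>x. iexp ((\<theta> * c d) * x) \<partial>distr gauss_space std_normal_distribution (\<lambda>\<omega>. \<omega> d))"
      by (subst integral_distr[OF coordinate_measurable_std]) auto
    also have "\<dots> = char std_normal_distribution (\<theta> * c d)" unfolding distr_coordinate char_def ..
    finally show ?thesis by (simp add: char_std_normal_distribution power_mult_distrib mult.commute)
  qed
  have "char (distr gauss_space borel (\<lambda>\<omega>. \<Sum>i\<in>I. \<gamma> i * \<omega> (q i))) \<theta>
      = char (distr gauss_space borel (\<lambda>\<omega>. \<Sum>d\<in>q ` I. c d * \<omega> d)) \<theta>"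
    by (subst eq[of "\<lambda>a d. a * _ d"]) (rule refl)
  also have "\<dots> = (\<Prod>d\<in>q ` I. of_real (exp (- (c d)\<^sup>2 * \<theta>\<^sup>2 / 2)))"
    by (subst G.char_distr_sum[OF ind]) (simp add: one)
  also have "\<dots> = of_real (exp (\<Sum>d\<in>q ` I. - (c d)\<^sup>2 * \<theta>\<^sup>2 / 2))"
    using I by (simp add: exp_sum)
  also have "(\<Sum>d\<in>q ` I. - (c d)\<^sup>2 * \<theta>\<^sup>2 / 2) = - (\<Sum>i\<in>I. (\<gamma> i)\<^sup>2) * \<theta>\<^sup>2 / 2"
    unfolding eq[of "\<lambda>a d. a\<^sup>2"] by (simp add: sum_negf sum_divide_distrib[symmetric] sum_distrib_right)
  finally show ?thesis .
qed

text \<open>By uniqueness of characteristic functions the law is that of \<open>sqrt v\<close> times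
  a standard normal variable, from which mean, variance and normality are read off. The case
  \<open>v = 0\<close> is the degenerate one.\<close>

lemma normal_of_char:
  assumes P: "prob_space P" and W [measurable]: "W \<in> borel_measurable P" and v: "0 \<le> v"
    and char: "\<And>\<theta>. char (distr P borel W) \<theta> = of_real (exp (- v * \<theta>\<^sup>2 / 2))"
  shows "normal_variable P W" "(\<integral>\<omega>. W \<omega> \<partial>P) = 0" "(\<integral>\<omega>. (W \<omega>)\<^sup>2 \<partial>P) = v"
proof -
  interpret P: prob_space P by (rule P)
  let ?N = "distr std_normal_distribution borel (\<lambda>x. sqrt v * x)"
  have "distr P borel W = ?N"
  proof (rule Levy_uniqueness)
    show "char (distr P borel W) = char ?N"
    proof
      fix \<theta>
      have "char ?N \<theta> = (\<integral>x. iexp (\<theta> * (sqrt v * x)) \<partial>std_normal_distribution)"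
        unfolding char_def by (subst integral_distr) auto
      also have "\<dots> = (\<integral>x. iexp ((\<theta> * sqrt v) * x) \<partial>std_normal_distribution)" by (simp add: mult.assoc)
      also have "\<dots> = char std_normal_distribution (\<theta> * sqrt v)" unfolding char_def ..
      also have "\<dots> = of_real (exp (- v * \<theta>\<^sup>2 / 2))"
        using v by (simp add: char_std_normal_distribution power_mult_distrib mult.commute)
      finally show "char (distr P borel W) \<theta> = char ?N \<theta>" by (simp add: char)
    qed
  qed (auto intro!: P.real_distribution_distr prob_space.real_distribution_distr[OF prob_space_std_normal])
  note distr = this
  have int: "(\<integral>\<omega>. g (W \<omega>) \<partial>P) = (\<integral>x. g (sqrt v * x) \<partial>std_normal_distribution)"
    if [measurable]: "g \<in> borel_measurable borel" for g :: "real \<Rightarrow> real"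
  proof -
    have "(\<integral>\<omega>. g (W \<omega>) \<partial>P) = (\<integral>x. g x \<partial>distr P borel W)" by (subst integral_distr) auto
    also have "\<dots> = (\<integral>x. g (sqrt v * x) \<partial>std_normal_distribution)" unfolding distr by (subst integral_distr) auto
    finally show ?thesis .
  qed
  show "(\<integral>\<omega>. W \<omega> \<partial>P) = 0"
    using int[of "\<lambda>x. x"] integral_std_normal_distribution_moment_odd[of 1] by simp
  show "(\<integral>\<omega>. (W \<omega>)\<^sup>2 \<partial>P) = v"
    using int[of "\<lambda>x. x\<^sup>2"] std_normal_distribution_even_moments(1)[of 1] v by (simp add: power_mult_distrib)
  show "normal_variable P W"
  proof (cases "v = 0")
    case True
    have "AE x in ?N. x = 0" unfolding True by (subst AE_distr_iff) auto
    then have "AE \<omega> in P. W \<omega> = 0" unfolding distr[symmetric] by (subst (asm) AE_distr_iff) auto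
    then show ?thesis unfolding normal_variable_def using W by blast
  next
    case False
    have s: "distributed std_normal_distribution lborel (\<lambda>x. x) std_normal_density"
      unfolding distributed_def by (auto simp: distr_id2)
    have "distributed std_normal_distribution lborel (\<lambda>x. 0 + sqrt v * x) (normal_density (0 + sqrt v * 0) (\<bar>sqrt v\<bar> * 1))"
      using False by (intro prob_space.normal_density_affine[OF prob_space_std_normal s]) auto
    then have "distr std_normal_distribution lborel (\<lambda>x. sqrt v * x) = density lborel (normal_density 0 (sqrt v))"
      using v by (simp add: distributed_distr_eq_density)
    moreover have "distr P lborel W = distr P borel W" "distr std_normal_distribution lborel (\<lambda>x. sqrt v * x) = ?N"
      by (intro distr_cong; simp)+
    ultimately have "distr P lborel W = density lborel (normal_density 0 (sqrt v))" using distr by simp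
    then have "distributed P lborel W (normal_density 0 (sqrt v))"
      unfolding distributed_def using W by (auto simp: normal_density_nonneg)
    moreover have "0 < sqrt v" using v False by simp
    ultimately show ?thesis unfolding normal_variable_def using W by blast
  qed
qed

subsection \<open>Convergence of the series\<close>

definition coord :: "nat \<Rightarrow> nat \<Rightarrow> real" where
  "coord l k = real (prod_encode (l, k))"

text \<open>The base \<open>5 / 4\<close> works because \<open>(5 / 4) ^ 4 > 2\<close> makes the expected weights summable and
  \<open>5 / 4 < sqrt 2\<close> makes the layers summable.\<close>

definition weight :: "nat \<Rightarrow> (real \<Rightarrow> real) \<Rightarrow> real" where
  "weight l \<omega> = (\<Sum>k<2 ^ l. (\<omega> (coord l k) / (5 / 4) ^ l) ^ 4)"

lemma weight_nonneg: "0 \<le> weight l \<omega>"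
  unfolding weight_def by (intro sum_nonneg) simp

lemma weight_measurable [measurable]: "weight l \<in> borel_measurable gauss_space"
  unfolding weight_def by measurable

lemma coordinate_fourth_moment:
  "integrable gauss_space (\<lambda>\<omega>. \<omega> d ^ 4)" "(\<integral>\<omega>. \<omega> d ^ 4 \<partial>gauss_space) = 3"
proof -
  have "(\<integral>x. x ^ 4 \<partial>distr gauss_space std_normal_distribution (\<lambda>\<omega>. \<omega> d)) = 3"
    unfolding distr_coordinate using std_normal_distribution_even_moments(1)[of 2]
    by (simp add: fact_numeral)
  then show "(\<integral>\<omega>. \<omega> d ^ 4 \<partial>gauss_space) = 3"
    by (subst (asm) integral_distr[OF coordinate_measurable_std]) auto
  have "integrable (distr gauss_space std_normal_distribution (\<lambda>\<omega>. \<omega> d)) (\<lambda>x. x ^ 4)"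
    unfolding distr_coordinate by (rule integrable_std_normal_distribution_moment)
  then show "integrable gauss_space (\<lambda>\<omega>. \<omega> d ^ 4)"
    by (subst (asm) integrable_distr_eq[OF coordinate_measurable_std]) auto
qed

text \<open>Level \<open>l\<close> has 2^l coordinates, each with fourth moment 3, and 512 / 625 = 2
  (4/5)^4.\<close>

lemma nn_integral_weight: "(\<integral>\<^sup>+\<omega>. ennreal (weight l \<omega>) \<partial>gauss_space) = ennreal (3 * (512 / 625) ^ l)"
proof -
  have i: "integrable gauss_space (weight l)"
    unfolding weight_def power_divide
    by (intro Bochner_Integration.integrable_sum Bochner_Integration.integrable_divide coordinate_fourth_moment)
  have "(\<integral>\<omega>. weight l \<omega> \<partial>gauss_space) = (\<Sum>k<2 ^ l. (\<integral>\<omega>. \<omega> (coord l k) ^ 4 / ((5 / 4) ^ l) ^ 4 \<partial>gauss_space))"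
    unfolding weight_def power_divide[of "_ (coord l _)"]
    by (intro Bochner_Integration.integral_sum Bochner_Integration.integrable_divide coordinate_fourth_moment)
  also have "\<dots> = 2 ^ l * (3 / ((5 / 4) ^ l) ^ 4)" by (simp add: coordinate_fourth_moment)
  also have "\<dots> = 3 * (512 / 625) ^ l"
  proof -
    have "((5 / 4 :: real) ^ l) ^ 4 = (625 / 256) ^ l"
      by (simp add: power_mult[symmetric] mult.commute[of l] power_mult power_divide)
    moreover have "(2 :: real) ^ l / (625 / 256) ^ l = (512 / 625) ^ l"
      by (simp add: power_divide[symmetric])
    ultimately show ?thesis by (simp add: mult.commute)
  qed
  finally show ?thesis
    by (subst nn_integral_eq_integral[OF i]) (auto simp: weight_nonneg)
qed

text \<open>Summability is expressed by a sum in \<open>ennreal\<close>, which always exists and is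
  measurable; a finite expectation makes it finite almost surely.\<close>

definition good :: "(real \<Rightarrow> real) \<Rightarrow> bool" where
  "good \<omega> \<longleftrightarrow> (\<Sum>l. ennreal (weight l \<omega>)) \<noteq> \<infinity>"

lemma AE_good: "AE \<omega> in gauss_space. good \<omega>"
  unfolding good_def
proof (rule nn_integral_noteq_infinite)
  have "(\<integral>\<^sup>+\<omega>. (\<Sum>l. ennreal (weight l \<omega>)) \<partial>gauss_space) = (\<Sum>l. ennreal (3 * (512 / 625) ^ l))"
    by (subst nn_integral_suminf) (auto simp: nn_integral_weight)
  also have "\<dots> = ennreal (\<Sum>l. 3 * (512 / 625) ^ l)"
    by (intro suminf_ennreal2 summable_mult summable_geometric) auto
  finally show "(\<integral>\<^sup>+\<omega>. (\<Sum>l. ennreal (weight l \<omega>)) \<partial>gauss_space) \<noteq> \<infinity>" by simp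
qed measurable

lemma good_measurable [measurable]: "Measurable.pred gauss_space good"
  unfolding good_def by measurable

definition layer :: "nat \<Rightarrow> real \<Rightarrow> (real \<Rightarrow> real) \<Rightarrow> real" where
  "layer l t \<omega> = (\<Sum>k<2 ^ l. schauder l k t * \<omega> (coord l k))"

lemma layer_measurable [measurable]: "layer l t \<in> borel_measurable gauss_space"
  unfolding layer_def by measurable

lemma tent_continuous: "continuous_on A (\<lambda>t. tent (a * t - b))"
  unfolding tent_def by (intro continuous_intros)

lemma layer_continuous: "continuous_on A (\<lambda>t. layer l t \<omega>)"
  unfolding layer_def schauder_def by (intro continuous_intros tent_continuous)

text \<open>At a given time at most one tent of a level is non-zero, so a layer is as large as a
  single term: a coordinate of size at most (T + 1) (5/4)^l times a tent of height 2^(-l/2) /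
  2.\<close>

lemma layer_bound:
  assumes "good \<omega>"
  obtains C where "\<And>l t. \<bar>layer l t \<omega>\<bar> \<le> C * (5 / 4 * sqrt (1 / 2)) ^ l"
proof -
  have sm: "summable (\<lambda>l. weight l \<omega>)"
    using assms weight_nonneg unfolding good_def by (intro summable_suminf_not_top) auto
  define T where "T = (\<Sum>l. weight l \<omega>)"
  have T: "weight l \<omega> \<le> T" for l
    unfolding T_def using sum_le_suminf[OF sm, of "{l}"] weight_nonneg by simp
  have T0: "0 \<le> T" using T[of 0] weight_nonneg[of 0 \<omega>] by linarith
  have coord: "\<bar>\<omega> (coord l k)\<bar> \<le> (T + 1) * (5 / 4) ^ l" if "k < 2 ^ l" for l k
  proof -
    define x where "x = \<bar>\<omega> (coord l k)\<bar> / (5 / 4) ^ l"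
    have "x ^ 4 \<le> weight l \<omega>"
    proof -
      have "x = \<bar>\<omega> (coord l k) / (5 / 4) ^ l\<bar>" by (simp only: x_def abs_divide) simp
      then have "x ^ 4 = (\<omega> (coord l k) / (5 / 4) ^ l) ^ 4" by (simp only: power_even_abs even_numeral)
      also have "\<dots> \<le> weight l \<omega>"
        unfolding weight_def by (rule member_le_sum) (use that in auto)
      finally show ?thesis .
    qed
    then have x4: "x ^ 4 \<le> T" using T[of l] by linarith
    \<comment> \<open>A crude substitute for the fourth root of \<open>T\<close>: a number above 1
      is at most its fourth power.\<close>
    have "x \<le> T + 1"
    proof (rule ccontr)
      assume "\<not> x \<le> T + 1"
      then have x: "1 \<le> x" "T < x" using T0 by auto
      have "x ^ 1 \<le> x ^ 4" using x by (intro power_increasing) auto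
      then show False using x4 x by simp
    qed
    then show ?thesis by (simp add: x_def pos_divide_le_eq)
  qed
  have "\<bar>layer l t \<omega>\<bar> \<le> (T + 1) / 2 * (5 / 4 * sqrt (1 / 2)) ^ l" for l t
  proof -
    let ?c = "sqrt (1 / 2 ^ l) / 2"
    have "\<bar>layer l t \<omega>\<bar> \<le> (\<Sum>k<2 ^ l. \<bar>schauder l k t * \<omega> (coord l k)\<bar>)"
      unfolding layer_def by (rule sum_abs)
    also have "\<dots> \<le> (\<Sum>k<2 ^ l. ?c * of_bool (0 < 2 ^ l * t - real k \<and> 2 ^ l * t - real k < 1) * ((T + 1) * (5 / 4) ^ l))"
    proof (rule sum_mono)
      fix k assume "k \<in> {..<(2::nat) ^ l}"
      have tent: "tent y \<le> of_bool (0 < y \<and> y < 1)" for y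
        using tent_le_1[of y] tent_outside[of y] by (cases "0 < y \<and> y < 1") auto
      have "\<bar>schauder l k t\<bar> = ?c * tent (2 ^ l * t - real k)"
        by (simp add: schauder_def abs_mult tent_nonneg)
      also have "\<dots> \<le> ?c * of_bool (0 < 2 ^ l * t - real k \<and> 2 ^ l * t - real k < 1)"
        by (rule mult_left_mono[OF tent]) simp
      finally have "\<bar>schauder l k t\<bar> \<le> ?c * of_bool (0 < 2 ^ l * t - real k \<and> 2 ^ l * t - real k < 1)" .
      then show "\<bar>schauder l k t * \<omega> (coord l k)\<bar>
          \<le> ?c * of_bool (0 < 2 ^ l * t - real k \<and> 2 ^ l * t - real k < 1) * ((T + 1) * (5 / 4) ^ l)"
        unfolding abs_mult using coord \<open>k \<in> _\<close> by (intro mult_mono) auto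
    qed
    also have "\<dots> = ?c * (\<Sum>k<2 ^ l. of_bool (0 < 2 ^ l * t - real k \<and> 2 ^ l * t - real k < 1)) * ((T + 1) * (5 / 4) ^ l)"
      by (simp only: sum_distrib_left sum_distrib_right)
    also have "\<dots> \<le> ?c * 1 * ((T + 1) * (5 / 4) ^ l)"
      using T0 by (intro mult_right_mono mult_left_mono sum_unit_interval_le) auto
    also have "\<dots> = (T + 1) / 2 * (5 / 4 * sqrt (1 / 2)) ^ l"
      by (simp add: power_mult_distrib real_sqrt_power[symmetric] power_divide)
    finally show ?thesis .
  qed
  then show ?thesis by (rule that)
qed

lemma geometric_ratio: "\<bar>5 / 4 * sqrt (1 / 2)\<bar> < (1 :: real)"
proof -
  have "sqrt (1 / 2) < 4 / (5 :: real)" by (rule real_less_lsqrt) (auto simp: power2_eq_square)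
  then show ?thesis by simp
qed

text \<open>The limit process must have continuous paths for every outcome, not just almost surely;
  hence the value 0 off the good set.\<close>

definition bridge :: "real \<Rightarrow> (real \<Rightarrow> real) \<Rightarrow> real" where
  "bridge t \<omega> = (if good \<omega> then \<Sum>l. layer l t \<omega> else 0)"

lemma bridge_measurable [measurable]: "bridge t \<in> borel_measurable gauss_space"
  unfolding bridge_def by measurable

lemma bridge_continuous: "continuous_on UNIV (\<lambda>t. bridge t \<omega>)"
proof (cases "good \<omega>")
  case True
  then obtain C where C: "\<And>l t. \<bar>layer l t \<omega>\<bar> \<le> C * (5 / 4 * sqrt (1 / 2)) ^ l" by (rule layer_bound) blast
  have "uniform_limit UNIV (\<lambda>n t. \<Sum>l<n. layer l t \<omega>) (\<lambda>t. \<Sum>l. layer l t \<omega>) sequentially"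
  proof (rule Weierstrass_m_test)
    show "summable (\<lambda>l. C * (5 / 4 * sqrt (1 / 2)) ^ l)"
      using geometric_ratio by (intro summable_mult summable_geometric) simp
  qed (use C in simp)
  then have "continuous_on UNIV (\<lambda>t. \<Sum>l. layer l t \<omega>)"
    by (rule uniform_limit_theorem[rotated]) (auto intro!: always_eventually continuous_intros layer_continuous)
  then show ?thesis using True by (simp add: bridge_def)
qed (simp add: bridge_def)

lemma bridge_sums:
  assumes "good \<omega>"
  shows "(\<lambda>n. \<Sum>l<n. layer l t \<omega>) \<longlonglongrightarrow> bridge t \<omega>"
proof -
  obtain C where C: "\<And>l t. \<bar>layer l t \<omega>\<bar> \<le> C * (5 / 4 * sqrt (1 / 2)) ^ l"
    using layer_bound[OF assms] by blast
  have "summable (\<lambda>l. layer l t \<omega>)"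
  proof (rule summable_comparison_test)
    show "\<exists>N. \<forall>n\<ge>N. norm (layer n t \<omega>) \<le> C * (5 / 4 * sqrt (1 / 2)) ^ n" using C by auto
    show "summable (\<lambda>l. C * (5 / 4 * sqrt (1 / 2)) ^ l)"
      using geometric_ratio by (intro summable_mult summable_geometric) simp
  qed
  then show ?thesis using assms unfolding bridge_def by (simp add: summable_LIMSEQ)
qed

text \<open>Finite partial sums of the series have explicit Gaussian characteristic functions. These
  converge by dominated convergence, and their variances by the Schauder expansion. Times may
  repeat, since \<open>u\<close> need not be injective.\<close>

lemma bridge_gaussian:
  fixes u a :: "'i \<Rightarrow> real"
  assumes J: "finite J"
  defines "W \<equiv> \<lambda>\<omega>. \<Sum>j\<in>J. a j * bridge (u j) \<omega>"
    and "v \<equiv> \<Sum>i\<in>J. \<Sum>j\<in>J. a i * a j * bridge_cov (u i) (u j)"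
  shows "normal_variable gauss_space W" "(\<integral>\<omega>. W \<omega> \<partial>gauss_space) = 0" "(\<integral>\<omega>. (W \<omega>)\<^sup>2 \<partial>gauss_space) = v"
proof -
  have Wm [measurable]: "W \<in> borel_measurable gauss_space" unfolding W_def by measurable
  define S where "S n \<omega> = (\<Sum>j\<in>J. a j * (\<Sum>l<n. layer l (u j) \<omega>))" for n \<omega>
  define I where "I n = (SIGMA l:{..<n}. {..<(2::nat) ^ l})" for n :: nat
  define \<gamma> where "\<gamma> p = (\<Sum>j\<in>J. a j * schauder (fst p) (snd p) (u j))" for p
  define v' where "v' n = (\<Sum>p\<in>I n. (\<gamma> p)\<^sup>2)" for n
  have I: "finite (I n)" for n by (simp add: I_def)
  have S: "S n \<omega> = (\<Sum>p\<in>I n. \<gamma> p * \<omega> (coord (fst p) (snd p)))" for n \<omega>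
  proof -
    have "S n \<omega> = (\<Sum>j\<in>J. \<Sum>p\<in>I n. a j * (schauder (fst p) (snd p) (u j) * \<omega> (coord (fst p) (snd p))))"
      unfolding S_def layer_def I_def by (simp add: sum.Sigma sum_distrib_left split_def)
    also have "\<dots> = (\<Sum>p\<in>I n. \<gamma> p * \<omega> (coord (fst p) (snd p)))"
      unfolding \<gamma>_def by (subst sum.swap) (simp add: sum_distrib_right mult.assoc)
    finally show ?thesis .
  qed
  have Sm [measurable]: "S n \<in> borel_measurable gauss_space" for n unfolding S_def by measurable
  have v'_eq: "v' n = (\<Sum>i\<in>J. \<Sum>j\<in>J. a i * a j * (\<Sum>l<n. \<Sum>k<2 ^ l. schauder l k (u i) * schauder l k (u j)))" for n
  proof -
    have "v' n = (\<Sum>p\<in>I n. \<Sum>i\<in>J. \<Sum>j\<in>J. a i * a j * (schauder (fst p) (snd p) (u i) * schauder (fst p) (snd p) (u j)))"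
      unfolding v'_def \<gamma>_def power2_eq_square sum_product by (intro sum.cong refl) (simp add: mult_ac)
    also have "\<dots> = (\<Sum>i\<in>J. \<Sum>j\<in>J. \<Sum>p\<in>I n. a i * a j * (schauder (fst p) (snd p) (u i) * schauder (fst p) (snd p) (u j)))"
      by (subst sum.swap) (intro sum.cong refl sum.swap)
    also have "\<dots> = (\<Sum>i\<in>J. \<Sum>j\<in>J. a i * a j * (\<Sum>l<n. \<Sum>k<2 ^ l. schauder l k (u i) * schauder l k (u j)))"
      unfolding I_def by (simp add: sum.Sigma sum_distrib_left split_def)
    finally show ?thesis .
  qed
  have v'_lim: "v' \<longlonglongrightarrow> v"
    unfolding v'_eq v_def by (intro tendsto_intros schauder_sum_tendsto)
  have v: "0 \<le> v"
    by (rule LIMSEQ_le_const[OF v'_lim]) (auto simp: v'_def intro!: sum_nonneg)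
  have char: "char (distr gauss_space borel W) \<theta> = of_real (exp (- v * \<theta>\<^sup>2 / 2))" for \<theta>
  proof (rule LIMSEQ_unique)
    have "(\<lambda>n. \<integral>\<omega>. iexp (\<theta> * S n \<omega>) \<partial>gauss_space) \<longlonglongrightarrow> (\<integral>\<omega>. iexp (\<theta> * W \<omega>) \<partial>gauss_space)"
    proof (rule integral_dominated_convergence[where w = "\<lambda>_. 1"])
      show "AE \<omega> in gauss_space. (\<lambda>n. iexp (\<theta> * S n \<omega>)) \<longlonglongrightarrow> iexp (\<theta> * W \<omega>)"
        using AE_good
      proof eventually_elim
        case (elim \<omega>)
        show ?case unfolding S_def W_def by (intro tendsto_intros bridge_sums[OF elim])
      qed
    qed auto
    then show "(\<lambda>n. char (distr gauss_space borel (S n)) \<theta>) \<longlonglongrightarrow> char (distr gauss_space borel W) \<theta>"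
      unfolding char_def by (simp add: integral_distr)
    have "char (distr gauss_space borel (S n)) \<theta> = of_real (exp (- v' n * \<theta>\<^sup>2 / 2))" for n
      unfolding S[abs_def] v'_def
      by (rule char_coordinate_sum[OF I]) (auto simp: inj_on_def coord_def)
    moreover have "(\<lambda>n. complex_of_real (exp (- v' n * \<theta>\<^sup>2 / 2))) \<longlonglongrightarrow> of_real (exp (- v * \<theta>\<^sup>2 / 2))"
      by (intro tendsto_intros v'_lim) auto
    ultimately show "(\<lambda>n. char (distr gauss_space borel (S n)) \<theta>) \<longlonglongrightarrow> of_real (exp (- v * \<theta>\<^sup>2 / 2))"
      by simp
  qed
  show "normal_variable gauss_space W" "(\<integral>\<omega>. W \<omega> \<partial>gauss_space) = 0" "(\<integral>\<omega>. (W \<omega>)\<^sup>2 \<partial>gauss_space) = v"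
    by (rule normal_of_char[OF G.prob_space_axioms Wm v char])+
qed

subsection \<open>Time change\<close>

text \<open>A sum of squares without a common zero: the process is thereby defined at time 1 as
  well, where t^2 / (1 - t)^2 has a pole.\<close>

definition scale :: "real \<Rightarrow> real" where
  "scale t = t\<^sup>2 + (1 - t)\<^sup>2"

text \<open>Writing a Brownian bridge as \<open>(1 - x) * B (x / (1 - x))\<close> for a Brownian motion \<open>B\<close>, this time
  change gives the process \<open>(1 - t)\<^sup>2 * B (t\<^sup>2 / (1 - t)\<^sup>2)\<close>.\<close>

definition time_change :: "real \<Rightarrow> real" where
  "time_change t = t\<^sup>2 / scale t"

lemma scale_pos: "0 < scale t"
  unfolding scale_def by (cases "t = 0") (auto simp: add_pos_nonneg)

lemma scaled_bridge_cov:
  assumes "0 \<le> s" "s \<le> t" "t \<le> 1"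
  shows "scale s * scale t * bridge_cov (time_change s) (time_change t) = s\<^sup>2 * (1 - t)\<^sup>2"
proof -
  \<comment> \<open>The complement has the same denominator, so in the bridge covariance both
    denominators cancel against the two scales.\<close>
  have c: "1 - time_change t = (1 - t)\<^sup>2 / scale t" for t
    using scale_pos[of t] by (simp add: time_change_def scale_def field_simps)
  have "s * (1 - t) \<le> t * (1 - s)" using assms by (simp add: algebra_simps)
  then have "(s * (1 - t))\<^sup>2 \<le> (t * (1 - s))\<^sup>2" using assms by (intro power_mono) auto
  then have "s\<^sup>2 * (1 - t)\<^sup>2 \<le> t\<^sup>2 * (1 - s)\<^sup>2" by (simp only: power_mult_distrib)
  then have "s\<^sup>2 * scale t \<le> t\<^sup>2 * scale s" by (simp add: scale_def distrib_left mult.commute)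
  then have le: "time_change s \<le> time_change t"
    unfolding time_change_def using scale_pos[of s] scale_pos[of t] by (simp add: divide_le_eq pos_le_divide_eq mult.commute)
  have "0 \<le> time_change s" unfolding time_change_def using scale_pos[of s] by simp
  moreover have "0 \<le> 1 - time_change t" unfolding c using scale_pos[of t] by simp
  ultimately have "bridge_cov (time_change s) (time_change t) = time_change s * (1 - time_change t)"
    using le by (simp add: bridge_cov_def min_absorb1 max_absorb2)
  also have "\<dots> = s\<^sup>2 / scale s * ((1 - t)\<^sup>2 / scale t)" unfolding c by (simp add: time_change_def)
  finally show ?thesis using scale_pos[of s] scale_pos[of t] by (simp add: field_simps)
qed

definition bridge_process :: "real \<Rightarrow> (real \<Rightarrow> real) \<Rightarrow> real" where
  "bridge_process t \<omega> = scale t * bridge (time_change t) \<omega>"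

lemma bridge_process_gaussian:
  fixes u a :: "'i \<Rightarrow> real"
  assumes "finite J"
  shows "normal_variable gauss_space (\<lambda>\<omega>. \<Sum>j\<in>J. a j * bridge_process (u j) \<omega>)"
    "(\<integral>\<omega>. (\<Sum>j\<in>J. a j * bridge_process (u j) \<omega>) \<partial>gauss_space) = 0"
    "(\<integral>\<omega>. (\<Sum>j\<in>J. a j * bridge_process (u j) \<omega>)\<^sup>2 \<partial>gauss_space)
      = (\<Sum>i\<in>J. \<Sum>j\<in>J. a i * a j * (scale (u i) * scale (u j) * bridge_cov (time_change (u i)) (time_change (u j))))"
  using bridge_gaussian[OF assms, of "\<lambda>j. a j * scale (u j)" "\<lambda>j. time_change (u j)"]
  by (simp_all add: bridge_process_def mult_ac)

lemma limit_process_bridge: "limit_process gauss_space bridge_process"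
  unfolding limit_process_def gaussian_process_def
proof (intro conjI ballI allI impI)
  show "prob_space gauss_space" by (rule G.prob_space_axioms)
  show "bridge_process t \<in> borel_measurable gauss_space" for t
    unfolding bridge_process_def by measurable
  show "normal_variable gauss_space (\<lambda>\<omega>. \<Sum>t\<in>F. a t * bridge_process t \<omega>)" if "finite F \<and> F \<subseteq> {0..1}" for F a
    using bridge_process_gaussian(1)[of F a "\<lambda>t. t"] that by simp
  show "continuous_on {0..1} (\<lambda>t. bridge_process t \<omega>)" for \<omega>
  proof -
    have "continuous_on {0..1} time_change"
      unfolding time_change_def using scale_pos by (intro continuous_intros) (auto simp: scale_def less_imp_neq[THEN not_sym] intro!: continuous_intros)
    then have "continuous_on {0..1} (\<lambda>t. bridge (time_change t) \<omega>)"
      by (rule continuous_on_compose2[OF bridge_continuous]) simp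
    then show ?thesis unfolding bridge_process_def scale_def by (intro continuous_intros)
  qed
  show "(\<integral>\<omega>. bridge_process t \<omega> \<partial>gauss_space) = 0" for t
    using bridge_process_gaussian(2)[of "{()}" "\<lambda>_. 1" "\<lambda>_. t"] by simp
  fix s t :: real assume st: "0 \<le> s \<and> s \<le> t \<and> t \<le> 1"
  let ?K = "\<lambda>s t. scale s * scale t * bridge_cov (time_change s) (time_change t)"
  let ?x = "bridge_process s" and ?y = "bridge_process t"
  have sq: "integrable gauss_space (\<lambda>\<omega>. (bridge_process t \<omega>)\<^sup>2)" "(\<integral>\<omega>. (bridge_process t \<omega>)\<^sup>2 \<partial>gauss_space) = ?K t t" for t
    using bridge_process_gaussian(3)[of "{()}" "\<lambda>_. 1" "\<lambda>_. t"]
      normal_variable_facts(2)[OF G.prob_space_axioms bridge_process_gaussian(1)[of "{()}" "\<lambda>_. 1" "\<lambda>_. t"]] by simp_all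
  \<comment> \<open>Polarisation of the variance. The two times are indexed by \<open>bool\<close>
    because the set of them would have only one element for \<open>s = t\<close>.\<close>
  define u where "u b = (if b then s else t)" for b
  have sum2: "(\<Sum>b\<in>UNIV. g b) = g True + g False" for g :: "bool \<Rightarrow> real" by (simp add: UNIV_bool)
  note two = bridge_process_gaussian[of "UNIV :: bool set" "\<lambda>_. 1" u]
  have i2: "integrable gauss_space (\<lambda>\<omega>. (?x \<omega> + ?y \<omega>)\<^sup>2)"
    using normal_variable_facts(2)[OF G.prob_space_axioms two(1)] by (simp add: sum2 u_def)
  have comm: "?K t s = ?K s t" by (simp add: bridge_cov_def min.commute max.commute)
  have e2: "(\<integral>\<omega>. (?x \<omega> + ?y \<omega>)\<^sup>2 \<partial>gauss_space) = ?K s s + 2 * ?K s t + ?K t t"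
    using two(3) comm by (simp add: sum2 u_def)
  have "(\<integral>\<omega>. ?x \<omega> * ?y \<omega> \<partial>gauss_space) = (\<integral>\<omega>. ((?x \<omega> + ?y \<omega>)\<^sup>2 - (?x \<omega>)\<^sup>2 - (?y \<omega>)\<^sup>2) / 2 \<partial>gauss_space)"
    by (rule Bochner_Integration.integral_cong) (simp_all add: power2_sum)
  also have "\<dots> = ((\<integral>\<omega>. (?x \<omega> + ?y \<omega>)\<^sup>2 \<partial>gauss_space) - (\<integral>\<omega>. (?x \<omega>)\<^sup>2 \<partial>gauss_space) - (\<integral>\<omega>. (?y \<omega>)\<^sup>2 \<partial>gauss_space)) / 2"
    using i2 sq(1) by simp
  also have "\<dots> = ?K s t" unfolding e2 sq(2) by simp
  also have "\<dots> = s\<^sup>2 * (1 - t)\<^sup>2" using st by (intro scaled_bridge_cov) auto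
  finally show "(\<integral>\<omega>. ?x \<omega> * ?y \<omega> \<partial>gauss_space) = s\<^sup>2 * (1 - t)\<^sup>2" .
qed

theorem theorem1p5:
  shows "(\<exists>(M :: (real \<Rightarrow> real) measure) Z. limit_process M Z) \<and>
    (\<forall>(M :: 'v measure) Z. limit_process M Z \<longrightarrow>
       converges_in_distribution random_perm (\<lambda>n \<sigma>. cadlag_path (scaled_runs n \<sigma>))
         M (\<lambda>\<omega>. cadlag_path (\<lambda>t. Z t \<omega>)))"
  using limit_process_bridge scaled_runs_converges by blast

end
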